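(* Let $F\colon\mathcal{S}^n\to\overline{\mathbb{R}}$ be elliptic at $0$ and not identically $0$. Then the following are equivalent. (i) The comparison principle holds for the equation $F(\mathcal{H}w)=0$ in any open and bounded $\Omega\subseteq\mathbb{R}^n$. (ii) The set $\Gamma_0:=\{X\in\mathcal{S}^n : F(X)=0\}$ does not contain an open ball. (iii) For all $X\in\mathcal{S}^n$, $\ \sup\{t\in\mathbb{R} : X+tI\in\Theta_-\}=\inf\{t\in\mathbb{R} : X+tI\in\Theta_+\}$. (iv) $F(X_0-tI)<0<F(X_0+tI)$ for all $X_0\in\Gamma_0$ and all $t>0$. (v) The sets $\overline{\Theta}_+$ and $-\overline{\Theta}_-$ are duals. (vi) $\partial\Theta_-=\partial\Theta_+$.
   Context: $\mathcal{S}^n$ is the space of real symmetric $n\times n$ matrices with its usual partial order ($X\le Y$ iff $Y-X$ is positive semidefinite), $\overline{\mathbb{R}}=\mathbb{R}\cup\{-\infty,\infty\}$, and $\mathcal{H}w$ is the Hessian matrix of $w$. $F$ is elliptic at $0$ if for all $X\le Y$ in $\mathcal{S}^n$: $0\le F(X)$ implies $0\le F(Y)$, and $0<F(X)$ implies $0<F(Y)$. $\Theta_-:=\{X\in\mathcal{S}^n : F(X)\le0\}$, $\Theta_+:=\{X\in\mathcal{S}^n : F(X)\ge0\}$; overline, $\partial$ and ${}^\circ$ denote closure, boundary and interior in $\mathcal{S}^n$. Conventions: $\sup\emptyset=-\infty$, $\inf\emptyset=+\infty$. The dual of a set $\Theta\subseteq\mathcal{S}^n$ is $\widetilde\Theta:=-(\mathcal{S}^n\setminus\Theta^\circ)=\{X\in\mathcal{S}^n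 : -X\notin\Theta^\circ\}$; (v) means that $\overline\Theta_+$ is the dual of $-\overline\Theta_-$, i.e. $\overline\Theta_+=\mathcal{S}^n\setminus(\overline\Theta_-)^\circ$. Viscosity solutions: $v\in USC(\overline\Omega)$ is a viscosity subsolution of $F(\mathcal{H}w)=0$ in $\Omega$ if, whenever $x_0\in\Omega$ and $\phi$ is a $C^2$ function near $x_0$ with $\phi(x_0)=v(x_0)$ and $\phi\ge v$ near $x_0$, then $F(\mathcal{H}\phi(x_0))\ge0$. $u\in LSC(\overline\Omega)$ is a viscosity supersolution if, whenever $\phi$ is $C^2$ near $x_0\in\Omega$ with $\phi(x_0)=u(x_0)$ and $\phi\le u$ near $x_0$, then $F(\mathcal{H}\phi(x_0))\le0$. ($USC$, $LSC$: real-valued upper/lower semicontinuous functions.) The comparison principle holds for the equation in $\Omega$ if: whenever $v\in USC(\overline\Omega)$ is a viscosity subsolution and $u\in LSC(\overline\Omega)$ is a viscosity supersolution in $\Omega$ with $v\le u$ on $\partial\Omega$, then $v\le u$ in $\Omega$. *)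

theory Defs
  imports "HOL-Analysis.Analysis"
begin

text \<open>
  The space of real symmetric matrices is the carrier set \<open>Sym\<close> inside \<^typ>\<open>real^'n^'n\<close>. An operator
  is a total function on all matrices, but only its values on \<open>Sym\<close> are ever used. Topological
  notions in the space of symmetric matrices are those of the subspace topology
  \<open>top_of_set Sym\<close> (\<open>Sym\<close> has empty interior in \<^typ>\<open>real^'n^'n\<close> in general).
\<close>

definition Sym :: "(real^'n^'n) set" where
  "Sym = {X. transpose X = X}"

definition psd :: "real^'n^'n \<Rightarrow> bool" where
  "psd A \<longleftrightarrow> A \<in> Sym \<and> (\<forall>v. 0 \<le> v \<bullet> (A *v v))"

definition loewner_le :: "real^'n^'n \<Rightarrow> real^'n^'n \<Rightarrow> bool" where
  "loewner_le X Y \<longleftrightarrow> psd (Y - X)"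

definition elliptic_at_0 :: "(real^'n^'n \<Rightarrow> ereal) \<Rightarrow> bool" where
  "elliptic_at_0 F \<longleftrightarrow>
     (\<forall>X\<in>Sym. \<forall>Y\<in>Sym. loewner_le X Y \<longrightarrow>
        (0 \<le> F X \<longrightarrow> 0 \<le> F Y) \<and> (0 < F X \<longrightarrow> 0 < F Y))"

definition Theta_minus :: "(real^'n^'n \<Rightarrow> ereal) \<Rightarrow> (real^'n^'n) set" where
  "Theta_minus F = {X\<in>Sym. F X \<le> 0}"

definition Theta_plus :: "(real^'n^'n \<Rightarrow> ereal) \<Rightarrow> (real^'n^'n) set" where
  "Theta_plus F = {X\<in>Sym. F X \<ge> 0}"

definition Gamma_0 :: "(real^'n^'n \<Rightarrow> ereal) \<Rightarrow> (real^'n^'n) set" where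
  "Gamma_0 F = {X\<in>Sym. F X = 0}"

definition dual_set :: "(real^'n^'n) set \<Rightarrow> (real^'n^'n) set" where
  "dual_set \<Theta> = uminus ` (Sym - (top_of_set Sym interior_of \<Theta>))"

definition usc_on :: "'a::topological_space set \<Rightarrow> ('a \<Rightarrow> real) \<Rightarrow> bool" where
  "usc_on S f \<longleftrightarrow> (\<forall>x\<in>S. \<forall>a. f x < a \<longrightarrow> (\<forall>\<^sub>F y in at x within S. f y < a))"

definition lsc_on :: "'a::topological_space set \<Rightarrow> ('a \<Rightarrow> real) \<Rightarrow> bool" where
  "lsc_on S f \<longleftrightarrow> (\<forall>x\<in>S. \<forall>a. a < f x \<longrightarrow> (\<forall>\<^sub>F y in at x within S. a < f y))"

definition pderiv_at :: "'n \<Rightarrow> (real^'n \<Rightarrow> real) \<Rightarrow> real^'n \<Rightarrow> real" where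
  "pderiv_at i f x = frechet_derivative f (at x) (axis i 1)"

definition hessian :: "(real^'n \<Rightarrow> real) \<Rightarrow> real^'n \<Rightarrow> real^'n^'n" where
  "hessian f x = (\<chi> i j. pderiv_at i (pderiv_at j f) x)"

text \<open>
  The differentiability conditions make the Frechet derivatives used in \<open>pderiv_at\<close> meaningful;
  continuity of the function and its first order partial derivatives follows from them.
\<close>

definition C2_near :: "(real^'n \<Rightarrow> real) \<Rightarrow> real^'n \<Rightarrow> bool" where
  "C2_near f x0 \<longleftrightarrow>
     (\<exists>U. open U \<and> x0 \<in> U \<and> f differentiable_on U \<and>
        (\<forall>j. pderiv_at j f differentiable_on U) \<and>
        (\<forall>i j. continuous_on U (pderiv_at i (pderiv_at j f))))"

definition viscosity_subsolution ::
  "(real^'n^'n \<Rightarrow> ereal) \<Rightarrow> (real^'n) set \<Rightarrow> (real^'n \<Rightarrow> real) \<Rightarrow> bool" where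
  "viscosity_subsolution F \<Omega> v \<longleftrightarrow> usc_on (closure \<Omega>) v \<and>
     (\<forall>x0\<in>\<Omega>. \<forall>\<phi>. C2_near \<phi> x0 \<and> \<phi> x0 = v x0 \<and> (\<forall>\<^sub>F x in nhds x0. \<phi> x \<ge> v x)
        \<longrightarrow> F (hessian \<phi> x0) \<ge> 0)"

definition viscosity_supersolution ::
  "(real^'n^'n \<Rightarrow> ereal) \<Rightarrow> (real^'n) set \<Rightarrow> (real^'n \<Rightarrow> real) \<Rightarrow> bool" where
  "viscosity_supersolution F \<Omega> u \<longleftrightarrow> lsc_on (closure \<Omega>) u \<and>
     (\<forall>x0\<in>\<Omega>. \<forall>\<phi>. C2_near \<phi> x0 \<and> \<phi> x0 = u x0 \<and> (\<forall>\<^sub>F x in nhds x0. \<phi> x \<le> u x)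
        \<longrightarrow> F (hessian \<phi> x0) \<le> 0)"

definition comparison_principle :: "(real^'n^'n \<Rightarrow> ereal) \<Rightarrow> (real^'n) set \<Rightarrow> bool" where
  "comparison_principle F \<Omega> \<longleftrightarrow>
     (\<forall>v u. viscosity_subsolution F \<Omega> v \<and> viscosity_supersolution F \<Omega> u \<and>
        (\<forall>x\<in>frontier \<Omega>. v x \<le> u x) \<longrightarrow> (\<forall>x\<in>\<Omega>. v x \<le> u x))"

definition all_equivalent :: "bool list \<Rightarrow> bool" where
  "all_equivalent Ps \<longleftrightarrow> (\<forall>P\<in>set Ps. \<forall>Q\<in>set Ps. P \<longleftrightarrow> Q)"

end

theory Submission
  imports Defs "HOL-Complex_Analysis.Great_Picard"
begin

text \<open>
  By ellipticity, each of (ii)--(vi) says that there are no \<open>X\<close> and \<open>t > 0\<close> with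
  \<open>F X \<ge> 0 \<ge> F (X + t I)\<close>; if there are, two quadratic polynomials with Hessians \<open>X\<close> and \<open>X + t I\<close>
  violate comparison in the unit ball.

  For the converse, suppose that \<open>v - u\<close> has a positive interior maximum. The sup-convolutions \<open>f\<close>, \<open>g\<close>
  of \<open>v + \<delta> |x|\<^sup>2 / 2\<close> and \<open>- u\<close> are semiconvex, and the set of points at which \<open>f + g\<close> minus a small
  linear function is maximal is not negligible (Jensen). Instead of Alexandrov's theorem, a compactness
  argument is used: a blow-up of \<open>f\<close> at a non-porous point of that set is a function \<open>h\<close> with Lipschitz
  gradient on the whole space such that \<open>h\<close> and \<open>- h\<close> inherit the two viscosity inequalities.
  Functions of this kind form a family that is closed under blow-ups and locally uniform limits, and
  maximising second differences in finitely many directions within it produces a quadratic polynomial.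
  Its Hessian \<open>A\<close> then satisfies both inequalities, which contradicts (iv).
\<close>

section \<open>Semiconvex functions and locally uniform limits\<close>

text \<open>\<open>F\<close> carries no continuity, so the conditions \<open>F X \<ge> 0\<close> and
  \<open>F X \<le> 0\<close> need not survive a limit of matrices. Two devices make up for this. The
  viscosity inequalities used inside the argument conclude only that A + \<eta> I is admissible for
  every \<eta> > 0, a form that passes to limits. And adding \<delta> |x|^2 / 2 to the subsolution
  separates the two conditions on the final matrix by \<delta>, which pays for these losses and
  still leaves a gap of positive length. A point where f and g lie between paraboloids has blow-ups
  that satisfy good bounds at the origin only. Non-porosity is what spreads these bounds over the
  whole space. This leaves one function, which matters because extremal second differences are
  computed for one family.\<close>

definition semiconvex :: "real \<Rightarrow> ('a::real_inner \<Rightarrow> real) \<Rightarrow> bool" where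
  "semiconvex K f \<longleftrightarrow> (\<forall>x. \<exists>a. \<forall>h. f x + a \<bullet> h - K * (norm h)\<^sup>2 \<le> f (x + h))"

text \<open>This is the class C^{1,1} in pointwise form: at each point a paraboloid above and one
  below share a tangent plane. Likewise \<open>semiconvex K f\<close> says that f + K |x|^2 is
  convex. In this form both are preserved, with the same K, by the blow-ups (f (x + r h) - c - a
  \<bullet> h) / r^2.\<close>

definition pinched :: "real \<Rightarrow> ('a::real_inner \<Rightarrow> real) \<Rightarrow> bool" where
  "pinched K f \<longleftrightarrow> (\<forall>x. \<exists>a. \<forall>h. \<bar>f (x + h) - f x - a \<bullet> h\<bar> \<le> K * (norm h)\<^sup>2)"

definition loc_unif_lim :: "(nat \<Rightarrow> 'a::real_normed_vector \<Rightarrow> real) \<Rightarrow> ('a \<Rightarrow> real) \<Rightarrow> bool" where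
  "loc_unif_lim fs f \<longleftrightarrow> (\<forall>R. uniform_limit (cball 0 R) fs f sequentially)"

lemma pinched_imp_semiconvex: "pinched K f \<Longrightarrow> semiconvex K f"
  unfolding pinched_def semiconvex_def
proof (intro allI)
  fix x assume "\<forall>x. \<exists>a. \<forall>h. \<bar>f (x + h) - f x - a \<bullet> h\<bar> \<le> K * (norm h)\<^sup>2"
  then obtain a where "\<And>h. \<bar>f (x + h) - f x - a \<bullet> h\<bar> \<le> K * (norm h)\<^sup>2" by blast
  then have "f x + a \<bullet> h - K * (norm h)\<^sup>2 \<le> f (x + h)" for h
    using abs_le_D2[of "f (x + h) - f x - a \<bullet> h"] by (smt (verit))
  then show "\<exists>a. \<forall>h. f x + a \<bullet> h - K * (norm h)\<^sup>2 \<le> f (x + h)" by blast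
qed

text \<open>The slope \<open>a\<close> of a supporting paraboloid is bounded by moving one unit in
  its own direction: the growth bound on the ball of radius R + 1 leaves no room for a larger slope.
  The support inequality then bounds f x - f y, and exchanging x and y gives the other sign.\<close>

lemma semiconvex_lipschitz:
  fixes f :: "'a::real_inner \<Rightarrow> real"
  assumes sc: "semiconvex K f" and bd: "\<And>x. \<bar>f x\<bar> \<le> K * (norm x)\<^sup>2"
    and K: "K \<ge> 0" and x: "norm x \<le> R" and y: "norm y \<le> R"
  shows "\<bar>f x - f y\<bar> \<le> (4 * K * (R + 1)\<^sup>2 + K) * norm (x - y)"
proof -
  have R: "R \<ge> 0" using x norm_ge_zero order_trans by blast
  have main: "f x - f y \<le> (4 * K * (R + 1)\<^sup>2 + K) * norm (x - y)"
    if x: "norm x \<le> R" and y: "norm y \<le> R" for x y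
  proof -
    obtain a where a: "\<And>h. f x + a \<bullet> h - K * (norm h)\<^sup>2 \<le> f (x + h)"
      using sc unfolding semiconvex_def by blast
    have na: "norm a \<le> 2 * K * (R + 1)\<^sup>2 + K"
    proof (cases "a = 0")
      case False
      have "f x + a \<bullet> sgn a - K \<le> f (x + sgn a)" using a[of "sgn a"] False by (simp add: norm_sgn)
      moreover have "a \<bullet> sgn a = norm a"
        using False by (simp add: sgn_div_norm dot_square_norm power2_eq_square)
      moreover have "f (x + sgn a) \<le> K * (R + 1)\<^sup>2"
      proof -
        have "norm (x + sgn a) \<le> R + 1"
          using norm_triangle_ineq[of x "sgn a"] x False by (simp add: norm_sgn)
        then have "(norm (x + sgn a))\<^sup>2 \<le> (R + 1)\<^sup>2" by (intro power_mono) auto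
        then have "K * (norm (x + sgn a))\<^sup>2 \<le> K * (R + 1)\<^sup>2" using K by (intro mult_left_mono) auto
        then show ?thesis using bd[of "x + sgn a"] by linarith
      qed
      moreover have "- f x \<le> K * (R + 1)\<^sup>2"
      proof -
        have "(norm x)\<^sup>2 \<le> (R + 1)\<^sup>2" using x by (intro power_mono) auto
        then have "K * (norm x)\<^sup>2 \<le> K * (R + 1)\<^sup>2" using K by (intro mult_left_mono) auto
        then show ?thesis using bd[of x] by linarith
      qed
      ultimately show ?thesis by linarith
    qed (use K in auto)
    have "f x + a \<bullet> (y - x) - K * (norm (y - x))\<^sup>2 \<le> f y" using a[of "y - x"] by simp
    moreover have "- (a \<bullet> (y - x)) \<le> (2 * K * (R + 1)\<^sup>2 + K) * norm (x - y)"
    proof -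
      have "- (a \<bullet> (y - x)) \<le> norm a * norm (y - x)"
        using Cauchy_Schwarz_ineq2[of a "y - x"] by linarith
      also have "\<dots> \<le> (2 * K * (R + 1)\<^sup>2 + K) * norm (y - x)"
        using na by (intro mult_right_mono) auto
      finally show ?thesis by (simp add: norm_minus_commute)
    qed
    moreover have "K * (norm (y - x))\<^sup>2 \<le> 2 * K * (R + 1)\<^sup>2 * norm (x - y)"
    proof -
      have "norm (y - x) \<le> 2 * R" using norm_triangle_ineq4[of y x] x y by linarith
      moreover have "R \<le> (R + 1)\<^sup>2" using R by (simp add: power2_eq_square algebra_simps)
      ultimately have "norm (y - x) \<le> 2 * (R + 1)\<^sup>2" by linarith
      then have "norm (y - x) * norm (y - x) \<le> 2 * (R + 1)\<^sup>2 * norm (y - x)"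
        by (intro mult_right_mono) auto
      then have "K * (norm (y - x) * norm (y - x)) \<le> K * (2 * (R + 1)\<^sup>2 * norm (y - x))"
        using K by (intro mult_left_mono) auto
      then show ?thesis by (simp add: power2_eq_square norm_minus_commute mult.assoc mult.left_commute)
    qed
    ultimately show ?thesis by (simp add: algebra_simps)
  qed
  show ?thesis using main[OF x y] main[OF y x] by (simp add: norm_minus_commute abs_le_iff)
qed

text \<open>The Lipschitz bound passes to the pointwise limit, so convergence on a finite
  \<open>d\<close>-net of the ball suffices: moving to a net point, comparing there and moving back
  cost e / 4 each.\<close>

lemma lipschitz_imp_loc_unif_lim:
  fixes fs :: "nat \<Rightarrow> 'a::euclidean_space \<Rightarrow> real"
  assumes L: "\<And>R. R > 0 \<Longrightarrow> \<exists>L\<ge>0. \<forall>k x y. norm x \<le> R \<longrightarrow> norm y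
      \<le> R \<longrightarrow> \<bar>fs k x - fs k y\<bar> \<le> L * norm (x - y)"
    and lim: "\<And>x. (\<lambda>k. fs k x) \<longlonglongrightarrow> f x"
  shows "loc_unif_lim fs f"
  unfolding loc_unif_lim_def
proof
  fix R0 :: real
  define R where "R = max R0 1"
  have R: "R > 0" "cball 0 R0 \<subseteq> (cball 0 R :: 'a set)" unfolding R_def by auto
  obtain L where L0: "L \<ge> 0" and L1: "\<And>k x y. norm x \<le> R \<Longrightarrow> norm y \<le> R \<Longrightarrow> \<bar>fs k x - fs k y\<bar> \<le> L * norm (x - y)"
    using L[OF R(1)] by blast
  have Lf: "\<bar>f x - f y\<bar> \<le> L * norm (x - y)" if "norm x \<le> R" "norm y \<le> R" for x y
  proof (rule LIMSEQ_le_const2)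
    show "(\<lambda>k. \<bar>fs k x - fs k y\<bar>) \<longlonglongrightarrow> \<bar>f x - f y\<bar>" by (intro tendsto_intros lim)
  qed (use L1 that in blast)
  have "uniform_limit (cball 0 R) fs f sequentially"
  proof (rule uniform_limitI)
    fix e :: real assume e: "e > 0"
    define d where "d = e / (4 * (L + 1))"
    have d: "d > 0" using e L0 by (simp add: d_def)
    have Ld: "L * t \<le> e / 4" if "0 \<le> t" "t \<le> d" for t
    proof -
      have "L * t \<le> (L + 1) * d" using that L0 by (intro mult_mono) auto
      moreover have "(L + 1) * d = e / 4"
        using add_nonneg_pos[OF L0 zero_less_one] by (simp only: d_def times_divide_eq_right mult.commute[of 4] nonzero_mult_divide_mult_cancel_left)
      ultimately show ?thesis by simp
    qed
    have "cball 0 R \<subseteq> (\<Union>x\<in>cball 0 R. ball (x::'a) d)" using d by force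
    from compactE_image[OF compact_cball _ this]
    obtain N :: "'a set" where N: "N \<subseteq> cball 0 R" "finite N" "cball 0 R \<subseteq> (\<Union>x\<in>N. ball x d)"
      by (metis open_ball)
    have "\<forall>\<^sub>F k in sequentially. \<forall>z\<in>N. dist (fs k z) (f z) < e / 4"
      using N(2) tendstoD[OF lim, of "e / 4"] e by (intro eventually_ball_finite) auto
    then show "\<forall>\<^sub>F k in sequentially. \<forall>x\<in>cball 0 R. dist (fs k x) (f x) < e"
    proof eventually_elim
      case (elim k)
      show ?case
      proof
        fix x :: 'a assume x: "x \<in> cball 0 R"
        then obtain z where z: "z \<in> N" "x \<in> ball z d" using N(3) by blast
        have nz: "norm z \<le> R" and nx: "norm x \<le> R" using z(1) N(1) x by auto
        have xz: "norm (x - z) \<le> d" using z(2) by (simp add: dist_norm norm_minus_commute)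
        have "\<bar>fs k x - fs k z\<bar> \<le> e / 4" "\<bar>f x - f z\<bar> \<le> e / 4"
          using L1[OF nx nz, of k] Lf[OF nx nz] Ld[OF _ xz] by auto
        moreover have "\<bar>fs k z - f z\<bar> < e / 4" using elim z(1) by (auto simp: dist_real_def)
        ultimately show "dist (fs k x) (f x) < e" using e unfolding dist_real_def by linarith
      qed
    qed
  qed
  then show "uniform_limit (cball 0 R0) fs f sequentially" using R(2) uniform_limit_on_subset by blast
qed

text \<open>An Arzela-Ascoli argument: diagonal extraction on a countable dense set, then the common
  Lipschitz bound. The quadratic growth bound provides equicontinuity because semiconvexity turns it
  into \<open>semiconvex_lipschitz\<close>.\<close>

lemma semiconvex_compactness:
  fixes f :: "nat \<Rightarrow> 'a::euclidean_space \<Rightarrow> real"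
  assumes sc: "\<And>k. semiconvex K (f k)" and bd: "\<And>k x. \<bar>f k x\<bar> \<le> K * (norm x)\<^sup>2" and K: "K \<ge> 0"
  obtains r g where "strict_mono r" "loc_unif_lim (\<lambda>k. f (r k)) g"
proof -
  obtain D :: "'a set" where D: "countable D" "\<And>U. open U \<Longrightarrow> U \<noteq> {} \<Longrightarrow> \<exists>d\<in>D. d \<in> U"
    by (rule countable_dense_setE) blast
  \<comment> \<open>Division by 1 + |x|^2 turns the quadratic growth into the bound K, uniform in n
    and x, that \<open>function_convergent_subsequence\<close> asks for.\<close>
  have "norm (f n x / (1 + (norm x)\<^sup>2)) \<le> K" for n x
  proof -
    have "\<bar>f n x\<bar> \<le> K * (1 + (norm x)\<^sup>2)" using bd[of n x] K by (simp add: algebra_simps)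
    moreover have "1 + (norm x)\<^sup>2 > 0" by (smt (verit) zero_le_power2)
    ultimately show ?thesis by (simp add: abs_divide divide_le_eq)
  qed
  then obtain r where r: "strict_mono (r::nat\<Rightarrow>nat)"
    and l: "\<And>x. x \<in> D \<Longrightarrow> \<exists>l. (\<lambda>n. f (r n) x / (1 + (norm x)\<^sup>2)) \<longlonglongrightarrow> l"
    using function_convergent_subsequence[OF D(1), of "\<lambda>n x. f n x / (1 + (norm x)\<^sup>2)" K] by metis
  have cD: "Cauchy (\<lambda>n. f (r n) x)" if "x \<in> D" for x
  proof -
    from l[OF that] obtain l where "(\<lambda>n. f (r n) x / (1 + (norm x)\<^sup>2)) \<longlonglongrightarrow> l" ..
    then have "(\<lambda>n. (f (r n) x / (1 + (norm x)\<^sup>2)) * (1 + (norm x)\<^sup>2)) \<longlonglongrightarrow> l * (1 + (norm x)\<^sup>2)"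
      by (intro tendsto_intros)
    moreover have "1 + (norm x)\<^sup>2 \<noteq> 0" by (smt (verit) zero_le_power2)
    ultimately show ?thesis by (simp add: LIMSEQ_imp_Cauchy)
  qed
  have Lip: "\<exists>L\<ge>0. \<forall>k x y. norm x \<le> R \<longrightarrow> norm y \<le> R \<longrightarrow> \<bar>f (r k) x - f (r k) y\<bar> \<le> L * norm (x - y)" 
    if "R > 0" for R
    using semiconvex_lipschitz[OF sc bd K, where R=R] K
    by (intro exI[of _ "4 * K * (R + 1)\<^sup>2 + K"]) auto
  have C: "Cauchy (\<lambda>n. f (r n) x)" for x
  proof (rule metric_CauchyI)
    fix e :: real assume e: "e > 0"
    obtain L where L: "L \<ge> 0" "\<And>k u v. norm u \<le> norm x + 1 \<Longrightarrow> norm v \<le> norm x + 1 \<Longrightarrow>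
        \<bar>f (r k) u - f (r k) v\<bar> \<le> L * norm (u - v)"
      using Lip[of "norm x + 1"] by (metis add_nonneg_pos norm_ge_zero zero_less_one)
    define d where "d = min 1 (e / (4 * (L + 1)))"
    have d: "d > 0" using e L(1) by (simp add: d_def)
    obtain z where z: "z \<in> D" "z \<in> ball x d" using D(2)[of "ball x d"] d by auto
    have zx: "norm (x - z) < d" using z(2) by (simp add: dist_norm)
    have nz: "norm z \<le> norm x + 1" using zx norm_triangle_ineq4[of x "x - z"] by (simp add: d_def)
    have le: "\<bar>f (r k) x - f (r k) z\<bar> \<le> e / 4" for k
    proof -
      have "L * norm (x - z) \<le> (L + 1) * (e / (4 * (L + 1)))"
        using zx L(1) by (intro mult_mono) (auto simp: d_def)
      also have "\<dots> = e / 4"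
        using add_nonneg_pos[OF L(1) zero_less_one] by (simp only: times_divide_eq_right mult.commute[of 4] nonzero_mult_divide_mult_cancel_left)
      finally show ?thesis using L(2)[of x z k] nz by auto
    qed
    obtain M where M: "\<And>m n. m \<ge> M \<Longrightarrow> n \<ge> M \<Longrightarrow> dist (f (r m) z) (f (r n) z) < e / 4"
      using metric_CauchyD[OF cD[OF z(1)], of "e / 4"] e by auto
    have "dist (f (r m) x) (f (r n) x) < e" if "m \<ge> M" "n \<ge> M" for m n
      using M[OF that] le[of m] le[of n] e unfolding dist_real_def by linarith
    then show "\<exists>M. \<forall>m\<ge>M. \<forall>n\<ge>M. dist (f (r m) x) (f (r n) x) < e" by blast
  qed
  define g where "g x = lim (\<lambda>n. f (r n) x)" for x
  have "(\<lambda>n. f (r n) x) \<longlonglongrightarrow> g x" for x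
    using C[of x] unfolding g_def by (simp add: Cauchy_convergent convergent_LIMSEQ_iff[symmetric])
  then have "loc_unif_lim (\<lambda>k. f (r k)) g"
    using Lip by (rule lipschitz_imp_loc_unif_lim[rotated])
  with r show ?thesis using that by blast
qed

lemma loc_unif_limD:
  assumes "loc_unif_lim fs f" shows "(\<lambda>k. fs k x) \<longlonglongrightarrow> f x"
proof -
  have "x \<in> cball 0 (norm x)" by simp
  then show ?thesis using assms unfolding loc_unif_lim_def
    by (intro tendsto_uniform_limitI[where S = "cball 0 (norm x)"]) auto
qed

text \<open>The map \<open>k\<close> need not be monotone: the indices supplied by the density of
  rescaled contact sets come only with \<open>k j \<ge> j\<close>.\<close>

lemma loc_unif_lim_reindex:
  assumes "loc_unif_lim fs f" "\<And>j. k j \<ge> j" shows "loc_unif_lim (\<lambda>j. fs (k j)) f"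
proof -
  have "filterlim k sequentially sequentially"
    by (rule filterlim_at_top_mono[OF filterlim_ident]) (simp add: assms(2))
  then show ?thesis using assms(1) filterlim_compose unfolding loc_unif_lim_def by blast
qed

lemma loc_unif_lim_subseq:
  "loc_unif_lim fs f \<Longrightarrow> strict_mono r \<Longrightarrow> loc_unif_lim (\<lambda>k. fs (r k)) f"
  using loc_unif_lim_reindex[of fs f r] seq_suble by blast

lemma loc_unif_lim_continuous:
  fixes f :: "'a::euclidean_space \<Rightarrow> real"
  assumes "loc_unif_lim fs f" and "\<And>k. continuous_on UNIV (fs k)"
  shows "continuous_on UNIV f"
proof -
  have "isCont f x" for x
  proof -
    have "continuous_on (cball 0 (norm x + 1)) f"
    proof (rule uniform_limit_theorem[where F = sequentially and f = fs])
      show "\<forall>\<^sub>F n in sequentially. continuous_on (cball 0 (norm x + 1)) (fs n)"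
        using continuous_on_subset[OF assms(2) subset_UNIV] by simp
    qed (use assms(1) in \<open>simp_all add: loc_unif_lim_def\<close>)
    moreover have "x \<in> interior (cball 0 (norm x + 1))" by simp
    ultimately show ?thesis by (rule continuous_on_interior)
  qed
  then show ?thesis by (simp add: continuous_at_imp_continuous_on)
qed

text \<open>Contact points move with the index. Uniform convergence absorbs the change of function,
  continuity of the limit the change of point.\<close>

lemma loc_unif_lim_moving:
  fixes f :: "'a::euclidean_space \<Rightarrow> real"
  assumes lim: "loc_unif_lim fs f" and "\<And>k. continuous_on UNIV (fs k)" and X: "X \<longlonglongrightarrow> x"
  shows "(\<lambda>k. fs k (X k)) \<longlonglongrightarrow> f x"
proof (rule LIMSEQ_I)
  fix e :: real assume e: "e > 0"
  have c: "(\<lambda>k. f (X k)) \<longlonglongrightarrow> f x"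
    using continuous_on_tendsto_compose[OF loc_unif_lim_continuous[OF lim assms(2)] X] by simp
  obtain B where B: "\<And>k. norm (X k) \<le> B" using convergent_imp_Bseq[OF convergentI[OF X]] by (metis Bseq_def)
  have "\<forall>\<^sub>F k in sequentially. \<forall>y\<in>cball 0 B. dist (fs k y) (f y) < e / 2"
    using lim e unfolding loc_unif_lim_def uniform_limit_iff by (meson half_gt_zero)
  moreover have "\<forall>\<^sub>F k in sequentially. dist (f (X k)) (f x) < e / 2"
    using tendstoD[OF c, of "e / 2"] e by simp
  ultimately have "\<forall>\<^sub>F k in sequentially. norm (fs k (X k) - f x) < e"
  proof eventually_elim
    case (elim k)
    then have "dist (fs k (X k)) (f (X k)) < e / 2" using B by auto
    then show ?case using elim(2) unfolding dist_norm real_norm_def by linarith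
  qed
  then show "\<exists>no. \<forall>n\<ge>no. norm (fs n (X n) - f x) < e" by (simp add: eventually_sequentially)
qed

lemma pinched_continuous: 
  fixes f :: "'a::real_inner \<Rightarrow> real"
  assumes "pinched K f" shows "continuous_on UNIV f"
proof -
  have "isCont f x" for x
  proof -
    obtain a where a: "\<And>h. \<bar>f (x + h) - f x - a \<bullet> h\<bar> \<le> K * (norm h)\<^sup>2"
      using assms unfolding pinched_def by blast
    have "((\<lambda>h. K * (norm (h::'a))\<^sup>2) \<longlongrightarrow> K * (norm (0::'a))\<^sup>2) (at 0)" by (intro tendsto_intros)
    then have "((\<lambda>h. K * (norm (h::'a))\<^sup>2) \<longlongrightarrow> 0) (at 0)" by simp
    then have "((\<lambda>h. f (x + h) - f x - a \<bullet> h) \<longlongrightarrow> 0) (at 0)"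
      by (rule Lim_null_comparison[rotated]) (use a in simp)
    moreover have "((\<lambda>h. f x + a \<bullet> h) \<longlongrightarrow> f x + a \<bullet> 0) (at 0)" by (intro tendsto_intros)
    ultimately have "((\<lambda>h. f (x + h) - f x - a \<bullet> h + (f x + a \<bullet> h)) \<longlongrightarrow> 0 + (f x + a \<bullet> 0)) (at 0)"
      by (rule tendsto_add)
    then have "((\<lambda>h. f (x + h)) \<longlongrightarrow> f x) (at 0)" by simp
    then show ?thesis by (simp add: isCont_iff)
  qed
  then show ?thesis by (simp add: continuous_at_imp_continuous_on)
qed

section \<open>Extremal second differences\<close>

text \<open>Constant and slope are arbitrary, so that a member can be normalised to vanish to first
  order at any chosen point without leaving the family; the common K then yields
  compactness.\<close>

definition blowup_closed :: "real \<Rightarrow> ('a::euclidean_space \<Rightarrow> real) set \<Rightarrow> bool" where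
  "blowup_closed K T \<longleftrightarrow> (\<forall>f\<in>T. pinched K f) \<and>
     (\<forall>f\<in>T. \<forall>x c a r. r > 0 \<longrightarrow> (\<lambda>h. (f (x + r *\<^sub>R h) - c - a \<bullet> h) / r\<^sup>2) \<in> T) \<and>
     (\<forall>fs f. (\<forall>k. fs k \<in> T) \<and> loc_unif_lim fs f \<longrightarrow> f \<in> T)"

text \<open>Iterated halving gives \<psi> t \<le> 2^n \<psi> (t / 2^n) \<le> C t^2 / 2^n, which
  tends to 0.\<close>

lemma half_subadditive_nonpos:
  fixes \<psi> :: "real \<Rightarrow> real"
  assumes half: "\<And>t. \<psi> t \<le> 2 * \<psi> (t / 2)" and quad: "\<And>t. \<psi> t \<le> C * t\<^sup>2"
  shows "\<psi> t \<le> 0"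
proof -
  have *: "\<psi> t \<le> 2 ^ n * \<psi> (t / 2 ^ n)" for n
  proof (induction n)
    case (Suc n)
    have "2 ^ n * \<psi> (t / 2 ^ n) \<le> 2 ^ n * (2 * \<psi> (t / 2 ^ n / 2))" by (intro mult_left_mono half) auto
    also have "\<dots> = 2 ^ Suc n * \<psi> (t / 2 ^ Suc n)" by (simp add: mult_ac)
    finally show ?case using Suc by linarith
  qed auto
  have "\<psi> t \<le> C * t\<^sup>2 * (1 / 2) ^ n" for n
  proof -
    have "2 ^ n * \<psi> (t / 2 ^ n) \<le> 2 ^ n * (C * (t / 2 ^ n)\<^sup>2)" by (intro mult_left_mono quad) auto
    also have "\<dots> = C * t\<^sup>2 * (1 / 2) ^ n" by (simp add: power_divide power2_eq_square field_simps)
    finally show ?thesis using *[of n] by linarith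
  qed
  moreover have "(\<lambda>n. C * t\<^sup>2 * (1 / 2 :: real) ^ n) \<longlonglongrightarrow> C * t\<^sup>2 * 0"
    by (intro tendsto_intros) auto
  ultimately show ?thesis using LIMSEQ_le_const[of _ "C * t\<^sup>2 * 0" "\<psi> t"] by auto
qed

text \<open>If \<xi> a < \<xi> b, concavity repeats at least this loss in every further step of the
  progression b + k (a - b), so that \<xi> would tend to minus infinity.\<close>

lemma midconcave_bounded_below_const:
  fixes \<xi> :: "real \<Rightarrow> real"
  assumes mid: "\<And>t s. \<xi> (t + s) + \<xi> (t - s) \<le> 2 * \<xi> t" and bd: "\<And>t. M \<le> \<xi> t"
  shows "\<xi> a = \<xi> b"
proof -
  have "\<xi> b \<le> \<xi> a" for a b
  proof (rule ccontr)
    assume "\<not> \<xi> b \<le> \<xi> a"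
    then have \<delta>: "\<xi> b - \<xi> a > 0" by simp
    define u where "u k = \<xi> (b + real k * (a - b))" for k
    have step: "u (Suc k) - u k \<le> \<xi> a - \<xi> b" for k
    proof (induction k)
      case (Suc k)
      have "u (Suc (Suc k)) + u k \<le> 2 * u (Suc k)"
        using mid[of "b + real (Suc k) * (a - b)" "a - b"] by (simp add: u_def algebra_simps)
      then show ?case using Suc by linarith
    qed (simp add: u_def)
    have le: "u k \<le> \<xi> b - real k * (\<xi> b - \<xi> a)" for k
    proof (induction k)
      case (Suc k) then show ?case using step[of k] by (simp add: algebra_simps)
    qed (simp add: u_def)
    obtain n where "real n * (\<xi> b - \<xi> a) > \<xi> b - M" using \<delta> reals_Archimedean3 by blast
    then show False using le[of n] bd[of "b + real n * (a - b)"] unfolding u_def by linarith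
  qed
  then show ?thesis by (meson order_antisym)
qed

text \<open>Among all members of the family, one that maximises the second difference in direction \<open>e\<close>
  satisfies \<open>f'' = s\<close> along a segment; its blow-ups at the midpoint satisfy this on a line. Adding the
  values at two points symmetric to that line gives a concave function on \<open>\<real>\<close> that is bounded from
  below, hence constant, which propagates the identity to the whole space.\<close>

lemma extremal_direction:
  fixes e :: "'a::euclidean_space"
  assumes bc: "blowup_closed K T" and ne: "T \<noteq> {}" and K: "K \<ge> 0"
  obtains f s where "f \<in> T" "\<And>x t. f (x + t *\<^sub>R e) + f (x - t *\<^sub>R e) - 2 * f x = s * t\<^sup>2"
proof -
  have pin: "pinched K f" if "f \<in> T" for f using bc that unfolding blowup_closed_def by blast
  have resc: "(\<lambda>h. (f (x + r *\<^sub>R h) - c - a \<bullet> h) / r\<^sup>2) \<in> T" if "f \<in> T" "r > 0" for f x c a r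
    using bc that unfolding blowup_closed_def by blast
  have lim: "f \<in> T" if "\<And>k. fs k \<in> T" "loc_unif_lim fs f" for fs f
    using bc that unfolding blowup_closed_def by blast
  have compact: "\<exists>r g. strict_mono r \<and> g \<in> T \<and> (\<forall>x. (\<lambda>k. fs (r k) x) \<longlonglongrightarrow> g x)"
    if "\<And>k. fs k \<in> T" "\<And>k x. \<bar>fs k x\<bar> \<le> K * (norm x)\<^sup>2" for fs :: "nat \<Rightarrow> 'a \<Rightarrow> real"
  proof -
    note fs = that
    obtain r g where "strict_mono r" "loc_unif_lim (\<lambda>k. fs (r k)) g"
      by (rule semiconvex_compactness[OF pinched_imp_semiconvex[OF pin[OF fs(1)]] fs(2) K])
    moreover have "g \<in> T" by (rule lim[of "\<lambda>k. fs (r k)"]) (fact fs(1), fact)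
    moreover have "(\<lambda>k. fs (r k) x) \<longlonglongrightarrow> g x" for x by (rule loc_unif_limD) fact
    ultimately show ?thesis by blast
  qed
  define D where "D f = f e + f (- e) - 2 * f 0" for f :: "'a \<Rightarrow> real"
  \<comment> \<open>Subtracting the tangent plane at 0 leaves the second difference at 0 unchanged
    and provides the growth bound that compactness requires.\<close>
  have norm_ex: "\<exists>g\<in>T. (\<forall>x. \<bar>g x\<bar> \<le> K * (norm x)\<^sup>2) \<and> D g = D f" if f: "f \<in> T" for f
  proof -
    obtain a where a: "\<And>h. \<bar>f (0 + h) - f 0 - a \<bullet> h\<bar> \<le> K * (norm h)\<^sup>2"
      using pin[OF f] unfolding pinched_def by blast
    have "(\<lambda>h. (f (0 + 1 *\<^sub>R h) - f 0 - a \<bullet> h) / 1\<^sup>2) \<in> T" by (rule resc[OF f]) simp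
    then show ?thesis using a by (intro bexI[where x="\<lambda>h. f h - f 0 - a \<bullet> h"]) (auto simp: D_def)
  qed
  have Dbd: "\<bar>D f\<bar> \<le> 2 * K * (norm e)\<^sup>2" if f: "f \<in> T" for f
  proof -
    obtain g where g: "\<And>x. \<bar>g x\<bar> \<le> K * (norm x)\<^sup>2" "D g = D f" using norm_ex[OF f] by blast
    show ?thesis using g(1)[of e] g(1)[of "- e"] g(1)[of 0] g(2) unfolding D_def by simp
  qed
  define S where "S = Sup (D ` T)"
  have bdd: "bdd_above (D ` T)" by (rule bdd_aboveI2[where M="2 * K * (norm e)\<^sup>2"]) (use Dbd abs_le_D1 in blast)
  have leS: "D f \<le> S" if "f \<in> T" for f unfolding S_def by (rule cSUP_upper[OF that bdd])
  have "\<exists>f\<in>T. (\<forall>x. \<bar>f x\<bar> \<le> K * (norm x)\<^sup>2) \<and> D f > S - 1 / real (Suc k)" for k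
  proof -
    have "S - 1 / real (Suc k) < S" by simp
    then obtain f where "f \<in> T" "D f > S - 1 / real (Suc k)"
      unfolding S_def using less_cSUP_iff[OF ne bdd] by blast
    then show ?thesis using norm_ex by metis
  qed
  then obtain F where F: "\<And>k. F k \<in> T" "\<And>k x. \<bar>F k x\<bar> \<le> K * (norm x)\<^sup>2" "\<And>k. D (F k) > S - 1 / real (Suc k)"
    by metis
  obtain r f0 where r: "strict_mono r" and f0: "f0 \<in> T" and l0: "\<And>x. (\<lambda>k. F (r k) x) \<longlonglongrightarrow> f0 x"
    using compact[of F] F by metis
  have f0bd: "\<bar>f0 x\<bar> \<le> K * (norm x)\<^sup>2" for x
    using LIMSEQ_le_const2[OF tendsto_rabs[OF l0[of x]]] F(2) by blast
  have Df0: "D f0 = S"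
  proof (rule antisym[OF leS[OF f0]])
    have "(\<lambda>k. S - 1 / real (Suc k)) \<longlonglongrightarrow> S - 0"
      by (intro tendsto_intros LIMSEQ_Suc lim_1_over_n)
    moreover have "(\<lambda>k. D (F (r k))) \<longlonglongrightarrow> D f0" unfolding D_def by (intro tendsto_intros l0)
    moreover have "S - 1 / real (Suc k) \<le> D (F (r k))" for k
    proof -
      have "1 / real (Suc (r k)) \<le> 1 / real (Suc k)"
        using seq_suble[OF r, of k] by (intro divide_left_mono) auto
      then show ?thesis using F(3)[of "r k"] by linarith
    qed
    ultimately show "S \<le> D f0" by (intro LIMSEQ_le[of _ S _ "D f0"]) auto
  qed
  \<comment> \<open>Rescaling by t about x extends the bound for \<open>D\<close> to all base points
    and step lengths: every member minus the parabola of curvature S is midpoint concave in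
    direction e.\<close>
  have sd: "f (x + t *\<^sub>R e) + f (x - t *\<^sub>R e) - 2 * f x \<le> S * t\<^sup>2" if f: "f \<in> T" for f x t
  proof -
    have pos: "f (x + t *\<^sub>R e) + f (x - t *\<^sub>R e) - 2 * f x \<le> S * t\<^sup>2" if "t > 0" for t
    proof -
      have "D (\<lambda>h. (f (x + t *\<^sub>R h) - 0 - 0 \<bullet> h) / t\<^sup>2) \<le> S" by (intro leS resc f that)
      then have "(f (x + t *\<^sub>R e) + f (x - t *\<^sub>R e) - 2 * f x) / t\<^sup>2 \<le> S"
        by (simp add: D_def diff_divide_distrib add_divide_distrib)
      then show ?thesis using that by (simp add: divide_le_eq)
    qed
    consider "t > 0" | "t = 0" | "t < 0" by linarith
    then show ?thesis
    proof cases
      case 3 then show ?thesis using pos[of "- t"] by (simp add: algebra_simps)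
    qed (use pos in auto)
  qed
  \<comment> \<open>Midpoint concavity, \<psi> 0 = 0 and quadratic size at 0 give \<psi> \<le> 0.
    Since \<open>D f0 = S\<close> means \<psi> 1 + \<psi> (-1) = 0, both end values vanish.\<close>
  define \<psi> where "\<psi> t = f0 (t *\<^sub>R e) - S / 2 * t\<^sup>2" for t
  have mid: "\<psi> (t + s) + \<psi> (t - s) \<le> 2 * \<psi> t" for t s
    using sd[OF f0, of "t *\<^sub>R e" s] by (simp add: \<psi>_def algebra_simps power2_eq_square)
  have f00: "f0 0 = 0" using f0bd[of 0] by simp
  then have \<psi>0: "\<psi> 0 = 0" by (simp add: \<psi>_def)
  have \<psi>le: "\<psi> t \<le> 0" for t
  proof (rule half_subadditive_nonpos[of \<psi> "K * (norm e)\<^sup>2 + \<bar>S\<bar> / 2"])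
    show "\<psi> t \<le> 2 * \<psi> (t / 2)" for t using mid[of "t / 2" "t / 2"] \<psi>0 by simp
    show "\<psi> t \<le> (K * (norm e)\<^sup>2 + \<bar>S\<bar> / 2) * t\<^sup>2" for t
    proof -
      have "- (S / 2) * t\<^sup>2 \<le> \<bar>S\<bar> / 2 * t\<^sup>2" by (intro mult_right_mono) auto
      then show ?thesis using f0bd[of "t *\<^sub>R e"]
        by (simp add: \<psi>_def power_mult_distrib algebra_simps)
    qed
  qed
  have "\<psi> 1 + \<psi> (- 1) = 0" using Df0 f00 by (simp add: \<psi>_def D_def)
  then have \<psi>1: "\<psi> 1 = 0" "\<psi> (- 1) = 0" using \<psi>le[of 1] \<psi>le[of "- 1"] by auto
  have cont\<psi>: "continuous_on {-1..1} \<psi>"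
    unfolding \<psi>_def
    by (intro continuous_intros continuous_on_compose2[OF pinched_continuous[OF pin[OF f0]]]) auto
  have \<psi>z: "\<psi> t = 0" if "\<bar>t\<bar> \<le> 1" for t
  proof -
    obtain t1 where t1: "t1 \<in> {-1..1}" "\<And>t. t \<in> {-1..1} \<Longrightarrow> \<psi> t1 \<le> \<psi> t"
      using continuous_attains_inf[OF compact_Icc _ cont\<psi>] by auto
    \<comment> \<open>The nearer endpoint, reflected in the minimiser t1, stays inside [-1, 1];
      concavity then compares the minimum with the value 0 at that endpoint.\<close>
    have "\<psi> t1 \<ge> 0"
    proof (cases "t1 \<ge> 0")
      case True
      have "\<psi> 1 + \<psi> (t1 - (1 - t1)) \<le> 2 * \<psi> t1" using mid[of t1 "1 - t1"] by simp
      moreover have "\<psi> t1 \<le> \<psi> (t1 - (1 - t1))" using t1(1) True by (intro t1(2)) auto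
      ultimately show ?thesis using \<psi>1 by simp
    next
      case False
      have "\<psi> (t1 + (t1 + 1)) + \<psi> (- 1) \<le> 2 * \<psi> t1" using mid[of t1 "t1 + 1"] by simp
      moreover have "\<psi> t1 \<le> \<psi> (t1 + (t1 + 1))" using t1(1) False by (intro t1(2)) auto
      ultimately show ?thesis using \<psi>1 by simp
    qed
    then show ?thesis using t1(2)[of t] \<psi>le[of t] that by (simp add: abs_le_iff)
  qed
  \<comment> \<open>Magnification by k + 1 about 0 stretches the segment on which f0 is a parabola
    to |t| \<le> k + 1, so the limit is a parabola on the whole line.\<close>
  define G where "G k h = (f0 (0 + (1 / real (Suc k)) *\<^sub>R h) - 0 - 0 \<bullet> h) / (1 / real (Suc k))\<^sup>2" for k h
  have GT: "G k \<in> T" for k unfolding G_def by (rule resc[OF f0]) simp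
  have Gbd: "\<bar>G k h\<bar> \<le> K * (norm h)\<^sup>2" for k h
    using f0bd[of "(1 / real (Suc k)) *\<^sub>R h"] by (simp add: G_def power_mult_distrib power_divide abs_mult field_simps)
  obtain r1 f1 where r1: "strict_mono r1" and f1: "f1 \<in> T" and l1: "\<And>x. (\<lambda>k. G (r1 k) x) \<longlonglongrightarrow> f1 x"
    using compact[of G] GT Gbd by metis
  have line: "f1 (t *\<^sub>R e) = S / 2 * t\<^sup>2" for t
  proof (rule LIMSEQ_unique[OF l1])
    have "G k (t *\<^sub>R e) = S / 2 * t\<^sup>2" if "real k \<ge> \<bar>t\<bar>" for k
    proof -
      have "\<bar>t / real (Suc k)\<bar> \<le> 1" using that by (simp add: divide_le_eq)
      from \<psi>z[OF this] show ?thesis by (simp add: \<psi>_def G_def power_divide field_simps)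
    qed
    moreover obtain N where "real N \<ge> \<bar>t\<bar>" using real_arch_simple by blast
    moreover have "real (r1 k) \<ge> real N" if "k \<ge> N" for k using seq_suble[OF r1, of k] that by simp
    ultimately have "G (r1 k) (t *\<^sub>R e) = S / 2 * t\<^sup>2" if "k \<ge> N" for k
      using that order_trans by blast
    then have "\<forall>\<^sub>F k in sequentially. G (r1 k) (t *\<^sub>R e) = S / 2 * t\<^sup>2"
      unfolding eventually_sequentially by blast
    then show "(\<lambda>k. G (r1 k) (t *\<^sub>R e)) \<longlonglongrightarrow> S / 2 * t\<^sup>2"
      by (rule tendsto_eventually)
  qed
  have "f1 (y + s *\<^sub>R e) + f1 (y - s *\<^sub>R e) - 2 * f1 y = S * s\<^sup>2" for y s
  proof -
    \<comment> \<open>In the sum over y and -y the slope terms of the expansion around t e cancel,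
      which leaves a lower bound independent of t. Once \<xi> is constant, two second differences
      that are at most S s^2 each have the sum 2 S s^2, so both are equal to S s^2.\<close>
    define \<xi> where "\<xi> t = f1 (y + t *\<^sub>R e) + f1 (- y + t *\<^sub>R e) - S * t\<^sup>2" for t
    have "\<xi> a = \<xi> b" for a b
    proof (rule midconcave_bounded_below_const[of \<xi> "- (2 * K * (norm y)\<^sup>2)"])
      show "\<xi> (t + s) + \<xi> (t - s) \<le> 2 * \<xi> t" for t s
        using sd[OF f1, of "y + t *\<^sub>R e" s] sd[OF f1, of "- y + t *\<^sub>R e" s]
        by (simp add: \<xi>_def algebra_simps power2_eq_square)
      show "- (2 * K * (norm y)\<^sup>2) \<le> \<xi> t" for t
      proof -
        obtain a where a: "\<And>h. \<bar>f1 (t *\<^sub>R e + h) - f1 (t *\<^sub>R e) - a \<bullet> h\<bar> \<le> K * (norm h)\<^sup>2"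
          using pin[OF f1] unfolding pinched_def by blast
        show ?thesis using a[of y] a[of "- y"] line[of t] by (simp add: \<xi>_def algebra_simps)
      qed
    qed
    then have "\<xi> s = \<xi> 0" "\<xi> (- s) = \<xi> 0" by blast+
    then have "\<xi> s + \<xi> (- s) - 2 * \<xi> 0 = 0" by simp
    then have "(f1 (y + s *\<^sub>R e) + f1 (y - s *\<^sub>R e) - 2 * f1 y - S * s\<^sup>2)
       + (f1 (- y + s *\<^sub>R e) + f1 (- y - s *\<^sub>R e) - 2 * f1 (- y) - S * s\<^sup>2) = 0"
      by (simp add: \<xi>_def algebra_simps)
    then show ?thesis using sd[OF f1, of y s] sd[OF f1, of "- y" s] by linarith
  qed
  with f1 show thesis using that by blast
qed

text \<open>The members with the identity in one direction form a family that is again closed under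
  blow-ups and limits. The next direction is treated inside it, so nothing already gained is
  lost.\<close>

lemma extremal_directions:
  fixes D :: "'a::euclidean_space set"
  assumes "finite D" and "blowup_closed K T" and "T \<noteq> {}" and "K \<ge> 0"
  shows "\<exists>f\<in>T. \<exists>s. \<forall>e\<in>D. \<forall>x t. f (x + t *\<^sub>R e) + f (x - t *\<^sub>R e) - 2 * f x = s e * t\<^sup>2"
  using assms
proof (induction D arbitrary: T rule: finite_induct)
  case (insert e D)
  obtain f s where f: "f \<in> T" "\<And>x t. f (x + t *\<^sub>R e) + f (x - t *\<^sub>R e) - 2 * f x = s * t\<^sup>2"
    using extremal_direction[OF insert.prems, of e] by blast
  define T' where "T' = {f \<in> T. \<forall>x t. f (x + t *\<^sub>R e) + f (x - t *\<^sub>R e) - 2 * f x = s * t\<^sup>2}"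
  have ne: "T' \<noteq> {}" using f unfolding T'_def by blast
  have "blowup_closed K T'"
    unfolding blowup_closed_def
  proof (intro conjI ballI allI impI)
    show "pinched K f" if "f \<in> T'" for f using that insert.prems(1) unfolding T'_def blowup_closed_def by blast
  next
    fix f x c a and r :: real assume f: "f \<in> T'" and r: "r > 0"
    have "(f (x + r *\<^sub>R (y + t *\<^sub>R e)) - c - a \<bullet> (y + t *\<^sub>R e)) / r\<^sup>2 +
          (f (x + r *\<^sub>R (y - t *\<^sub>R e)) - c - a \<bullet> (y - t *\<^sub>R e)) / r\<^sup>2 -
          2 * ((f (x + r *\<^sub>R y) - c - a \<bullet> y) / r\<^sup>2) = s * t\<^sup>2" for y t
    proof -
      have "f (x + r *\<^sub>R y + (r * t) *\<^sub>R e) + f (x + r *\<^sub>R y - (r * t) *\<^sub>R e) - 2 * f (x + r *\<^sub>R y) = s * (r * t)\<^sup>2"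
        using f unfolding T'_def by blast
      moreover have "x + r *\<^sub>R (y + t *\<^sub>R e) = x + r *\<^sub>R y + (r * t) *\<^sub>R e"
        "x + r *\<^sub>R (y - t *\<^sub>R e) = x + r *\<^sub>R y - (r * t) *\<^sub>R e" by (simp_all add: algebra_simps)
      moreover have "(u - c - (p + q)) / r\<^sup>2 + (v - c - (p - q)) / r\<^sup>2 - 2 * ((w - c - p) / r\<^sup>2) = (u + v - 2 * w) / r\<^sup>2"
        for u v w p q :: real by (simp add: diff_divide_distrib add_divide_distrib)
      ultimately show ?thesis using r
        by (simp only: inner_add_right inner_diff_right) (simp add: power_mult_distrib)
    qed
    moreover have "(\<lambda>h. (f (x + r *\<^sub>R h) - c - a \<bullet> h) / r\<^sup>2) \<in> T"
      using f r insert.prems(1) unfolding T'_def blowup_closed_def by blast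
    ultimately show "(\<lambda>h. (f (x + r *\<^sub>R h) - c - a \<bullet> h) / r\<^sup>2) \<in> T'" unfolding T'_def by simp
  next
    fix fs f assume a: "(\<forall>k. fs k \<in> T') \<and> loc_unif_lim fs f"
    have l: "(\<lambda>k. fs k y) \<longlonglongrightarrow> f y" for y using a loc_unif_limD by blast
    have "f (x + t *\<^sub>R e) + f (x - t *\<^sub>R e) - 2 * f x = s * t\<^sup>2" for x t
    proof (rule LIMSEQ_unique)
      show "(\<lambda>k. fs k (x + t *\<^sub>R e) + fs k (x - t *\<^sub>R e) - 2 * fs k x) \<longlonglongrightarrow> f (x + t *\<^sub>R e) + f (x - t *\<^sub>R e) - 2 * f x"
        by (intro tendsto_intros l)
      show "(\<lambda>k. fs k (x + t *\<^sub>R e) + fs k (x - t *\<^sub>R e) - 2 * fs k x) \<longlonglongrightarrow> s * t\<^sup>2"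
        using a unfolding T'_def by simp
    qed
    moreover have "f \<in> T" using a insert.prems(1) unfolding T'_def blowup_closed_def by blast
    ultimately show "f \<in> T'" unfolding T'_def by simp
  qed
  from insert.IH[OF this ne insert.prems(3)]
  obtain g s' where g: "g \<in> T'" "\<forall>e\<in>D. \<forall>x t. g (x + t *\<^sub>R e) + g (x - t *\<^sub>R e) - 2 * g x = s' e * t\<^sup>2"
    by blast
  then show ?case
    by (intro bexI[of _ g] exI[of _ "s'(e := s)"]) (auto simp: T'_def)
qed auto

section \<open>Stability of viscosity inequalities under blow-up\<close>

lemma Sym_inner:
  assumes "A \<in> Sym" shows "x \<bullet> (A *v y) = (A *v x) \<bullet> y"
proof -
  have "(A *v x) \<bullet> y = (transpose A *v x) \<bullet> y" using assms by (simp add: Sym_def)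
  also have "\<dots> = x \<bullet> (A *v y)" by (simp only: transpose_matrix_vector dot_lmul_matrix)
  finally show ?thesis by simp
qed

lemma Sym_add: "A \<in> Sym \<Longrightarrow> B \<in> Sym \<Longrightarrow> A + B \<in> Sym"
  and Sym_diff: "A \<in> Sym \<Longrightarrow> B \<in> Sym \<Longrightarrow> A - B \<in> Sym"
  and Sym_minus: "A \<in> Sym \<Longrightarrow> - A \<in> Sym"
  and Sym_scaleR: "A \<in> Sym \<Longrightarrow> c *\<^sub>R A \<in> Sym"
  by (auto simp: Sym_def transpose_def vec_eq_iff)

lemma Sym_mat: "mat c \<in> Sym"
  by (auto simp: Sym_def transpose_mat)

text \<open>Second differences along e_i + e_j, with i = j allowed, determine a symmetric matrix by
  polarisation. After its quadratic form is subtracted, the rest is affine along each of these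
  directions, and its slope does not change along coordinate axes; moving along the axes in turn
  shows that it is affine.\<close>

lemma quadratic_of_second_differences:
  fixes f :: "real^'n \<Rightarrow> real" and s :: "real^'n \<Rightarrow> real"
  assumes pin: "pinched K f"
    and sd: "\<And>i j x t. f (x + t *\<^sub>R (axis i 1 + axis j 1)) + f (x - t *\<^sub>R (axis i 1 + axis j 1)) - 2 * f x = s (axis i 1 + axis j 1) * t\<^sup>2"
  obtains A p c where "A \<in> Sym" "\<And>x. f x = c + p \<bullet> x + x \<bullet> (A *v x) / 2"
proof -
  let ?d = "\<lambda>i j. axis i 1 + axis j 1 :: real^'n"
  obtain a where a: "\<And>x h. \<bar>f (x + h) - f x - a x \<bullet> h\<bar> \<le> K * (norm h)\<^sup>2"
    using pin unfolding pinched_def by metis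
  \<comment> \<open>For the form x \<bullet> (A *v x) / 2 one has s (e_i + e_j) = A_ii + 2 A_ij +
    A_jj and s (2 e_i) = 4 A_ii; the entry is obtained by solving for A_ij.\<close>
  define A :: "real^'n^'n" where "A = (\<chi> i j. (s (?d i j) - s (?d i i) / 4 - s (?d j j) / 4) / 2)"
  have A: "A \<in> Sym" by (simp add: Sym_def A_def transpose_def vec_eq_iff add.commute)
  define q where "q x = x \<bullet> (A *v x) / 2" for x
  have Ad: "?d i j \<bullet> (A *v ?d i j) = s (?d i j)" for i j
  proof -
    have "?d i j \<bullet> (A *v ?d i j) = A $ i $ i + A $ i $ j + A $ j $ i + A $ j $ j"
      by (simp add: matrix_vector_right_distrib matrix_vector_mult_basis inner_add_left inner_axis' column_def)
    also have "\<dots> = s (?d i j)" by (simp add: A_def add.commute) (simp add: field_simps)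
    finally show ?thesis .
  qed
  have q_add: "q (x + h) = q x + (A *v x) \<bullet> h + h \<bullet> (A *v h) / 2" for x h
    using Sym_inner[OF A, of x h]
    by (simp add: q_def matrix_vector_right_distrib inner_add_left inner_add_right inner_commute add_divide_distrib)
  define \<phi> where "\<phi> x = f x - q x" for x
  define b where "b x = a x - A *v x" for x
  have line: "\<phi> (x + t *\<^sub>R ?d i j) = \<phi> x + t * (b x \<bullet> ?d i j)" for i j x t
  proof -
    \<comment> \<open>This is the deviation of \<phi> from its tangent along the line. The quadratic
      terms cancel in \<open>J\<close>, so that the midpoint equation holds exactly, while
      \<open>bd\<close> makes \<psi> quadratically small at 0; then neither \<psi> nor -\<psi> can
      be positive.\<close>
    define \<psi> where "\<psi> t = \<phi> (x + t *\<^sub>R ?d i j) - \<phi> x - t * (b x \<bullet> ?d i j)" for t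
    define C where "C = K * (norm (?d i j))\<^sup>2 + \<bar>s (?d i j)\<bar> / 2"
    have \<psi>: "\<psi> t = f (x + t *\<^sub>R ?d i j) - f x - a x \<bullet> (t *\<^sub>R ?d i j) - s (?d i j) * t\<^sup>2 / 2" for t
    proof -
      have "(t *\<^sub>R ?d i j) \<bullet> (A *v (t *\<^sub>R ?d i j)) = t\<^sup>2 * s (?d i j)"
        using Ad[of i j] by (simp add: matrix_vector_mult_scaleR power2_eq_square)
      moreover have "(A *v x) \<bullet> (t *\<^sub>R ?d i j) = t * ((A *v x) \<bullet> ?d i j)" "a x \<bullet> (t *\<^sub>R ?d i j) = t * (a x \<bullet> ?d i j)"
        by simp_all
      ultimately show ?thesis
        unfolding \<psi>_def \<phi>_def b_def q_add inner_diff_left by (simp add: algebra_simps)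
    qed
    have bd: "\<bar>\<psi> t\<bar> \<le> C * t\<^sup>2" for t
    proof -
      have "K * (norm (t *\<^sub>R ?d i j))\<^sup>2 = K * (norm (?d i j))\<^sup>2 * t\<^sup>2" by (simp add: power_mult_distrib)
      moreover have "\<bar>s (?d i j) * t\<^sup>2 / 2\<bar> = \<bar>s (?d i j)\<bar> / 2 * t\<^sup>2" by (simp add: abs_mult)
      ultimately show ?thesis using a[of x "t *\<^sub>R ?d i j"] unfolding \<psi> C_def distrib_right by linarith
    qed
    have J: "\<psi> (u + v) + \<psi> (u - v) = 2 * \<psi> u" for u v
    proof -
      have e: "x + (u + v) *\<^sub>R ?d i j = (x + u *\<^sub>R ?d i j) + v *\<^sub>R ?d i j"
        "x + (u - v) *\<^sub>R ?d i j = (x + u *\<^sub>R ?d i j) - v *\<^sub>R ?d i j" by (simp_all add: algebra_simps)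
      have J0: "f (x + (u + v) *\<^sub>R ?d i j) + f (x + (u - v) *\<^sub>R ?d i j) - 2 * f (x + u *\<^sub>R ?d i j) = s (?d i j) * v\<^sup>2"
        unfolding e by (rule sd)
      have J1: "a x \<bullet> ((u + v) *\<^sub>R ?d i j) = a x \<bullet> (u *\<^sub>R ?d i j) + a x \<bullet> (v *\<^sub>R ?d i j)"
        "a x \<bullet> ((u - v) *\<^sub>R ?d i j) = a x \<bullet> (u *\<^sub>R ?d i j) - a x \<bullet> (v *\<^sub>R ?d i j)"
        by (simp_all only: scaleR_add_left scaleR_diff_left inner_add_right inner_diff_right)
      have "s (?d i j) * (u + v)\<^sup>2 / 2 + s (?d i j) * (u - v)\<^sup>2 / 2 = s (?d i j) * u\<^sup>2 + s (?d i j) * v\<^sup>2"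
        by (simp add: power2_eq_square field_simps)
      note J2 = this
      have alg: "f1 - c - a1 - s1 / 2 + (f2 - c - a2 - s2 / 2) = 2 * (f3 - c - a - S / 2)"
        if "f1 + f2 - 2 * f3 = T" "a1 = a + b" "a2 = a - b" "s1 / 2 + s2 / 2 = S + T"
        for f1 f2 f3 T a1 a2 a b s1 s2 S c :: real using that by simp
      show ?thesis unfolding \<psi> by (rule alg[OF J0 J1 J2])
    qed
    have \<psi>0: "\<psi> 0 = 0" by (simp add: \<psi>_def)
    have half: "\<psi> u = 2 * \<psi> (u / 2)" for u using J[of "u / 2" "u / 2"] \<psi>0 by simp
    have "\<psi> t \<le> 0"
      by (rule half_subadditive_nonpos[of \<psi> C, OF eq_refl[OF half] abs_le_D1[OF bd]])
    moreover have "- \<psi> t \<le> 0"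
    proof (rule half_subadditive_nonpos[of "\<lambda>t. - \<psi> t" C])
      show "- \<psi> u \<le> 2 * - \<psi> (u / 2)" for u using half[of u] by simp
      show "- \<psi> u \<le> C * u\<^sup>2" for u using bd[of u] by linarith
    qed
    ultimately show ?thesis unfolding \<psi>_def by simp
  qed
  have line1: "\<phi> (x + t *\<^sub>R axis i 1) = \<phi> x + t * (b x \<bullet> axis i 1)" for x t i
  proof -
    have "(t / 2) *\<^sub>R ?d i i = (t / 2 + t / 2) *\<^sub>R axis i 1"
      by (simp only: scaleR_add_left scaleR_add_right)
    then have e: "(t / 2) *\<^sub>R ?d i i = t *\<^sub>R axis i 1" by (simp only: field_sum_of_halves)
    have "t / 2 * (b x \<bullet> ?d i i) = t * (b x \<bullet> axis i 1)" unfolding inner_add_right by simp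
    then show ?thesis using line[of x "t / 2" i i] unfolding e by simp
  qed
  \<comment> \<open>The point x + t (e_i + e_j) is reached directly or by way of x + t e_i;
    comparing the two affine formulas identifies the j-th slopes at x and at x + t e_i.\<close>
  have bc: "b (x + t *\<^sub>R axis i 1) = b x" for x t i
  proof (cases "t = 0")
    case False
    have "b (x + t *\<^sub>R axis i 1) \<bullet> axis j 1 = b x \<bullet> axis j 1" for j
    proof -
      have "\<phi> (x + t *\<^sub>R ?d i j) = \<phi> (x + t *\<^sub>R axis i 1) + t * (b (x + t *\<^sub>R axis i 1) \<bullet> axis j 1)"
        using line1[of "x + t *\<^sub>R axis i 1" t j] by (simp add: scaleR_add_right add.assoc)
      then show ?thesis using line[of x t i j] line1[of x t i] False by (simp add: inner_add_right algebra_simps)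
    qed
    then show ?thesis by (simp add: vec_eq_iff inner_axis)
  qed auto
  have ind: "b (\<Sum>i\<in>I. x $ i *\<^sub>R axis i 1) = b 0
      \<and> \<phi> (\<Sum>i\<in>I. x $ i *\<^sub>R axis i 1) = \<phi> 0 + b 0 \<bullet> (\<Sum>i\<in>I. x $ i *\<^sub>R axis i 1)"
    if "finite I" for I x
    using that
  proof (induction I rule: finite_induct)
    case (insert i I)
    let ?y = "\<Sum>i\<in>I. x $ i *\<^sub>R axis i 1 :: real^'n"
    have "(\<Sum>i\<in>insert i I. x $ i *\<^sub>R axis i 1) = ?y + x $ i *\<^sub>R axis i 1"
      using insert.hyps by (simp add: add.commute)
    then show ?case using insert.IH bc[of ?y "x $ i" i] line1[of ?y "x $ i" i] by (simp add: inner_add_right)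
  qed auto
  have expand: "(\<Sum>i\<in>UNIV. x $ i *\<^sub>R axis i 1) = x" for x :: "real^'n"
    using basis_expansion[of x] by (simp add: scalar_mult_eq_scaleR)
  have "f x = \<phi> 0 + b 0 \<bullet> x + x \<bullet> (A *v x) / 2" for x
  proof -
    have "\<phi> x = \<phi> 0 + b 0 \<bullet> x"
      using ind[OF finite_class.finite_UNIV, of x] unfolding expand by simp
    then show ?thesis unfolding \<phi>_def[of x] q_def[of x] by linarith
  qed
  then show ?thesis by (rule that[OF A])
qed

definition quad :: "real \<Rightarrow> real^'n \<Rightarrow> real^'n^'n \<Rightarrow> real^'n \<Rightarrow> real^'n \<Rightarrow> real" where
  "quad c p A x y = c + p \<bullet> (y - x) + (y - x) \<bullet> (A *v (y - x)) / 2"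

lemma quad_recenter:
  assumes "A \<in> Sym"
  shows "quad c p A x y = quad (quad c p A x z) (p + A *v (z - x)) A z y"
proof -
  have yx: "y - x = (y - z) + (z - x)" by simp
  have "(y - z) \<bullet> (A *v (z - x)) = (A *v (z - x)) \<bullet> (y - z)" "(z - x) \<bullet> (A *v (y - z)) = (A *v (z - x)) \<bullet> (y - z)"
    using Sym_inner[OF assms] by (simp_all add: inner_commute)
  then show ?thesis unfolding quad_def yx
    by (simp only: matrix_vector_right_distrib inner_add_left inner_add_right) (simp add: field_simps)
qed

lemma uminus_matrix_vector_mult: "(- A) *v y = - (A *v (y :: real^'n))"
  by (simp add: matrix_vector_mult_def vec_eq_iff sum_negf)

text \<open>A set S of admissible matrices stands in for the sign of \<open>F\<close>, so that
  subsolutions and negatives of supersolutions obey one notion. Asking only for A + \<eta> I with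
  \<eta> > 0 makes the notion stable under limits although S need not be closed.\<close>

definition visc_sub :: "(real^'n^'n) set \<Rightarrow> (real^'n) set \<Rightarrow> (real^'n \<Rightarrow> real) \<Rightarrow> bool" where
  "visc_sub S U f \<longleftrightarrow> (\<forall>x\<in>U. \<forall>p. \<forall>A\<in>Sym.
     (\<forall>\<^sub>F y in nhds x. f y \<le> f x + p \<bullet> (y - x) + (y - x) \<bullet> (A *v (y - x)) / 2) \<longrightarrow>
     (\<forall>\<eta>>0. A + \<eta> *\<^sub>R mat 1 \<in> S))"

lemma visc_subD:
  assumes "visc_sub S U f" "x \<in> U" "A \<in> Sym"
    "\<forall>\<^sub>F y in nhds x. f y \<le> f x + p \<bullet> (y - x) + (y - x) \<bullet> (A *v (y - x)) / 2" "\<eta> > 0"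
  shows "A + \<eta> *\<^sub>R mat 1 \<in> S"
  using assms unfolding visc_sub_def by blast

lemma inner_add_mat: "h \<bullet> ((A + \<eta> *\<^sub>R mat 1) *v h) = h \<bullet> (A *v h) + \<eta> * (norm (h::real^'n))\<^sup>2"
  by (simp add: matrix_vector_mult_add_rdistrib inner_add_right scaleR_matrix_vector_assoc[symmetric] power2_norm_eq_inner)

text \<open>Half of \<eta> is added to the test matrix to make the contact strict; the approximating
  functions are then touched by a vertical translate of the new paraboloid at a nearby interior
  point. The other half is what the definition consumes there.\<close>

lemma visc_sub_limit:
  fixes f :: "real^'n \<Rightarrow> real"
  assumes lim: "loc_unif_lim fs f" and cont: "\<And>k. continuous_on UNIV (fs k)"
    and vs: "\<And>k. visc_sub S (U k) (fs k)" and U: "\<And>R. \<forall>\<^sub>F k in sequentially. ball 0 R \<subseteq> U k"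
  shows "visc_sub S UNIV f"
  unfolding visc_sub_def
proof (intro ballI allI impI)
  fix x p :: "real^'n" and A :: "real^'n^'n" and \<eta> :: real
  assume A: "A \<in> Sym" and \<eta>: "\<eta> > 0"
    and "\<forall>\<^sub>F y in nhds x. f y \<le> f x + p \<bullet> (y - x) + (y - x) \<bullet> (A *v (y - x)) / 2"
  then obtain d where d: "d > 0" "\<And>y. dist y x < d \<Longrightarrow> f y \<le> f x + p \<bullet> (y - x) + (y - x) \<bullet> (A *v (y - x)) / 2"
    unfolding eventually_nhds_metric by blast
  define \<rho> where "\<rho> = d / 2"
  have \<rho>: "\<rho> > 0" using d by (simp add: \<rho>_def)
  define B where "B = A + (\<eta> / 2) *\<^sub>R mat 1"
  have B: "B \<in> Sym" unfolding B_def by (intro Sym_add Sym_scaleR Sym_mat A)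
  define Q where "Q y = p \<bullet> (y - x) + (y - x) \<bullet> (B *v (y - x)) / 2" for y
  have fQ: "f y - Q y \<le> f x - \<eta> / 4 * (norm (y - x))\<^sup>2" if "y \<in> cball x \<rho>" for y
  proof -
    have "dist y x < d" using that \<rho> by (simp add: dist_commute \<rho>_def)
    from d(2)[OF this] show ?thesis unfolding Q_def B_def inner_add_mat by (simp add: field_simps)
  qed
  \<comment> \<open>Strict contact leaves a margin \<eta> \<rho>^2 / 4 on the sphere. Its two halves
    pay for the errors at x and at z, so the maximum cannot lie on the sphere.\<close>
  have ev1: "\<forall>\<^sub>F k in sequentially. \<forall>y\<in>cball 0 (norm x + \<rho>). dist (fs k y) (f y) < \<eta> * \<rho>\<^sup>2 / 8"
  proof -
    have "\<eta> * \<rho>\<^sup>2 / 8 > 0" using \<eta> \<rho> by simp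
    then show ?thesis using lim unfolding loc_unif_lim_def uniform_limit_iff by blast
  qed
  have "\<forall>\<^sub>F k in sequentially. (\<forall>y\<in>cball 0 (norm x + \<rho>). dist (fs k y) (f y) < \<eta> * \<rho>\<^sup>2 / 8)
      \<and> ball 0 (norm x + \<rho>) \<subseteq> U k"
    using ev1 U by (rule eventually_conj)
  then obtain k where k: "\<And>y. y \<in> cball 0 (norm x + \<rho>) \<Longrightarrow> dist (fs k y) (f y) < \<eta> * \<rho>\<^sup>2 / 8"
    and Uk: "ball 0 (norm x + \<rho>) \<subseteq> U k"
    unfolding eventually_sequentially by blast
  have cb: "cball x \<rho> \<subseteq> cball 0 (norm x + \<rho>)" "ball x \<rho> \<subseteq> ball 0 (norm x + \<rho>)"
    by (auto simp: dist_norm norm_minus_commute) (smt (verit) norm_triangle_sub norm_minus_commute)+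
  have "continuous_on (cball x \<rho>) (\<lambda>y. fs k y - Q y)"
    unfolding Q_def
    by (intro continuous_intros continuous_on_subset[OF cont]
        continuous_on_compose2[OF matrix_vector_mult_linear_continuous_on[of UNIV]]) auto
  then obtain z where z: "z \<in> cball x \<rho>" "\<And>y. y \<in> cball x \<rho> \<Longrightarrow> fs k y - Q y \<le> fs k z - Q z"
    using continuous_attains_sup[OF compact_cball, of x \<rho> "\<lambda>y. fs k y - Q y"] \<rho> by auto
  have zb: "z \<in> ball x \<rho>"
  proof (rule ccontr)
    assume "z \<notin> ball x \<rho>"
    then have nz: "norm (z - x) = \<rho>" using z(1) by (simp add: dist_norm norm_minus_commute)
    have "fs k x - Q x \<le> fs k z - Q z" using z(2) \<rho> by simp
    moreover have "Q x = 0" by (simp add: Q_def)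
    moreover have "\<bar>fs k x - f x\<bar> < \<eta> * \<rho>\<^sup>2 / 8" using k[of x] cb \<rho> by (auto simp: dist_real_def)
    moreover have "\<bar>fs k z - f z\<bar> < \<eta> * \<rho>\<^sup>2 / 8" using k[of z] cb z(1) by (auto simp: dist_real_def)
    moreover have "f z - Q z \<le> f x - \<eta> / 4 * \<rho>\<^sup>2" using fQ[OF z(1)] nz by simp
    ultimately show False by simp
  qed
  have "B + (\<eta> / 2) *\<^sub>R mat 1 \<in> S"
  proof (rule visc_subD[OF vs[of k]])
    show "z \<in> U k" using zb cb Uk by blast
    have "\<forall>\<^sub>F y in nhds z. y \<in> ball x \<rho>" using zb by (intro eventually_nhds_in_open) auto
    then show "\<forall>\<^sub>F y in nhds z. fs k y \<le> fs k z + (p + B *v (z - x)) \<bullet> (y - z) + (y - z) \<bullet> (B *v (y - z)) / 2"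
    proof eventually_elim
      case (elim y)
      have "Q y - Q z = (p + B *v (z - x)) \<bullet> (y - z) + (y - z) \<bullet> (B *v (y - z)) / 2"
        using quad_recenter[OF B, of 0 p x y z] unfolding quad_def Q_def by simp
      then show ?case using z(2)[of y] elim by auto
    qed
  qed (use B \<eta> in auto)
  then show "A + \<eta> *\<^sub>R mat 1 \<in> S" unfolding B_def
    by (simp add: add.assoc scaleR_add_left[symmetric])
qed

text \<open>Lengths are divided by r and values by r^2, so Hessians do not change and the same S
  serves. Removing an affine part only alters the slope of a test.\<close>

lemma visc_sub_rescale:
  fixes f :: "real^'n \<Rightarrow> real"
  assumes vs: "visc_sub S U f" and r: "r > 0"
  shows "visc_sub S {h. x + r *\<^sub>R h \<in> U} (\<lambda>h. (f (x + r *\<^sub>R h) - c - a \<bullet> h) / r\<^sup>2)"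
  unfolding visc_sub_def
proof (intro ballI allI impI)
  fix h0 p :: "real^'n" and A :: "real^'n^'n" and \<eta> :: real
  let ?g = "\<lambda>h. (f (x + r *\<^sub>R h) - c - a \<bullet> h) / r\<^sup>2"
  assume h0: "h0 \<in> {h. x + r *\<^sub>R h \<in> U}" and A: "A \<in> Sym" and \<eta>: "\<eta> > 0"
    and ev: "\<forall>\<^sub>F h in nhds h0. ?g h \<le> ?g h0 + p \<bullet> (h - h0) + (h - h0) \<bullet> (A *v (h - h0)) / 2"
  let ?y0 = "x + r *\<^sub>R h0" and ?h = "\<lambda>y. (1 / r) *\<^sub>R (y - x)"
  have "isCont ?h ?y0" by (intro continuous_intros)
  then have "filterlim ?h (nhds (?h ?y0)) (nhds ?y0)"
    unfolding isCont_def tendsto_at_iff_tendsto_nhds[of ?h ?y0] .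
  moreover have "?h ?y0 = h0" using r by simp
  ultimately have "filterlim ?h (nhds h0) (nhds ?y0)" by (simp only:)
  from eventually_compose_filterlim[OF ev this]
  have "\<forall>\<^sub>F y in nhds ?y0. f y \<le> f ?y0 + (r *\<^sub>R p + (1 / r) *\<^sub>R a) \<bullet> (y - ?y0) + (y - ?y0) \<bullet> (A *v (y - ?y0)) / 2"
  proof eventually_elim
    case (elim y)
    define k where "k = ?h y - h0"
    have y: "y = ?y0 + r *\<^sub>R k" "?h y = h0 + k" "x + r *\<^sub>R ?h y = y"
      using r by (simp_all add: k_def algebra_simps)
    have "(f y - c - a \<bullet> (h0 + k)) / r\<^sup>2 \<le> ?g h0 + p \<bullet> k + k \<bullet> (A *v k) / 2"
      using elim[unfolded y(3), folded k_def] unfolding y(2) .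
    then have "f y - c - a \<bullet> (h0 + k) \<le> (?g h0 + p \<bullet> k + k \<bullet> (A *v k) / 2) * r\<^sup>2"
      using r by (subst (asm) pos_divide_le_eq) simp_all
    also have "\<dots> = f ?y0 - c - a \<bullet> h0 + r\<^sup>2 * (p \<bullet> k) + r\<^sup>2 * (k \<bullet> (A *v k)) / 2"
      using r by (simp add: field_simps)
    finally have "f y \<le> f ?y0 + a \<bullet> k + r\<^sup>2 * (p \<bullet> k) + r\<^sup>2 * (k \<bullet> (A *v k)) / 2"
      by (simp add: inner_add_right)
    moreover have "y - ?y0 = r *\<^sub>R k" using y(1) by simp
    ultimately show ?case using r
      by (simp add: inner_add_left inner_add_right matrix_vector_mult_scaleR power2_eq_square mult.assoc algebra_simps)
  qed
  from visc_subD[OF vs _ A this \<eta>] h0 show "A + \<eta> *\<^sub>R mat 1 \<in> S" by simp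
qed

text \<open>The support inequality at the steps b and -b, for a basis vector b, bounds the component
  \<open>a k \<bullet> b\<close> by differences of values that converge along the sequence.\<close>

lemma subgradients_convergent_subseq:
  fixes fs :: "nat \<Rightarrow> 'a::euclidean_space \<Rightarrow> real"
  assumes lim: "loc_unif_lim fs f" and cont: "\<And>k. continuous_on UNIV (fs k)" and X: "X \<longlonglongrightarrow> x"
    and a: "\<And>k h. fs k (X k) + a k \<bullet> h - K * (norm h)\<^sup>2 \<le> fs k (X k + h)"
  obtains r l where "strict_mono r" "(\<lambda>k. a (r k)) \<longlonglongrightarrow> l"
proof -
  have "\<exists>M. \<forall>k. \<bar>a k \<bullet> b\<bar> \<le> M" if b: "b \<in> Basis" for b
  proof -
    have "Bseq (\<lambda>k. fs k (X k + c) - fs k (X k))" for c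
      by (rule convergent_imp_Bseq, rule convergentI[where L = "f (x + c) - f x"])
        (intro tendsto_intros loc_unif_lim_moving[OF lim cont] X)
    then obtain M1 M2 where "\<And>k. norm (fs k (X k + b) - fs k (X k)) \<le> M1" "\<And>k. norm (fs k (X k + (- b)) - fs k (X k)) \<le> M2"
      unfolding Bseq_def by metis
    then have M: "\<bar>fs k (X k + b) - fs k (X k)\<bar> \<le> M1" "\<bar>fs k (X k + (- b)) - fs k (X k)\<bar> \<le> M2" for k
      by auto
    have "\<bar>a k \<bullet> b\<bar> \<le> M1 + M2 + K" for k
      using a[of k b] a[of k "- b"] M(1)[of k] M(2)[of k] b by simp
    then show ?thesis by blast
  qed
  then obtain M where M: "\<And>b k. b \<in> Basis \<Longrightarrow> \<bar>a k \<bullet> b\<bar> \<le> M b" by metis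
  have "norm (a k) \<le> (\<Sum>b\<in>Basis. M b)" for k
    using norm_le_l1[of "a k"] sum_mono[of Basis "\<lambda>b. \<bar>a k \<bullet> b\<bar>" M] M by fastforce
  then have "bounded (range a)" by (auto simp: bounded_iff)
  from bounded_imp_convergent_subsequence[OF this] show ?thesis using that by (auto simp: o_def)
qed

lemma pinched_limit_at:
  fixes fs :: "nat \<Rightarrow> 'a::euclidean_space \<Rightarrow> real"
  assumes lim: "loc_unif_lim fs f" and cont: "\<And>k. continuous_on UNIV (fs k)" and X: "X \<longlonglongrightarrow> x"
    and a: "\<And>k h. \<bar>fs k (X k + h) - fs k (X k) - a k \<bullet> h\<bar> \<le> K * (norm h)\<^sup>2"
  obtains l where "\<And>h. \<bar>f (x + h) - f x - l \<bullet> h\<bar> \<le> K * (norm h)\<^sup>2"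
proof -
  have "fs k (X k) + a k \<bullet> h - K * (norm h)\<^sup>2 \<le> fs k (X k + h)" for k h
    using a[of k h] by linarith
  from subgradients_convergent_subseq[OF lim cont X this]
  obtain r l where r: "strict_mono (r :: nat \<Rightarrow> nat)" and l: "(\<lambda>k. a (r k)) \<longlonglongrightarrow> l" .
  have "\<bar>f (x + h) - f x - l \<bullet> h\<bar> \<le> K * (norm h)\<^sup>2" for h
  proof (rule LIMSEQ_le_const2)
    have Xr: "(\<lambda>k. X (r k)) \<longlonglongrightarrow> x" using LIMSEQ_subseq_LIMSEQ[OF X r] by (simp add: o_def)
    show "(\<lambda>k. \<bar>fs (r k) (X (r k) + h) - fs (r k) (X (r k)) - a (r k) \<bullet> h\<bar>) \<longlonglongrightarrow> \<bar>f (x + h) - f x - l \<bullet> h\<bar>"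
      by (intro tendsto_intros loc_unif_lim_moving[OF loc_unif_lim_subseq[OF lim r] cont] Xr l)
  qed (use a in blast)
  then show ?thesis using that by blast
qed

lemma pinched_limit:
  fixes fs :: "nat \<Rightarrow> 'a::euclidean_space \<Rightarrow> real"
  assumes lim: "loc_unif_lim fs f" and pin: "\<And>k. pinched K (fs k)"
  shows "pinched K f"
  unfolding pinched_def
proof
  fix x
  have "\<forall>k. \<exists>a. \<forall>h. \<bar>fs k (x + h) - fs k x - a \<bullet> h\<bar> \<le> K * (norm h)\<^sup>2"
    using pin unfolding pinched_def by blast
  then obtain a where "\<And>k h. \<bar>fs k (x + h) - fs k x - a k \<bullet> h\<bar> \<le> K * (norm h)\<^sup>2"
    by metis
  from pinched_limit_at[OF lim pinched_continuous[OF pin] tendsto_const this]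
  show "\<exists>a. \<forall>h. \<bar>f (x + h) - f x - a \<bullet> h\<bar> \<le> K * (norm h)\<^sup>2" by blast
qed

lemma pinched_rescale:
  assumes pin: "pinched K f" and r: "r > 0"
  shows "pinched K (\<lambda>h. (f (x + r *\<^sub>R h) - c - a \<bullet> h) / r\<^sup>2)"
  unfolding pinched_def
proof
  fix y
  obtain b where b: "\<And>h. \<bar>f (x + r *\<^sub>R y + h) - f (x + r *\<^sub>R y) - b \<bullet> h\<bar> \<le> K * (norm h)\<^sup>2"
    using pin unfolding pinched_def by blast
  have "\<bar>(f (x + r *\<^sub>R (y + h)) - c - a \<bullet> (y + h)) / r\<^sup>2 - (f (x + r *\<^sub>R y) - c - a \<bullet> y) / r\<^sup>2
      - ((1 / r\<^sup>2) *\<^sub>R (r *\<^sub>R b - a)) \<bullet> h\<bar> \<le> K * (norm h)\<^sup>2" for h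
  proof -
    have "(f (x + r *\<^sub>R (y + h)) - c - a \<bullet> (y + h)) / r\<^sup>2 - (f (x + r *\<^sub>R y) - c - a \<bullet> y) / r\<^sup>2
      - ((1 / r\<^sup>2) *\<^sub>R (r *\<^sub>R b - a)) \<bullet> h = (f (x + r *\<^sub>R y + r *\<^sub>R h) - f (x + r *\<^sub>R y) - b \<bullet> (r *\<^sub>R h)) / r\<^sup>2"
      by (simp add: inner_diff_left inner_add_right scaleR_add_right add.assoc diff_divide_distrib add_divide_distrib)
    moreover have "\<bar>f (x + r *\<^sub>R y + r *\<^sub>R h) - f (x + r *\<^sub>R y) - b \<bullet> (r *\<^sub>R h)\<bar> \<le> K * (norm h)\<^sup>2 * r\<^sup>2"
      using b[of "r *\<^sub>R h"] by (simp add: power_mult_distrib mult_ac)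
    ultimately show ?thesis using r by (simp add: abs_divide pos_divide_le_eq)
  qed
  then show "\<exists>b. \<forall>h. \<bar>(f (x + r *\<^sub>R (y + h)) - c - a \<bullet> (y + h)) / r\<^sup>2 - (f (x + r *\<^sub>R y) - c - a \<bullet> y) / r\<^sup>2
      - b \<bullet> h\<bar> \<le> K * (norm h)\<^sup>2" by blast
qed

text \<open>A quadratic member of the family is touched from above by itself, and its negative by
  its own negative, so that one matrix passes both tests. The directions e_i + e_j are those from
  which the matrix can be recovered.\<close>

lemma visc_sub_both_sides:
  fixes f :: "real^'n \<Rightarrow> real"
  assumes K: "K \<ge> 0" and f: "pinched K f" "visc_sub S1 UNIV f" "visc_sub S2 UNIV (\<lambda>x. - f x)"
  obtains A where "A \<in> Sym" "\<And>\<eta>. \<eta> > 0 \<Longrightarrow> A + \<eta> *\<^sub>R mat 1 \<in> S1" "\<And>\<eta>. \<eta> > 0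
      \<Longrightarrow> - A + \<eta> *\<^sub>R mat 1 \<in> S2"
proof -
  define T where "T = {f. pinched K f \<and> visc_sub S1 UNIV f \<and> visc_sub S2 UNIV (\<lambda>x::real^'n. - f x)}"
  have "blowup_closed K T"
    unfolding blowup_closed_def
  proof (intro conjI ballI allI impI)
    fix f x c a and r :: real assume f: "f \<in> T" and r: "r > 0"
    have "visc_sub S1 {h. x + r *\<^sub>R h \<in> UNIV} (\<lambda>h. (f (x + r *\<^sub>R h) - c - a \<bullet> h) / r\<^sup>2)"
      using f unfolding T_def by (intro visc_sub_rescale r) simp
    moreover have "visc_sub S2 {h. x + r *\<^sub>R h \<in> UNIV} (\<lambda>h. (- f (x + r *\<^sub>R h) - (- c) - (- a) \<bullet> h) / r\<^sup>2)"
      using f unfolding T_def by (intro visc_sub_rescale[of S2 UNIV "\<lambda>x. - f x"] r) simp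
    moreover have "(- f (x + r *\<^sub>R h) - (- c) - (- a) \<bullet> h) / r\<^sup>2 = - ((f (x + r *\<^sub>R h) - c - a \<bullet> h) / r\<^sup>2)" for h
      by (simp add: minus_divide_left)
    ultimately show "(\<lambda>h. (f (x + r *\<^sub>R h) - c - a \<bullet> h) / r\<^sup>2) \<in> T"
      using pinched_rescale[OF _ r, of K f x c a] f unfolding T_def by simp
  next
    fix fs f assume a: "(\<forall>k. fs k \<in> T) \<and> loc_unif_lim fs f"
    then have fs: "\<And>k. pinched K (fs k)" "\<And>k. visc_sub S1 UNIV (fs k)" "\<And>k. visc_sub S2 UNIV (\<lambda>x. - fs k x)"
      and lim: "loc_unif_lim fs f" unfolding T_def by auto
    have cont: "continuous_on UNIV (fs k)" for k by (rule pinched_continuous[OF fs(1)])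
    have lim': "loc_unif_lim (\<lambda>k x. - fs k x) (\<lambda>x. - f x)"
      using lim unfolding loc_unif_lim_def by (auto intro: uniform_limit_intros)
    have "visc_sub S1 UNIV f" by (rule visc_sub_limit[OF lim cont fs(2)]) simp
    moreover have "visc_sub S2 UNIV (\<lambda>x. - f x)"
      by (rule visc_sub_limit[OF lim' _ fs(3)]) (auto intro: continuous_intros cont)
    ultimately show "f \<in> T" using pinched_limit[OF lim fs(1)] unfolding T_def by simp
  qed (simp add: T_def)
  moreover have "T \<noteq> {}" using f unfolding T_def by blast
  moreover have "finite ((\<lambda>(i, j). axis i 1 + axis j 1 :: real^'n) ` UNIV)" by simp
  ultimately obtain g s where g: "g \<in> T"
    and s: "\<And>e x t. e \<in> (\<lambda>(i, j). axis i 1 + axis j 1 :: real^'n) ` UNIV \<Longrightarrow>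
        g (x + t *\<^sub>R e) + g (x - t *\<^sub>R e) - 2 * g x = s e * t\<^sup>2"
    using extremal_directions[OF _ _ _ K] by metis
  have gp: "pinched K g" using g unfolding T_def by simp
  have sd: "g (x + t *\<^sub>R (axis i 1 + axis j 1)) + g (x - t *\<^sub>R (axis i 1 + axis j 1)) - 2 * g x = s (axis i 1 + axis j 1) * t\<^sup>2" for i j x t
    by (rule s) (rule image_eqI[where x = "(i, j)"], simp_all)
  obtain A c p where A: "A \<in> Sym" and gq: "\<And>x. g x = c + p \<bullet> x + x \<bullet> (A *v x) / 2"
    by (rule quadratic_of_second_differences[OF gp sd]) (rule that)
  have "A + \<eta> *\<^sub>R mat 1 \<in> S1" if "\<eta> > 0" for \<eta>
  proof (rule visc_subD[OF _ UNIV_I A _ that])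
    show "visc_sub S1 UNIV g" using g unfolding T_def by simp
    show "\<forall>\<^sub>F y in nhds 0. g y \<le> g 0 + p \<bullet> (y - 0) + (y - 0) \<bullet> (A *v (y - 0)) / 2"
      by (simp add: gq)
  qed
  moreover have "- A + \<eta> *\<^sub>R mat 1 \<in> S2" if "\<eta> > 0" for \<eta>
  proof (rule visc_subD[OF _ UNIV_I Sym_minus[OF A] _ that])
    show "visc_sub S2 UNIV (\<lambda>x. - g x)" using g unfolding T_def by simp
    show "\<forall>\<^sub>F y in nhds 0. - g y \<le> - g 0 + (- p) \<bullet> (y - 0) + (y - 0) \<bullet> (- A *v (y - 0)) / 2"
      by (simp add: gq uminus_matrix_vector_mult)
  qed
  ultimately show ?thesis using A that by blast
qed

section \<open>Porous sets\<close>

text \<open>Holes are required only at arbitrarily small radii, not at all small radii, so failure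
  of porosity is a strong property: in every small ball around x, each ball of relative size
  \<theta> meets S. This is what makes the rescaled copies of S dense.\<close>

definition porous_at :: "real \<Rightarrow> 'a::metric_space set \<Rightarrow> 'a \<Rightarrow> bool" where
  "porous_at \<theta> S x \<longleftrightarrow>
     (\<forall>d>0. \<exists>r z. 0 < r \<and> r < d \<and> ball z (\<theta> * r) \<subseteq> ball x r \<and> ball z (\<theta> * r) \<inter> S = {})"

text \<open>If the balls \<open>ball x r\<close> of a Vitali cover inside an open set \<open>U\<close> each have a hole of proportion
  \<open>\<theta> ^ n\<close>, removing the holes shows that the outer measure \<open>m\<close> of \<open>S\<close> is at most \<open>|U| - \<theta> ^ n m\<close>.\<close>

lemma bounded_porous_imp_negligible:
  fixes S :: "'a::euclidean_space set"
  assumes bdd: "bounded S" and \<theta>: "\<theta> > 0" and porous: "\<And>x. x \<in> S \<Longrightarrow> porous_at \<theta> S x"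
  shows "negligible S"
proof (rule ccontr)
  let ?c = "\<theta> ^ DIM('a)"
  assume "\<not> negligible S"
  then obtain e where e: "e > 0" "\<And>T. S \<subseteq> T \<Longrightarrow> T \<in> lmeasurable \<Longrightarrow> e \<le> measure lebesgue T"
    unfolding negligible_outer by (meson not_less)
  \<comment> \<open>S is not assumed measurable; the infimum \<open>m\<close> is its outer measure,
    positive because S is not negligible.\<close>
  define \<M> where "\<M> = measure lebesgue ` {T. S \<subseteq> T \<and> T \<in> lmeasurable}"
  define m where "m = Inf \<M>"
  obtain R where "S \<subseteq> ball 0 R" using bdd bounded_subset_ballD by blast
  then have ne: "\<M> \<noteq> {}" unfolding \<M>_def using lmeasurable_ball by blast
  have m: "m \<ge> e" unfolding m_def \<M>_def
    by (rule cInf_greatest) (use ne e(2) \<M>_def in auto)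
  have m_le: "m \<le> measure lebesgue T" if "S \<subseteq> T" "T \<in> lmeasurable" for T
    unfolding m_def \<M>_def by (rule cInf_lower) (use that e in \<open>auto intro!: bdd_belowI[where m = e]\<close>)
  have c: "?c > 0" using \<theta> by simp
  \<comment> \<open>One half of the tolerance m \<theta>^n is spent on T and the other on the open
    set U, so that |U| < m (1 + \<theta>^n).\<close>
  have "m * (1 + ?c / 2) > m" using e m c by simp
  then obtain T where T: "S \<subseteq> T" "T \<in> lmeasurable" "measure lebesgue T < m * (1 + ?c / 2)"
    using cInf_lessD[OF ne, of "m * (1 + ?c / 2)"] unfolding m_def \<M>_def by auto
  have m2: "m * ?c / 2 > 0" using e m c by simp
  obtain U where U: "open U" "T \<subseteq> U" "U - T \<in> lmeasurable" "emeasure lebesgue (U - T) < ennreal (m * ?c / 2)"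
    using sets_lebesgue_outer_open[OF fmeasurableD[OF T(2)] m2] .
  have "U = T \<union> (U - T)" using U(2) by blast
  then have Ulm: "U \<in> lmeasurable" using fmeasurable.Un[OF T(2) U(3)] by simp
  have "measure lebesgue (U - T) < m * ?c / 2"
    using U(4) m2 by (simp add: emeasure_eq_measure2[OF U(3)] ennreal_less_iff)
  moreover have "measure lebesgue (U - T) = measure lebesgue U - measure lebesgue T"
    using Ulm T(2) U(2) by (intro measurable_measure_Diff) (auto simp: fmeasurableD)
  ultimately have Um: "measure lebesgue U < m * (1 + ?c)" using T(3) by (simp add: algebra_simps)
  let ?K = "{(x, r). 0 < r \<and> ball x r \<subseteq> U \<and> (\<exists>z. ball z (\<theta> * r) \<subseteq> ball x r \<and> ball z (\<theta> * r) \<inter> S = {})}"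
  obtain C where C: "countable C" "C \<subseteq> ?K"
    "pairwise (\<lambda>i j. disjnt (ball (fst i) (snd i)) (ball (fst j) (snd j))) C"
    "negligible (S - (\<Union>i\<in>C. ball (fst i) (snd i)))"
  proof (rule Vitali_covering_theorem_balls[of S ?K fst snd])
    fix x and d :: real assume x: "x \<in> S" and d: "d > 0"
    have "x \<in> U" using x T(1) U(2) by blast
    then obtain d' where d': "d' > 0" "ball x d' \<subseteq> U" using U(1) openE by blast
    obtain r z where r: "0 < r" "r < min d d'" "ball z (\<theta> * r) \<subseteq> ball x r" "ball z (\<theta> * r) \<inter> S = {}"
      using porous[OF x, unfolded porous_at_def, rule_format, of "min d d'"] d d'(1) by auto
    have "ball x r \<subseteq> U" using r(2) d'(2) subset_ball[of r d' x] by auto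
    then show "\<exists>i. i \<in> ?K \<and> x \<in> ball (fst i) (snd i) \<and> snd i < d"
      using r by (intro exI[of _ "(x, r)"]) auto
  qed
  have "\<exists>z. ball z (\<theta> * snd i) \<subseteq> ball (fst i) (snd i) \<and> ball z (\<theta> * snd i) \<inter> S = {}" if "i \<in> C" for i
    using subsetD[OF C(2) that] by (cases i) simp
  then obtain z where z: "\<And>i. i \<in> C \<Longrightarrow> ball (z i) (\<theta> * snd i) \<subseteq> ball (fst i) (snd i)"
    "\<And>i. i \<in> C \<Longrightarrow> ball (z i) (\<theta> * snd i) \<inter> S = {}" by metis
  have pos: "snd i > 0" if "i \<in> C" for i using subsetD[OF C(2) that] by (cases i) simp
  define B where "B = (\<Union>i\<in>C. ball (fst i) (snd i))"
  define H where "H = (\<Union>i\<in>C. ball (z i) (\<theta> * snd i))"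
  have "ball (fst i) (snd i) \<subseteq> U" if "i \<in> C" for i
    using subsetD[OF C(2) that] by (cases i) simp
  then have BU: "B \<subseteq> U" unfolding B_def by blast
  have HB: "H \<subseteq> B" unfolding B_def H_def using z(1) by blast
  have oB: "open B" "open H" unfolding B_def H_def by auto
  have dB: "disjoint_family_on (\<lambda>i. ball (fst i) (snd i)) C"
    using C(3) unfolding disjoint_family_on_def pairwise_def disjnt_def by blast
  then have dH: "disjoint_family_on (\<lambda>i. ball (z i) (\<theta> * snd i)) C"
    using z(1) unfolding disjoint_family_on_def by blast
  \<comment> \<open>Each hole has \<theta>^n times the measure of its ball, and both families are
    disjoint, so the ratio carries over to the unions.\<close>
  have "emeasure lborel H = (\<integral>\<^sup>+ i. emeasure lborel (ball (z i) (\<theta> * snd i)) \<partial>count_space C)"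
    unfolding H_def by (rule emeasure_UN_countable) (use C(1) dH in auto)
  also have "\<dots> = (\<integral>\<^sup>+ i. ennreal ?c * emeasure lborel (ball (fst i) (snd i)) \<partial>count_space C)"
  proof (rule nn_integral_cong)
    fix i assume "i \<in> space (count_space C)"
    then have "snd i > 0" using pos by simp
    then show "emeasure lborel (ball (z i) (\<theta> * snd i)) = ennreal ?c * emeasure lborel (ball (fst i) (snd i))"
      using \<theta> by (simp add: emeasure_ball power_mult_distrib ennreal_mult'[symmetric] mult_ac)
  qed
  also have "\<dots> = ennreal ?c * (\<integral>\<^sup>+ i. emeasure lborel (ball (fst i) (snd i)) \<partial>count_space C)"
    by (rule nn_integral_cmult) simp
  also have "(\<integral>\<^sup>+ i. emeasure lborel (ball (fst i) (snd i)) \<partial>count_space C) = emeasure lborel B"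
    unfolding B_def by (rule emeasure_UN_countable[symmetric]) (use C(1) dB in auto)
  finally have eq: "measure lebesgue H = ?c * measure lebesgue B"
    using oB \<theta> by (simp add: measure_def enn2real_mult)
  have Bm: "B \<in> lmeasurable" and Hm: "H \<in> lmeasurable"
    using fmeasurableI2[OF Ulm] BU HB oB by (auto intro: borel_open)
  have "m \<le> measure lebesgue B"
  proof -
    have N: "S - B \<in> null_sets lebesgue" using C(4) unfolding B_def negligible_iff_null_sets .
    have "B \<union> (S - B) \<in> lmeasurable"
      by (intro fmeasurable.Un Bm null_setsD1 fmeasurableI_null_sets N)
    moreover have "measure lebesgue (B \<union> (S - B)) = measure lebesgue B"
      by (rule measure_Un_null_set[OF fmeasurableD[OF Bm] N])
    moreover have "S \<subseteq> B \<union> (S - B)" by blast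
    ultimately show ?thesis using m_le by metis
  qed
  then have "m * ?c \<le> measure lebesgue H" using eq c by (simp add: mult.commute)
  moreover have "m \<le> measure lebesgue (U - H)"
  proof (rule m_le)
    show "S \<subseteq> U - H" using T(1) U(2) z(2) unfolding H_def by blast
    show "U - H \<in> lmeasurable" using Ulm Hm by (simp add: fmeasurable.Diff)
  qed
  moreover have "measure lebesgue (U - H) = measure lebesgue U - measure lebesgue H"
    using Ulm Hm HB BU by (intro measurable_measure_Diff) (auto simp: fmeasurableD)
  ultimately show False using Um by (simp add: algebra_simps)
qed

lemma porous_at_mono:
  assumes "porous_at \<theta> E x" "0 < \<theta>'" "\<theta>' \<le> \<theta>" "S \<subseteq> E"
  shows "porous_at \<theta>' S x"
  unfolding porous_at_def
proof (intro allI impI)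
  fix d :: real assume "d > 0"
  then obtain r z where r: "0 < r" "r < d" "ball z (\<theta> * r) \<subseteq> ball x r" "ball z (\<theta> * r) \<inter> E = {}"
    using assms(1) unfolding porous_at_def by blast
  have "\<theta>' * r \<le> \<theta> * r" using assms(3) r(1) by (intro mult_right_mono) auto
  then have "ball z (\<theta>' * r) \<subseteq> ball z (\<theta> * r)" by (rule subset_ball)
  then show "\<exists>r z. 0 < r \<and> r < d \<and> ball z (\<theta>' * r) \<subseteq> ball x r \<and> ball z (\<theta>' * r) \<inter> S = {}"
    using r assms(4) by (intro exI[of _ r] exI[of _ z]) blast
qed

lemma porous_imp_negligible:
  fixes S :: "'a::euclidean_space set"
  assumes \<theta>: "\<theta> > 0" and porous: "\<And>x. x \<in> S \<Longrightarrow> porous_at \<theta> S x"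
  shows "negligible S"
proof -
  have "negligible (S \<inter> ball 0 (real n))" for n
  proof (rule bounded_porous_imp_negligible[OF bounded_Int[OF disjI2[OF bounded_ball]] \<theta>])
    fix x assume "x \<in> S \<inter> ball 0 (real n)"
    then show "porous_at \<theta> (S \<inter> ball 0 (real n)) x"
      using porous_at_mono[OF porous \<theta>] by blast
  qed
  then have "negligible (\<Union>n. S \<inter> ball 0 (real n))" by (rule negligible_Union_nat)
  moreover have "S = (\<Union>n. S \<inter> ball 0 (real n))" by (auto simp: reals_Archimedean2)
  ultimately show ?thesis by simp
qed

text \<open>For each n the points where E is porous with constant 1 / (n + 1) form a negligible set.
  Off the countable union porosity fails for all constants at one and the same point.\<close>

lemma nonporous_point:
  fixes E :: "'a::euclidean_space set"
  assumes "\<not> negligible E"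
  obtains x where "x \<in> E" "\<And>\<theta>. \<theta> > 0 \<Longrightarrow> \<not> porous_at \<theta> E x"
proof -
  define P where "P n = {x\<in>E. porous_at (1 / real (Suc n)) E x}" for n
  have "negligible (P n)" for n
  proof (rule porous_imp_negligible[of "1 / real (Suc n)"])
    fix x assume "x \<in> P n"
    then show "porous_at (1 / real (Suc n)) (P n) x"
      unfolding P_def by (elim CollectE conjE porous_at_mono) auto
  qed simp
  then have "negligible (\<Union>n. P n)" by (rule negligible_Union_nat)
  then have "\<not> E \<subseteq> (\<Union>n. P n)" using assms negligible_subset by blast
  then obtain x where x: "x \<in> E" "\<And>n. x \<notin> P n" by blast
  have "\<not> porous_at \<theta> E x" if \<theta>: "\<theta> > 0" for \<theta>
  proof
    assume p: "porous_at \<theta> E x"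
    obtain n where "1 / real (Suc n) < \<theta>" using nat_approx_posE[OF \<theta>] .
    then have "porous_at (1 / real (Suc n)) E x" by (intro porous_at_mono[OF p]) auto
    then show False using x unfolding P_def by blast
  qed
  with x(1) show ?thesis by (rule that)
qed

section \<open>Blow-up at a contact point\<close>

text \<open>These are the points where f + g meets its upper supporting planes of slope at most
  \<tau>, as in Jensen's lemma. The maxima can be taken globally because sup-convolutions live on
  the whole space and decay quadratically.\<close>

definition contact_set :: "real \<Rightarrow> ('a::real_inner \<Rightarrow> real) \<Rightarrow> ('a \<Rightarrow> real) \<Rightarrow> 'a set" where
  "contact_set \<tau> f g = {x. \<exists>p. norm p \<le> \<tau> \<and> (\<forall>z. f z + g z - p \<bullet> z \<le> f x + g x - p \<bullet> x)}"

text \<open>A small multiple of u is used for h, with a factor t such that C t < 1.\<close>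

lemma eq_zero_if_inner_le_quadratic:
  fixes u :: "'a::real_inner"
  assumes "\<And>h. u \<bullet> h \<le> C * (norm h)\<^sup>2"
  shows "u = 0"
proof (rule ccontr)
  assume u: "u \<noteq> 0"
  define t where "t = 1 / (2 * (\<bar>C\<bar> + 1))"
  have t: "t > 0" by (simp add: t_def)
  have "u \<bullet> (t *\<^sub>R u) \<le> C * (norm (t *\<^sub>R u))\<^sup>2" by (rule assms)
  then have "t * (norm u)\<^sup>2 \<le> C * t * (t * (norm u)\<^sup>2)"
    by (simp add: power2_norm_eq_inner power_mult_distrib power2_eq_square[of t] mult_ac)
  moreover have "t * (norm u)\<^sup>2 > 0" using t u by simp
  ultimately have "1 \<le> C * t" by (metis mult_le_cancel_right1 mult.commute not_less)
  moreover have "C * t \<le> \<bar>C\<bar> * t" using t by (intro mult_right_mono) auto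
  moreover have "\<bar>C\<bar> * t < 1" unfolding t_def by (simp add: divide_less_eq)
  ultimately show False by linarith
qed

text \<open>Through the plane above f + g, the paraboloid below g becomes a paraboloid above f, and
  conversely. The slopes add up to p because a linear function below a quadratic one
  vanishes.\<close>

lemma contact_pinched:
  fixes f g :: "'a::real_inner \<Rightarrow> real"
  assumes f: "semiconvex c f" and g: "semiconvex c g"
    and touch: "\<And>z. f z + g z - p \<bullet> z \<le> f x + g x - p \<bullet> x"
  obtains a b where "a + b = p" "\<And>h. \<bar>f (x + h) - f x - a \<bullet> h\<bar> \<le> c * (norm h)\<^sup>2"
    "\<And>h. \<bar>g (x + h) - g x - b \<bullet> h\<bar> \<le> c * (norm h)\<^sup>2"
proof -
  obtain a where a: "\<And>h. f x + a \<bullet> h - c * (norm h)\<^sup>2 \<le> f (x + h)"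
    using f unfolding semiconvex_def by blast
  obtain b where b: "\<And>h. g x + b \<bullet> h - c * (norm h)\<^sup>2 \<le> g (x + h)"
    using g unfolding semiconvex_def by blast
  have t: "f (x + h) + g (x + h) \<le> f x + g x + p \<bullet> h" for h
    using touch[of "x + h"] by (simp add: inner_add_right)
  have "a + b - p = 0"
  proof (rule eq_zero_if_inner_le_quadratic)
    show "(a + b - p) \<bullet> h \<le> 2 * c * (norm h)\<^sup>2" for h
      using a[of h] b[of h] t[of h] by (simp add: inner_add_left inner_diff_left)
  qed
  then have p: "p = a + b" by simp
  have ph: "p \<bullet> h = a \<bullet> h + b \<bullet> h" for h by (simp add: p inner_add_left)
  have "\<bar>f (x + h) - f x - a \<bullet> h\<bar> \<le> c * (norm h)\<^sup>2" "\<bar>g (x + h) - g x - b \<bullet> h\<bar> \<le> c * (norm h)\<^sup>2" for h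
    using a[of h] b[of h] t[of h] ph[of h] by linarith+
  then show ?thesis using p that by metis
qed

text \<open>Put y = x + d and expand around x with the steps d + h and d, and around y with the step
  h: the values cancel and (p - q) \<bullet> h remains. For h of length |d| along p - q the errors
  are at most (4 + 1 + 1) K |d|^2.\<close>

lemma pinched_gradient_lipschitz:
  fixes w :: "'a::real_inner \<Rightarrow> real"
  assumes x: "\<And>h. \<bar>w (x + h) - w x - p \<bullet> h\<bar> \<le> K * (norm h)\<^sup>2"
    and y: "\<And>h. \<bar>w (y + h) - w y - q \<bullet> h\<bar> \<le> K * (norm h)\<^sup>2" and K: "K \<ge> 0"
  shows "norm (p - q) \<le> 6 * K * norm (x - y)"
proof (cases "x = y")
  case True
  have "p - q = 0"
  proof (rule eq_zero_if_inner_le_quadratic)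
    show "(p - q) \<bullet> h \<le> 2 * K * (norm h)\<^sup>2" for h
      using x[of h] y[of h] unfolding True inner_diff_left by linarith
  qed
  then show ?thesis using True by simp
next
  case False
  define d where "d = y - x"
  define h where "h = norm d *\<^sub>R sgn (p - q)"
  have d: "norm d > 0" "norm (x - y) = norm d" using False by (auto simp: d_def norm_minus_commute)
  have nh: "norm h \<le> norm d" by (simp add: h_def norm_sgn)
  have e: "x + (d + h) = y + h" "x + d = y" by (simp_all add: d_def)
  have "(p - q) \<bullet> h \<le> K * (norm (d + h))\<^sup>2 + K * (norm d)\<^sup>2 + K * (norm h)\<^sup>2"
    using x[of "d + h"] x[of d] y[of h] unfolding e inner_diff_left inner_add_right by linarith
  also have "\<dots> \<le> K * (2 * norm d)\<^sup>2 + K * (norm d)\<^sup>2 + K * (norm d)\<^sup>2"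
    using norm_triangle_ineq[of d h] nh K by (intro add_mono mult_left_mono power_mono) auto
  also have "\<dots> = 6 * K * norm d * norm d" by (simp add: power2_eq_square)
  also have "(p - q) \<bullet> h = norm (p - q) * norm d"
    by (cases "p = q") (simp_all add: h_def sgn_div_norm dot_square_norm power2_eq_square)
  finally show ?thesis using d by simp
qed

text \<open>By the Lipschitz bound, a negligible contact set would have a negligible gradient image,
  but every small slope \<open>p\<close> occurs at some contact point.\<close>

lemma contact_set_not_negligible:
  fixes f g :: "'a::euclidean_space \<Rightarrow> real"
  assumes f: "semiconvex c f" and g: "semiconvex c g" and c: "c \<ge> 0" and \<tau>: "\<tau> > 0"
    and max: "\<And>p. norm p \<le> \<tau> \<Longrightarrow> \<exists>x. \<forall>z. f z + g z - p \<bullet> z \<le> f x + g x - p \<bullet> x"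
  shows "\<not> negligible (contact_set \<tau> f g)"
proof
  assume neg: "negligible (contact_set \<tau> f g)"
  define touch where "touch p x \<longleftrightarrow> (\<forall>z. f z + g z - p \<bullet> z \<le> f x + g x - p \<bullet> x)" for p x
  have pin: "\<bar>(f (x + h) + g (x + h)) - (f x + g x) - p \<bullet> h\<bar> \<le> 2 * c * (norm h)\<^sup>2" if "touch p x" for p x h
  proof -
    obtain a b where ab: "a + b = p" "\<bar>f (x + h) - f x - a \<bullet> h\<bar> \<le> c * (norm h)\<^sup>2"
      "\<bar>g (x + h) - g x - b \<bullet> h\<bar> \<le> c * (norm h)\<^sup>2"
      using contact_pinched[OF f g] \<open>touch p x\<close> unfolding touch_def by metis
    have "p \<bullet> h = a \<bullet> h + b \<bullet> h" using ab(1) by (metis inner_add_left)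
    then show ?thesis using ab(2,3) by linarith
  qed
  have lip: "norm (p - q) \<le> 12 * c * norm (x - y)" if "touch p x" "touch q y" for p q x y
    using pinched_gradient_lipschitz[of "\<lambda>x. f x + g x", OF pin[OF that(1)] pin[OF that(2)]] c by simp
  \<comment> \<open>Any choice would do: \<open>lip\<close> with both points equal shows that the
    slope at a contact point is unique, and this makes \<open>P\<close> hit every slope in the
    ball.\<close>
  define P where "P x = (SOME p. norm p \<le> \<tau> \<and> touch p x)" for x
  have P: "norm (P x) \<le> \<tau> \<and> touch (P x) x" if "x \<in> contact_set \<tau> f g" for x
  proof -
    have "\<exists>p. norm p \<le> \<tau> \<and> touch p x" using that unfolding contact_set_def touch_def by simp
    then show ?thesis unfolding P_def by (rule someI_ex)
  qed
  have "negligible (P ` contact_set \<tau> f g)"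
  proof (rule negligible_locally_Lipschitz_image[OF _ neg])
    fix x assume "x \<in> contact_set \<tau> f g"
    then have "norm (P y - P x) \<le> 12 * c * norm (y - x)" if "y \<in> contact_set \<tau> f g" for y
      using lip P that by blast
    then show "\<exists>T B. open T \<and> x \<in> T \<and> (\<forall>y\<in>contact_set \<tau> f g \<inter> T. norm (P y - P x) \<le> B * norm (y - x))"
      by (intro exI[of _ UNIV] exI[of _ "12 * c"]) simp
  qed simp
  moreover have "ball 0 \<tau> \<subseteq> P ` contact_set \<tau> f g"
  proof
    fix p :: 'a assume "p \<in> ball 0 \<tau>"
    then have np: "norm p \<le> \<tau>" by simp
    then obtain x where x: "touch p x" using max unfolding touch_def by blast
    then have xc: "x \<in> contact_set \<tau> f g" using np unfolding contact_set_def touch_def by blast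
    have "norm (p - P x) \<le> 12 * c * norm (x - x)" using lip x P[OF xc] by blast
    then have "p = P x" by simp
    then show "p \<in> P ` contact_set \<tau> f g" using xc by blast
  qed
  ultimately have "negligible (ball (0::'a) \<tau>)" using negligible_subset by blast
  then show False using open_not_negligible[of "ball (0::'a) \<tau>"] \<tau> by simp
qed

lemma semiconvex_rescale:
  assumes sc: "semiconvex K f" and r: "r > 0"
  shows "semiconvex K (\<lambda>h. (f (x + r *\<^sub>R h) - c - a \<bullet> h) / r\<^sup>2)"
  unfolding semiconvex_def
proof
  fix y
  obtain b where b: "\<And>h. f (x + r *\<^sub>R y) + b \<bullet> h - K * (norm h)\<^sup>2 \<le> f (x + r *\<^sub>R y + h)"
    using sc unfolding semiconvex_def by blast
  have "(f (x + r *\<^sub>R y) - c - a \<bullet> y) / r\<^sup>2 + ((1 / r\<^sup>2) *\<^sub>R (r *\<^sub>R b - a)) \<bullet> h - K * (norm h)\<^sup>2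
      \<le> (f (x + r *\<^sub>R (y + h)) - c - a \<bullet> (y + h)) / r\<^sup>2" for h
  proof -
    have "f (x + r *\<^sub>R y) + b \<bullet> (r *\<^sub>R h) - K * (norm h)\<^sup>2 * r\<^sup>2 \<le> f (x + r *\<^sub>R y + r *\<^sub>R h)"
      using b[of "r *\<^sub>R h"] by (simp add: power_mult_distrib mult_ac)
    then have "(f (x + r *\<^sub>R y) + b \<bullet> (r *\<^sub>R h) - K * (norm h)\<^sup>2 * r\<^sup>2 - c - a \<bullet> (y + h)) / r\<^sup>2
      \<le> (f (x + r *\<^sub>R y + r *\<^sub>R h) - c - a \<bullet> (y + h)) / r\<^sup>2"
      using r by (intro divide_right_mono) auto
    moreover have "(f (x + r *\<^sub>R y) + b \<bullet> (r *\<^sub>R h) - K * (norm h)\<^sup>2 * r\<^sup>2 - c - a \<bullet> (y + h)) / r\<^sup>2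
      = (f (x + r *\<^sub>R y) - c - a \<bullet> y) / r\<^sup>2 + ((1 / r\<^sup>2) *\<^sub>R (r *\<^sub>R b - a)) \<bullet> h - K * (norm h)\<^sup>2"
      using r by (simp add: inner_diff_left inner_add_right diff_divide_distrib add_divide_distrib)
    ultimately show ?thesis by (simp add: scaleR_add_right add.assoc)
  qed
  then show "\<exists>b. \<forall>h. (f (x + r *\<^sub>R y) - c - a \<bullet> y) / r\<^sup>2 + b \<bullet> h - K * (norm h)\<^sup>2
      \<le> (f (x + r *\<^sub>R (y + h)) - c - a \<bullet> (y + h)) / r\<^sup>2" by blast
qed

text \<open>The function f + K |x|^2 has an affine function supporting it from below at every point,
  hence it is convex, and convex functions are continuous in finite dimension.\<close>

lemma semiconvex_continuous:
  fixes f :: "'a::euclidean_space \<Rightarrow> real"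
  assumes "semiconvex K f" shows "continuous_on UNIV f"
proof -
  define \<phi> where "\<phi> x = f x + K * (x \<bullet> x)" for x
  have "\<exists>b. \<forall>h. \<phi> x + b \<bullet> h \<le> \<phi> (x + h)" for x
  proof -
    obtain a where a: "\<And>h. f x + a \<bullet> h - K * (norm h)\<^sup>2 \<le> f (x + h)"
      using assms unfolding semiconvex_def by blast
    have "\<phi> x + (a + (2 * K) *\<^sub>R x) \<bullet> h \<le> \<phi> (x + h)" for h
      using a[of h] by (simp add: \<phi>_def inner_add_left inner_add_right inner_commute power2_norm_eq_inner algebra_simps)
    then show ?thesis by blast
  qed
  then obtain b where b: "\<And>x h. \<phi> x + b x \<bullet> h \<le> \<phi> (x + h)" by metis
  have "convex_on UNIV \<phi>"
  proof (rule convex_onI)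
    fix t :: real and x y :: 'a assume t: "0 < t" "t < 1"
    let ?z = "(1 - t) *\<^sub>R x + t *\<^sub>R y"
    have "(1 - t) * (\<phi> ?z + b ?z \<bullet> (x - ?z)) + t * (\<phi> ?z + b ?z \<bullet> (y - ?z)) \<le> (1 - t) * \<phi> x + t * \<phi> y"
      using b[of ?z "x - ?z"] b[of ?z "y - ?z"] t by (intro add_mono mult_left_mono) auto
    moreover have "(1 - t) * (b ?z \<bullet> (x - ?z)) + t * (b ?z \<bullet> (y - ?z)) = b ?z \<bullet> ((1 - t) *\<^sub>R (x - ?z) + t *\<^sub>R (y - ?z))"
      by (simp only: inner_add_right inner_scaleR_right)
    moreover have "(1 - t) *\<^sub>R (x - ?z) + t *\<^sub>R (y - ?z) = 0" by (simp add: algebra_simps)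
    ultimately show "\<phi> ?z \<le> (1 - t) * \<phi> x + t * \<phi> y" by (simp add: algebra_simps)
  qed simp
  then have "continuous_on UNIV \<phi>" by (intro convex_on_continuous) auto
  then have "continuous_on UNIV (\<lambda>x. \<phi> x - K * (x \<bullet> x))" by (intro continuous_intros)
  then show ?thesis by (simp add: \<phi>_def)
qed

text \<open>At a non-porous point of the contact set, the rescaled contact sets become dense, so that in the
  limit \<open>f0 + g0\<close> is touched from above by an affine function at every point.\<close>

lemma contact_blowup:
  fixes f g :: "real^'n \<Rightarrow> real"
  assumes f: "semiconvex c f" and g: "semiconvex c g" and c: "c \<ge> 0"
    and neg: "\<not> negligible (contact_set \<tau> f g)"
    and U: "open U" "contact_set \<tau> f g \<subseteq> U" and vf: "visc_sub S1 U f" and vg: "visc_sub S2 U g"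
  obtains f0 where "pinched c f0" "visc_sub S1 UNIV f0" "visc_sub S2 UNIV (\<lambda>x. - f0 x)"
proof -
  let ?E = "contact_set \<tau> f g"
  have contact: "\<exists>a b. \<forall>h. \<bar>f (x + h) - f x - a \<bullet> h\<bar> \<le> c * (norm h)\<^sup>2
      \<and> \<bar>g (x + h) - g x - b \<bullet> h\<bar> \<le> c * (norm h)\<^sup>2
      \<and> f (x + h) + g (x + h) \<le> f x + g x + (a + b) \<bullet> h" if "x \<in> ?E" for x
  proof -
    obtain p where p: "\<And>z. f z + g z - p \<bullet> z \<le> f x + g x - p \<bullet> x"
      using \<open>x \<in> ?E\<close> unfolding contact_set_def by blast
    obtain a b where ab: "a + b = p" "\<And>h. \<bar>f (x + h) - f x - a \<bullet> h\<bar> \<le> c * (norm h)\<^sup>2"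
      "\<And>h. \<bar>g (x + h) - g x - b \<bullet> h\<bar> \<le> c * (norm h)\<^sup>2"
      using contact_pinched[OF f g p] by blast
    have "f (x + h) + g (x + h) \<le> f x + g x + (a + b) \<bullet> h" for h
      using p[of "x + h"] unfolding ab(1) inner_add_right by linarith
    with ab show ?thesis by blast
  qed
  obtain x0 where x0: "x0 \<in> ?E" and dense: "\<And>\<theta>. \<theta> > 0 \<Longrightarrow> \<not> porous_at \<theta> ?E x0"
    using nonporous_point[OF neg] by blast
  obtain a0 b0 where a0: "\<And>h. \<bar>f (x0 + h) - f x0 - a0 \<bullet> h\<bar> \<le> c * (norm h)\<^sup>2"
    and b0: "\<And>h. \<bar>g (x0 + h) - g x0 - b0 \<bullet> h\<bar> \<le> c * (norm h)\<^sup>2"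
    using contact[OF x0] by metis
  define R where "R k = 1 / real (Suc k)" for k
  have R: "R k > 0" for k by (simp add: R_def)
  define F where "F k h = (f (x0 + R k *\<^sub>R h) - f x0 - (R k *\<^sub>R a0) \<bullet> h) / (R k)\<^sup>2" for k h
  define G where "G k h = (g (x0 + R k *\<^sub>R h) - g x0 - (R k *\<^sub>R b0) \<bullet> h) / (R k)\<^sup>2" for k h
  have scF: "semiconvex c (F k)" and scG: "semiconvex c (G k)" for k
    unfolding F_def G_def by (intro semiconvex_rescale f g R)+
  have quot: "\<bar>t / (R k)\<^sup>2\<bar> \<le> c * (norm h)\<^sup>2" if "\<bar>t\<bar> \<le> c * (norm (R k *\<^sub>R h))\<^sup>2" for t k and h :: "real^'n"
    using that R[of k] by (simp add: abs_divide pos_divide_le_eq power_mult_distrib mult_ac)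
  have bdF: "\<bar>F k h\<bar> \<le> c * (norm h)\<^sup>2" for k h
    unfolding F_def by (rule quot) (use a0[of "R k *\<^sub>R h"] in simp)
  have bdG: "\<bar>G k h\<bar> \<le> c * (norm h)\<^sup>2" for k h
    unfolding G_def by (rule quot) (use b0[of "R k *\<^sub>R h"] in simp)
  obtain r1 f0 where r1: "strict_mono r1" and lim1: "loc_unif_lim (\<lambda>k. F (r1 k)) f0"
    by (rule semiconvex_compactness[OF scF bdF c])
  \<comment> \<open>The second extraction is made inside the first, so that f and g are blown up
    along common scales.\<close>
  obtain r2 g0 where r2: "strict_mono r2" and lim2: "loc_unif_lim (\<lambda>k. G (r1 (r2 k))) g0"
    by (rule semiconvex_compactness[OF scG bdG c, of "\<lambda>k. r1 k"])
  define \<rho> where "\<rho> k = r1 (r2 k)" for k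
  have \<rho>: "\<rho> k \<ge> k" for k
    unfolding \<rho>_def using seq_suble[OF r2, of k] seq_suble[OF r1, of "r2 k"] by linarith
  have limF: "loc_unif_lim (\<lambda>k. F (\<rho> k)) f0" and limG: "loc_unif_lim (\<lambda>k. G (\<rho> k)) g0"
    using loc_unif_lim_subseq[OF lim1 r2] lim2 unfolding \<rho>_def by simp_all
  have contF: "continuous_on UNIV (F k)" and contG: "continuous_on UNIV (G k)" for k
    using semiconvex_continuous scF scG by blast+
  have R0: "\<forall>\<^sub>F k in sequentially. R (\<rho> k) < d" if d: "d > 0" for d
  proof -
    obtain N where N: "1 / real (Suc N) < d" using nat_approx_posE[OF d] .
    have "R (\<rho> k) < d" if "k \<ge> N" for k
    proof -
      have "R (\<rho> k) \<le> 1 / real (Suc N)"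
        unfolding R_def using \<rho>[of k] that by (intro divide_left_mono) auto
      with N show ?thesis by simp
    qed
    then show ?thesis unfolding eventually_sequentially by blast
  qed
  have planes: "\<exists>l m. \<forall>h. \<bar>f0 (x + h) - f0 x - l \<bullet> h\<bar> \<le> c * (norm h)\<^sup>2 \<and>
      f0 (x + h) + g0 (x + h) \<le> f0 x + g0 x + (l + m) \<bullet> h" for x
  proof -
    have "\<exists>k\<ge>j. \<exists>y. norm (y - x) < 1 / real (Suc j) \<and> x0 + R (\<rho> k) *\<^sub>R y \<in> ?E" for j
    proof -
      \<comment> \<open>Write R for the scale. The ball of radius \<epsilon> R around x0 + R x lies
        in the ball of radius r = (|x| + \<epsilon>) R around x0 and has relative size \<theta>.
        Non-porosity puts a contact point into it, which in rescaled coordinates is within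
        \<epsilon> of x.\<close>
      define \<epsilon> where "\<epsilon> = 1 / real (Suc j)"
      define \<theta> where "\<theta> = \<epsilon> / (norm x + \<epsilon>)"
      have \<epsilon>: "\<epsilon> > 0" by (simp add: \<epsilon>_def)
      have nx: "norm x + \<epsilon> > 0" using \<epsilon> by (simp add: add_nonneg_pos)
      have \<theta>: "\<theta> > 0" using \<epsilon> nx by (simp add: \<theta>_def)
      obtain d where d: "d > 0" "\<And>r z. 0 < r \<Longrightarrow> r < d \<Longrightarrow> ball z (\<theta> * r) \<subseteq> ball x0 r
          \<Longrightarrow> ball z (\<theta> * r) \<inter> ?E \<noteq> {}"
        using dense[OF \<theta>] unfolding porous_at_def by blast
      have "\<forall>\<^sub>F k in sequentially. k \<ge> j \<and> R (\<rho> k) < d / (norm x + \<epsilon>)"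
        using eventually_ge_at_top R0[of "d / (norm x + \<epsilon>)"] d(1) nx by (intro eventually_conj) auto
      then obtain k where k: "k \<ge> j" "R (\<rho> k) < d / (norm x + \<epsilon>)"
        unfolding eventually_sequentially by blast
      define r where "r = (norm x + \<epsilon>) * R (\<rho> k)"
      let ?z = "x0 + R (\<rho> k) *\<^sub>R x"
      have r: "r > 0" "r < d" using nx R k(2) by (simp_all add: r_def pos_less_divide_eq mult.commute)
      have \<theta>r: "\<theta> * r = \<epsilon> * R (\<rho> k)" using nx by (simp add: \<theta>_def r_def)
      have "ball ?z (\<theta> * r) \<subseteq> ball x0 r"
      proof
        fix y assume "y \<in> ball ?z (\<theta> * r)"
        then have "norm (?z - y) < \<epsilon> * R (\<rho> k)" by (simp add: dist_norm \<theta>r)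
        moreover have "norm (x0 - y) \<le> norm (?z - y) + norm (R (\<rho> k) *\<^sub>R x)"
          using norm_triangle_ineq4[of "?z - y" "R (\<rho> k) *\<^sub>R x"] by simp
        moreover have "norm (R (\<rho> k) *\<^sub>R x) = norm x * R (\<rho> k)" using R[of "\<rho> k"] by simp
        ultimately have "norm (x0 - y) < (norm x + \<epsilon>) * R (\<rho> k)" unfolding distrib_right by linarith
        then show "y \<in> ball x0 r" by (simp add: r_def dist_norm)
      qed
      then have "ball ?z (\<epsilon> * R (\<rho> k)) \<inter> ?E \<noteq> {}" using d(2)[OF r] unfolding \<theta>r by blast
      then obtain e where e: "e \<in> ball ?z (\<epsilon> * R (\<rho> k))" "e \<in> ?E" by blast
      define y where "y = (1 / R (\<rho> k)) *\<^sub>R (e - x0)"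
      have ye: "x0 + R (\<rho> k) *\<^sub>R y = e" using R[of "\<rho> k"] by (simp add: y_def)
      have "R (\<rho> k) * norm (y - x) = norm (R (\<rho> k) *\<^sub>R (y - x))" using R[of "\<rho> k"] by simp
      also have "R (\<rho> k) *\<^sub>R (y - x) = e - ?z" using ye by (simp add: scaleR_diff_right algebra_simps)
      also have "norm (e - ?z) < R (\<rho> k) * \<epsilon>" using e(1) by (simp add: dist_norm norm_minus_commute mult.commute)
      finally have "norm (y - x) < \<epsilon>" using R[of "\<rho> k"] by simp
      then show ?thesis using k(1) ye e(2) unfolding \<epsilon>_def by metis
    qed
    then obtain \<kappa> X where \<kappa>: "\<And>j. \<kappa> j \<ge> j" and X: "\<And>j. norm (X j - x) < 1 / real (Suc j)"
      and XE: "\<And>j. x0 + R (\<rho> (\<kappa> j)) *\<^sub>R X j \<in> ?E" by metis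
    have Xx: "X \<longlonglongrightarrow> x"
    proof (rule LIM_zero_cancel, rule Lim_null_comparison)
      show "\<forall>\<^sub>F j in sequentially. norm (X j - x) \<le> 1 / real (Suc j)" using X by (simp add: less_imp_le)
      show "(\<lambda>j. 1 / real (Suc j)) \<longlonglongrightarrow> 0" by (rule LIMSEQ_Suc[OF lim_1_over_n])
    qed
    define F' where "F' j = F (\<rho> (\<kappa> j))" for j
    define G' where "G' j = G (\<rho> (\<kappa> j))" for j
    have limF': "loc_unif_lim F' f0" and limG': "loc_unif_lim G' g0"
      unfolding F'_def G'_def using loc_unif_lim_reindex[OF limF \<kappa>] loc_unif_lim_reindex[OF limG \<kappa>] by auto
    have "\<exists>a b. \<forall>h. \<bar>F' j (X j + h) - F' j (X j) - a \<bullet> h\<bar> \<le> c * (norm h)\<^sup>2 \<and>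
        \<bar>G' j (X j + h) - G' j (X j) - b \<bullet> h\<bar> \<le> c * (norm h)\<^sup>2 \<and>
        F' j (X j + h) + G' j (X j + h) \<le> F' j (X j) + G' j (X j) + (a + b) \<bullet> h" for j
    proof -
      let ?R = "R (\<rho> (\<kappa> j))" and ?x = "x0 + R (\<rho> (\<kappa> j)) *\<^sub>R X j"
      obtain a b where a: "\<And>h. \<bar>f (?x + h) - f ?x - a \<bullet> h\<bar> \<le> c * (norm h)\<^sup>2"
        and b: "\<And>h. \<bar>g (?x + h) - g ?x - b \<bullet> h\<bar> \<le> c * (norm h)\<^sup>2"
        and ab: "\<And>h. f (?x + h) + g (?x + h) \<le> f ?x + g ?x + (a + b) \<bullet> h"
        using contact[OF XE] by metis
      have Rp: "?R > 0" by (rule R)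
      have dF: "F' j (X j + h) - F' j (X j) - ((1 / ?R) *\<^sub>R (a - a0)) \<bullet> h = (f (?x + ?R *\<^sub>R h) - f ?x - a \<bullet> (?R *\<^sub>R h)) / ?R\<^sup>2" for h
        using Rp by (simp add: F'_def F_def inner_add_right inner_diff_left scaleR_add_right add.assoc field_simps power2_eq_square)
      have dG: "G' j (X j + h) - G' j (X j) - ((1 / ?R) *\<^sub>R (b - b0)) \<bullet> h = (g (?x + ?R *\<^sub>R h) - g ?x - b \<bullet> (?R *\<^sub>R h)) / ?R\<^sup>2" for h
        using Rp by (simp add: G'_def G_def inner_add_right inner_diff_left scaleR_add_right add.assoc field_simps power2_eq_square)
      have "F' j (X j + h) + G' j (X j + h) \<le> F' j (X j) + G' j (X j) + ((1 / ?R) *\<^sub>R (a - a0) + (1 / ?R) *\<^sub>R (b - b0)) \<bullet> h" for h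
      proof -
        have "(f (?x + ?R *\<^sub>R h) - f ?x - a \<bullet> (?R *\<^sub>R h)) / ?R\<^sup>2 + (g (?x + ?R *\<^sub>R h) - g ?x - b \<bullet> (?R *\<^sub>R h)) / ?R\<^sup>2 \<le> 0"
          unfolding add_divide_distrib[symmetric]
          by (rule divide_nonpos_nonneg) (use ab[of "?R *\<^sub>R h"] in \<open>simp_all add: inner_add_left distrib_left\<close>)
        then show ?thesis unfolding dF[symmetric] dG[symmetric] inner_add_left by linarith
      qed
      moreover have "\<bar>F' j (X j + h) - F' j (X j) - ((1 / ?R) *\<^sub>R (a - a0)) \<bullet> h\<bar> \<le> c * (norm h)\<^sup>2" for h
        unfolding dF by (rule quot) (rule a)
      moreover have "\<bar>G' j (X j + h) - G' j (X j) - ((1 / ?R) *\<^sub>R (b - b0)) \<bullet> h\<bar> \<le> c * (norm h)\<^sup>2" for h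
        unfolding dG by (rule quot) (rule b)
      ultimately show ?thesis by blast
    qed
    then obtain a b where a: "\<And>j h. \<bar>F' j (X j + h) - F' j (X j) - a j \<bullet> h\<bar> \<le> c * (norm h)\<^sup>2"
      and b: "\<And>j h. \<bar>G' j (X j + h) - G' j (X j) - b j \<bullet> h\<bar> \<le> c * (norm h)\<^sup>2"
      and ab: "\<And>j h. F' j (X j + h) + G' j (X j + h) \<le> F' j (X j) + G' j (X j) + (a j + b j) \<bullet> h"
      by metis
    have contF': "continuous_on UNIV (F' j)" and contG': "continuous_on UNIV (G' j)" for j
      unfolding F'_def G'_def by (rule contF contG)+
    have "F' k (X k) + a k \<bullet> h - c * (norm h)\<^sup>2 \<le> F' k (X k + h)" for k h using a[of k h] by linarith
    \<comment> \<open>The slopes of \<open>F'\<close> and then those of \<open>G'\<close> converge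
      along nested subsequences; the sum of the limits is the slope of the limiting plane.\<close>
    from subgradients_convergent_subseq[OF limF' contF' Xx this]
    obtain s1 l where s1: "strict_mono s1" and l: "(\<lambda>k. a (s1 k)) \<longlonglongrightarrow> l" .
    have Xs1: "(\<lambda>k. X (s1 k)) \<longlonglongrightarrow> x" using LIMSEQ_subseq_LIMSEQ[OF Xx s1] by (simp add: o_def)
    have "G' (s1 k) (X (s1 k)) + b (s1 k) \<bullet> h - c * (norm h)\<^sup>2 \<le> G' (s1 k) (X (s1 k) + h)" for k h
      using b[of "s1 k" h] by linarith
    from subgradients_convergent_subseq[OF loc_unif_lim_subseq[OF limG' s1] contG' Xs1 this]
    obtain s2 m where s2: "strict_mono s2" and m: "(\<lambda>k. b (s1 (s2 k))) \<longlonglongrightarrow> m" .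
    define s where "s k = s1 (s2 k)" for k
    have sm: "strict_mono s" using s1 s2 unfolding s_def by (simp add: strict_mono_def)
    have m: "(\<lambda>k. b (s k)) \<longlonglongrightarrow> m" using m by (simp add: s_def)
    have l': "(\<lambda>k. a (s k)) \<longlonglongrightarrow> l" using LIMSEQ_subseq_LIMSEQ[OF l s2] by (simp add: o_def s_def)
    have X': "(\<lambda>k. X (s k)) \<longlonglongrightarrow> x" using LIMSEQ_subseq_LIMSEQ[OF Xx sm] by (simp add: o_def)
    have F'': "(\<lambda>k. F' (s k) (Y k)) \<longlonglongrightarrow> f0 y" and G'': "(\<lambda>k. G' (s k) (Y k)) \<longlonglongrightarrow> g0 y"
      if "Y \<longlonglongrightarrow> y" for Y y
      using loc_unif_lim_moving[OF loc_unif_lim_subseq[OF limF' sm] contF' that]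
        loc_unif_lim_moving[OF loc_unif_lim_subseq[OF limG' sm] contG' that] by auto
    have Xh: "(\<lambda>k. X (s k) + h) \<longlonglongrightarrow> x + h" for h by (intro tendsto_intros X')
    have "\<bar>f0 (x + h) - f0 x - l \<bullet> h\<bar> \<le> c * (norm h)\<^sup>2" for h
    proof (rule LIMSEQ_le_const2)
      show "(\<lambda>k. \<bar>F' (s k) (X (s k) + h) - F' (s k) (X (s k)) - a (s k) \<bullet> h\<bar>) \<longlonglongrightarrow> \<bar>f0 (x + h) - f0 x - l \<bullet> h\<bar>"
        by (intro tendsto_intros F'' X' l')
    qed (use a in blast)
    moreover have "f0 (x + h) + g0 (x + h) \<le> f0 x + g0 x + (l + m) \<bullet> h" for h
    proof (rule LIMSEQ_le)
      show "(\<lambda>k. F' (s k) (X (s k) + h) + G' (s k) (X (s k) + h)) \<longlonglongrightarrow> f0 (x + h) + g0 (x + h)"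
        by (intro tendsto_intros F'' G'' X')
      show "(\<lambda>k. F' (s k) (X (s k)) + G' (s k) (X (s k)) + (a (s k) + b (s k)) \<bullet> h) \<longlonglongrightarrow> f0 x + g0 x + (l + m) \<bullet> h"
        by (intro tendsto_intros F'' G'' X' l' m)
    qed (use ab in blast)
    ultimately show ?thesis by blast
  qed
  have pin: "pinched c f0" unfolding pinched_def using planes by blast
  \<comment> \<open>The rescaled copies of a neighbourhood of x0 eventually contain every ball, so
    the limits satisfy their inequalities on the whole space.\<close>
  have Uball: "\<forall>\<^sub>F k in sequentially. ball 0 B \<subseteq> {h. x0 + R (\<rho> k) *\<^sub>R h \<in> U}" for B
  proof -
    obtain d where d: "d > 0" "ball x0 d \<subseteq> U" using U x0 openE by blast
    have B1: "\<bar>B\<bar> + 1 > 0" by simp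
    have "\<forall>\<^sub>F k in sequentially. R (\<rho> k) < d / (\<bar>B\<bar> + 1)" using d(1) B1 by (intro R0) simp
    then show ?thesis
    proof eventually_elim
      case (elim k)
      have "x0 + R (\<rho> k) *\<^sub>R h \<in> ball x0 d" if "h \<in> ball 0 B" for h
      proof -
        have "R (\<rho> k) * norm h \<le> R (\<rho> k) * (\<bar>B\<bar> + 1)" using that R[of "\<rho> k"] by (intro mult_left_mono) auto
        also have "\<dots> < d" using elim B1 by (simp only: pos_less_divide_eq)
        finally show ?thesis using R[of "\<rho> k"] by (simp add: dist_norm)
      qed
      then show ?case using d(2) by blast
    qed
  qed
  have "visc_sub S1 {h. x0 + R (\<rho> k) *\<^sub>R h \<in> U} (F (\<rho> k))" for k
    unfolding F_def by (rule visc_sub_rescale[OF vf R])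
  from visc_sub_limit[OF limF contF this Uball] have v1: "visc_sub S1 UNIV f0" .
  have "visc_sub S2 {h. x0 + R (\<rho> k) *\<^sub>R h \<in> U} (G (\<rho> k))" for k
    unfolding G_def by (rule visc_sub_rescale[OF vg R])
  from visc_sub_limit[OF limG contG this Uball] have v2: "visc_sub S2 UNIV g0" .
  have "visc_sub S2 UNIV (\<lambda>x. - f0 x)"
    unfolding visc_sub_def
  proof (intro ballI allI impI)
    fix x p :: "real^'n" and A :: "real^'n^'n" and \<eta> :: real
    assume A: "A \<in> Sym" and \<eta>: "\<eta> > 0"
      and ev: "\<forall>\<^sub>F y in nhds x. - f0 y \<le> - f0 x + p \<bullet> (y - x) + (y - x) \<bullet> (A *v (y - x)) / 2"
    obtain l m where lm: "\<And>h. f0 (x + h) + g0 (x + h) \<le> f0 x + g0 x + (l + m) \<bullet> h" using planes by metis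
    \<comment> \<open>A paraboloid above -f0, added to the plane above f0 + g0, lies above g0 and
      has the same matrix A.\<close>
    from ev have "\<forall>\<^sub>F y in nhds x. g0 y \<le> g0 x + (p + (l + m)) \<bullet> (y - x) + (y - x) \<bullet> (A *v (y - x)) / 2"
    proof eventually_elim
      case (elim y)
      then show ?case using lm[of "y - x"] unfolding inner_add_left[of p] by simp
    qed
    from visc_subD[OF v2 UNIV_I A this \<eta>] show "A + \<eta> *\<^sub>R mat 1 \<in> S2" .
  qed
  with pin v1 show ?thesis using that by blast
qed

section \<open>Sup-convolutions and the maximum principle\<close>

lemma usc_onD:
  fixes f :: "'a::metric_space \<Rightarrow> real"
  assumes "usc_on S f" "x \<in> S" "f x < a"
  obtains d where "d > 0" "\<And>y. y \<in> S \<Longrightarrow> dist y x < d \<Longrightarrow> f y < a"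
  using assms unfolding usc_on_def eventually_at by metis

lemma usc_on_seq:
  fixes f :: "'a::metric_space \<Rightarrow> real"
  assumes "usc_on S f" "x \<in> S" "f x < a" "X \<longlonglongrightarrow> x" "\<And>k. X k \<in> S"
  shows "\<forall>\<^sub>F k in sequentially. f (X k) < a"
proof -
  obtain d where d: "d > 0" "\<And>y. y \<in> S \<Longrightarrow> dist y x < d \<Longrightarrow> f y < a"
    using usc_onD[OF assms(1-3)] by blast
  from tendstoD[OF assms(4) d(1)] show ?thesis by eventually_elim (use d(2) assms(5) in blast)
qed

lemma usc_on_diff_continuous:
  fixes f :: "'a::topological_space \<Rightarrow> real"
  assumes f: "usc_on S f" and q: "continuous_on S q"
  shows "usc_on S (\<lambda>x. f x - q x)"
  unfolding usc_on_def
proof (intro ballI allI impI)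
  fix x a assume x: "x \<in> S" and a: "f x - q x < a"
  define \<delta> where "\<delta> = (a - (f x - q x)) / 2"
  have \<delta>: "\<delta> > 0" using a by (simp add: \<delta>_def)
  have "\<forall>\<^sub>F y in at x within S. f y < f x + \<delta>" using f x \<delta> unfolding usc_on_def by simp
  moreover have "\<forall>\<^sub>F y in at x within S. q y > q x - \<delta>"
    using q x \<delta> unfolding continuous_on_def by (intro order_tendstoD(1)) auto
  ultimately show "\<forall>\<^sub>F y in at x within S. f y - q y < a"
  proof eventually_elim
    case (elim y)
    moreover have "f x + \<delta> - (q x - \<delta>) = a" by (simp add: \<delta>_def field_simps)
    ultimately show ?case by linarith
  qed
qed

text \<open>Otherwise each x has a neighbourhood on which f stays below its value at some
  \<open>Y x\<close>. Finitely many of these cover K, and the largest of the finitely many values f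
  (\<open>Y x\<close>) would lie below another one.\<close>

lemma usc_on_compact_attains_sup:
  fixes f :: "'a::metric_space \<Rightarrow> real"
  assumes K: "compact K" "K \<noteq> {}" and f: "usc_on K f"
  shows "\<exists>x\<in>K. \<forall>y\<in>K. f y \<le> f x"
proof (rule ccontr)
  assume "\<not> ?thesis"
  then have "\<forall>x\<in>K. \<exists>y\<in>K. f x < f y" by (simp add: not_le)
  then obtain Y where Y: "\<And>x. x \<in> K \<Longrightarrow> Y x \<in> K" "\<And>x. x \<in> K \<Longrightarrow> f x < f (Y x)" by metis
  have "\<exists>d>0. \<forall>y\<in>K. dist y x < d \<longrightarrow> f y < f (Y x)" if "x \<in> K" for x
    using usc_onD[OF f that Y(2)[OF that]] by metis
  then obtain d where d: "\<And>x. x \<in> K \<Longrightarrow> d x > 0"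
    "\<And>x y. x \<in> K \<Longrightarrow> y \<in> K \<Longrightarrow> dist y x < d x \<Longrightarrow> f y < f (Y x)" by metis
  have "K \<subseteq> (\<Union>x\<in>K. ball x (d x))" using d(1) by force
  from compactE_image[OF K(1) _ this]
  obtain C where C: "C \<subseteq> K" "finite C" "K \<subseteq> (\<Union>x\<in>C. ball x (d x))" by (metis open_ball)
  have "C \<noteq> {}" using C(3) K(2) by blast
  then have "Max ((\<lambda>x. f (Y x)) ` C) \<in> (\<lambda>x. f (Y x)) ` C" using C(2) by (intro Max_in) auto
  then obtain x where x: "x \<in> C" "f (Y x) = Max ((\<lambda>x. f (Y x)) ` C)" by auto
  have "Y x \<in> K" using Y(1) x(1) C(1) by blast
  then obtain x' where x': "x' \<in> C" "dist (Y x) x' < d x'" using C(3) by (auto simp: dist_commute)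
  have "f (Y x) < f (Y x')" using d(2)[of x' "Y x"] x' C(1) \<open>Y x \<in> K\<close> by blast
  moreover have "f (Y x') \<le> f (Y x)" unfolding x(2) using C(2) x'(1) by (intro Max_ge) auto
  ultimately show False by simp
qed

section \<open>Sup-convolutions\<close>

definition is_supconv :: "real \<Rightarrow> 'a::real_normed_vector set \<Rightarrow> ('a \<Rightarrow> real) \<Rightarrow> ('a \<Rightarrow> real) \<Rightarrow> bool" where
  "is_supconv c K v f \<longleftrightarrow> (\<forall>x. (\<exists>y\<in>K. f x = v y - c * (norm (x - y))\<^sup>2) \<and>
     (\<forall>y\<in>K. v y - c * (norm (x - y))\<^sup>2 \<le> f x))"

text \<open>\<open>is_supconv\<close> is a relation, so that attainment of the maximum, on which the
  later arguments rest, comes with it. The variable x ranges over the whole space, the maximiser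
  over the compact K only.\<close>

lemma is_supconv_exists:
  fixes v :: "'a::real_normed_vector \<Rightarrow> real"
  assumes K: "compact K" "K \<noteq> {}" and v: "usc_on K v"
  obtains f where "is_supconv c K v f"
proof -
  have "\<exists>y\<in>K. \<forall>z\<in>K. v z - c * (norm (x - z))\<^sup>2 \<le> v y - c * (norm (x - y))\<^sup>2" for x
    by (intro usc_on_compact_attains_sup K usc_on_diff_continuous v continuous_intros)
  then obtain Y where Y: "\<And>x. Y x \<in> K" "\<And>x z. z \<in> K \<Longrightarrow> v z - c * (norm (x - z))\<^sup>2 \<le> v (Y x) - c * (norm (x - Y x))\<^sup>2"
    by metis
  then have "is_supconv c K v (\<lambda>x. v (Y x) - c * (norm (x - Y x))\<^sup>2)" unfolding is_supconv_def by blast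
  then show ?thesis by (rule that)
qed

text \<open>Freezing the maximiser that belongs to x gives a paraboloid below f that touches it at
  x; its slope there is 2 c (y - x).\<close>

lemma supconv_semiconvex:
  fixes v :: "'a::real_inner \<Rightarrow> real"
  assumes "is_supconv c K v f"
  shows "semiconvex c f"
  unfolding semiconvex_def
proof
  fix x
  obtain y where y: "y \<in> K" "f x = v y - c * (norm (x - y))\<^sup>2" using assms unfolding is_supconv_def by blast
  have "f x + ((2 * c) *\<^sub>R (y - x)) \<bullet> h - c * (norm h)\<^sup>2 \<le> f (x + h)" for h
  proof -
    have "v y - c * (norm (x + h - y))\<^sup>2 \<le> f (x + h)" using assms y(1) unfolding is_supconv_def by blast
    moreover have "(norm (x + h - y))\<^sup>2 = (norm (x - y))\<^sup>2 + 2 * ((x - y) \<bullet> h) + (norm h)\<^sup>2"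
      by (simp add: power2_norm_eq_inner inner_add_left inner_add_right inner_diff_left inner_diff_right inner_commute)
    then have "c * (norm (x + h - y))\<^sup>2 = c * (norm (x - y))\<^sup>2 - ((2 * c) *\<^sub>R (y - x)) \<bullet> h + c * (norm h)\<^sup>2"
      by (simp only: distrib_left) (simp add: inner_diff_left algebra_simps)
    ultimately show ?thesis using y(2) by linarith
  qed
  then show "\<exists>a. \<forall>h. f x + a \<bullet> h - c * (norm h)\<^sup>2 \<le> f (x + h)" by blast
qed

text \<open>The test function for \<open>f\<close> at \<open>x\<close>, translated by \<open>y - x\<close>, tests \<open>v\<close> at the maximiser \<open>y\<close>.\<close>

lemma supconv_visc_sub:
  fixes v :: "real^'n \<Rightarrow> real"
  assumes sup: "is_supconv c K v f" and \<Omega>: "open \<Omega>" "\<Omega> \<subseteq> K" and v: "visc_sub S \<Omega> v"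
  shows "visc_sub S {x. \<forall>y\<in>K. f x = v y - c * (norm (x - y))\<^sup>2 \<longrightarrow> y \<in> \<Omega>} f"
  unfolding visc_sub_def
proof (intro ballI allI impI)
  fix x p :: "real^'n" and A :: "real^'n^'n" and \<eta> :: real
  assume x: "x \<in> {x. \<forall>y\<in>K. f x = v y - c * (norm (x - y))\<^sup>2 \<longrightarrow> y \<in> \<Omega>}" and A: "A \<in> Sym" and \<eta>: "\<eta> > 0"
    and ev: "\<forall>\<^sub>F y in nhds x. f y \<le> f x + p \<bullet> (y - x) + (y - x) \<bullet> (A *v (y - x)) / 2"
  obtain y where y: "y \<in> K" "f x = v y - c * (norm (x - y))\<^sup>2" using sup unfolding is_supconv_def by blast
  then have y\<Omega>: "y \<in> \<Omega>" using x by blast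
  have "((\<lambda>z. x + (z - y)) \<longlongrightarrow> x + (y - y)) (nhds y)"
    by (intro tendsto_intros filterlim_ident)
  then have "filterlim (\<lambda>z. x + (z - y)) (nhds x) (nhds y)" by simp
  from eventually_compose_filterlim[OF ev this]
  have ev1: "\<forall>\<^sub>F z in nhds y. f (x + (z - y)) \<le> f x + p \<bullet> (z - y) + (z - y) \<bullet> (A *v (z - y)) / 2" by simp
  have ev2: "\<forall>\<^sub>F z in nhds y. z \<in> \<Omega>" by (rule eventually_nhds_in_open[OF \<Omega>(1) y\<Omega>])
  from ev1 ev2 have "\<forall>\<^sub>F z in nhds y. v z \<le> v y + p \<bullet> (z - y) + (z - y) \<bullet> (A *v (z - y)) / 2"
  proof eventually_elim
    case (elim z)
    have "z \<in> K" using elim(2) \<Omega>(2) by blast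
    then have "v z - c * (norm (x + (z - y) - z))\<^sup>2 \<le> f (x + (z - y))" using sup unfolding is_supconv_def by blast
    moreover have "x + (z - y) - z = x - y" by simp
    ultimately show ?case using elim(1) y(2) by simp
  qed
  from visc_subD[OF v y\<Omega> A this \<eta>] show "A + \<eta> *\<^sub>R mat 1 \<in> S" .
qed

text \<open>Points with a maximiser outside \<Omega> form a closed set: such maximisers stay in the
  compact K - \<Omega>, and by upper semicontinuity their limits are maximisers again. The blow-up
  needs an open domain for the viscosity inequalities.\<close>

lemma supconv_interior_open:
  fixes v :: "'a::euclidean_space \<Rightarrow> real"
  assumes K: "compact K" and \<Omega>: "open \<Omega>" and v: "usc_on K v" and sup: "is_supconv c K v f"
  shows "open {x. \<forall>y\<in>K. f x = v y - c * (norm (x - y))\<^sup>2 \<longrightarrow> y \<in> \<Omega>}"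
proof -
  let ?U = "{x. \<forall>y\<in>K. f x = v y - c * (norm (x - y))\<^sup>2 \<longrightarrow> y \<in> \<Omega>}"
  have cont: "continuous_on UNIV f" by (rule semiconvex_continuous[OF supconv_semiconvex[OF sup]])
  have "x \<in> - ?U" if X: "\<And>k. X k \<in> - ?U" "X \<longlonglongrightarrow> x" for X x
  proof -
    have "\<forall>k. \<exists>y. y \<in> K - \<Omega> \<and> f (X k) = v y - c * (norm (X k - y))\<^sup>2" using X(1) by blast
    then obtain y where y: "\<And>k. y k \<in> K - \<Omega>" "\<And>k. f (X k) = v (y k) - c * (norm (X k - y k))\<^sup>2" by metis
    have "compact (K - \<Omega>)" using K \<Omega> by (rule compact_diff)
    then obtain l r where l: "l \<in> K - \<Omega>" and r: "strict_mono (r :: nat \<Rightarrow> nat)" and yl: "(y \<circ> r) \<longlonglongrightarrow> l"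
      using y(1) unfolding compact_def by metis
    have yl: "(\<lambda>k. y (r k)) \<longlonglongrightarrow> l" using yl by (simp add: o_def)
    have Xr: "(\<lambda>k. X (r k)) \<longlonglongrightarrow> x" using LIMSEQ_subseq_LIMSEQ[OF X(2) r] by (simp add: o_def)
    have fX: "(\<lambda>k. f (X (r k))) \<longlonglongrightarrow> f x" using continuous_on_tendsto_compose[OF cont Xr] by simp
    have "f x \<le> v l - c * (norm (x - l))\<^sup>2"
    proof (rule field_le_epsilon)
      fix e :: real assume e: "e > 0"
      have "\<forall>\<^sub>F k in sequentially. v (y (r k)) < v l + e"
        using y(1) l e by (intro usc_on_seq[OF v _ _ yl]) auto
      then have "\<forall>\<^sub>F k in sequentially. f (X (r k)) \<le> v l + e - c * (norm (X (r k) - y (r k)))\<^sup>2"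
        by eventually_elim (simp add: y(2))
      moreover have "(\<lambda>k. v l + e - c * (norm (X (r k) - y (r k)))\<^sup>2) \<longlonglongrightarrow> v l + e - c * (norm (x - l))\<^sup>2"
        by (intro tendsto_intros Xr yl)
      ultimately have "f x \<le> v l + e - c * (norm (x - l))\<^sup>2"
        using tendsto_le[OF sequentially_bot _ fX] by blast
      then show "f x \<le> v l - c * (norm (x - l))\<^sup>2 + e" by simp
    qed
    moreover have "v l - c * (norm (x - l))\<^sup>2 \<le> f x" using sup l unfolding is_supconv_def by blast
    ultimately have "f x = v l - c * (norm (x - l))\<^sup>2" by simp
    then show ?thesis using l by blast
  qed
  then have "closed (- ?U)" unfolding closed_sequential_limits by blast
  then show ?thesis by (simp add: closed_open)
qed

text \<open>Pairs of points appear because the two sup-convolutions have different maximisers. If no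
  \<epsilon> worked, the offending pairs would accumulate at a single point of K - \<Omega>, against
  upper semicontinuity there.\<close>

lemma usc_pair_gap:
  fixes v w :: "'a::metric_space \<Rightarrow> real"
  assumes K: "compact K" and \<Omega>: "open \<Omega>" and v: "usc_on K v" and w: "usc_on K w"
    and lt: "\<And>y. y \<in> K - \<Omega> \<Longrightarrow> v y + w y < m"
  obtains \<epsilon> where "\<epsilon> > 0" "\<epsilon> \<le> 1"
    "\<And>y z. y \<in> K \<Longrightarrow> z \<in> K \<Longrightarrow> dist y z < \<epsilon>
        \<Longrightarrow> y \<notin> \<Omega> \<or> z \<notin> \<Omega> \<Longrightarrow> v y + w z < m - \<epsilon>"
proof (rule ccontr)
  assume "\<not> thesis"
  with that have *: "\<And>\<epsilon>. \<epsilon> > 0 \<Longrightarrow> \<epsilon> \<le> 1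
      \<Longrightarrow> \<exists>y z. y \<in> K \<and> z \<in> K \<and> dist y z < \<epsilon> \<and> (y \<notin> \<Omega> \<or> z \<notin> \<Omega>) \<and> m - \<epsilon> \<le> v y + w z"
    by (meson not_less)
  have "\<exists>y z. y \<in> K \<and> z \<in> K \<and> dist y z < 1 / real (Suc k) \<and> (y \<notin> \<Omega> \<or> z \<notin> \<Omega>)
      \<and> m - 1 / real (Suc k) \<le> v y + w z" for k
    by (rule *) auto
  then obtain y z where yz: "\<And>k. y k \<in> K" "\<And>k. z k \<in> K" "\<And>k. dist (y k) (z k) < 1 / real (Suc k)"
    "\<And>k. y k \<notin> \<Omega> \<or> z k \<notin> \<Omega>" "\<And>k. m - 1 / real (Suc k) \<le> v (y k) + w (z k)" by metis
  obtain l r where l: "l \<in> K" and r: "strict_mono (r :: nat \<Rightarrow> nat)" and "(y \<circ> r) \<longlonglongrightarrow> l"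
    using K yz(1) unfolding compact_def by metis
  then have yl: "(\<lambda>k. y (r k)) \<longlonglongrightarrow> l" by (simp add: o_def)
  have inv: "(\<lambda>k. 1 / real (Suc (r k))) \<longlonglongrightarrow> 0"
    using LIMSEQ_subseq_LIMSEQ[OF LIMSEQ_Suc[OF lim_1_over_n] r] by (simp add: o_def)
  have zl: "(\<lambda>k. z (r k)) \<longlonglongrightarrow> l"
  proof (rule metric_LIMSEQ_I)
    fix e :: real assume e: "e > 0"
    have "\<forall>\<^sub>F k in sequentially. dist (y (r k)) l < e / 2" using tendstoD[OF yl] e by (meson half_gt_zero)
    moreover have "\<forall>\<^sub>F k in sequentially. 1 / real (Suc (r k)) < e / 2" using order_tendstoD(2)[OF inv, of "e / 2"] e by simp
    ultimately have "\<forall>\<^sub>F k in sequentially. dist (z (r k)) l < e"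
    proof eventually_elim
      case (elim k)
      then show ?case using yz(3)[of "r k"] dist_triangle3[of "z (r k)" l "y (r k)"] by linarith
    qed
    then show "\<exists>no. \<forall>n\<ge>no. dist (z (r n)) l < e" by (simp add: eventually_sequentially)
  qed
  have "l \<notin> \<Omega>"
  proof
    assume "l \<in> \<Omega>"
    then have "\<forall>\<^sub>F k in sequentially. y (r k) \<in> \<Omega> \<and> z (r k) \<in> \<Omega>"
      using topological_tendstoD[OF yl \<Omega>] topological_tendstoD[OF zl \<Omega>] by (intro eventually_conj) auto
    then show False using yz(4) by (auto simp: eventually_sequentially)
  qed
  then have "v l + w l < m" using lt l by blast
  define \<delta> where "\<delta> = (m - (v l + w l)) / 3"
  have \<delta>: "\<delta> > 0" using \<open>v l + w l < m\<close> by (simp add: \<delta>_def)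
  have "\<forall>\<^sub>F k in sequentially. v (y (r k)) < v l + \<delta>" using \<delta> by (intro usc_on_seq[OF v l _ yl] yz) auto
  moreover have "\<forall>\<^sub>F k in sequentially. w (z (r k)) < w l + \<delta>" using \<delta> by (intro usc_on_seq[OF w l _ zl] yz) auto
  moreover have "\<forall>\<^sub>F k in sequentially. 1 / real (Suc (r k)) < \<delta>" by (rule order_tendstoD(2)[OF inv \<delta>])
  ultimately have "\<forall>\<^sub>F k in sequentially. False"
  proof eventually_elim
    case (elim k)
    then have "m < v l + w l + 3 * \<delta>" using yz(5)[of "r k"] by linarith
    moreover have "3 * \<delta> = m - (v l + w l)" by (simp add: \<delta>_def)
    ultimately show ?case by linarith
  qed
  then show False by simp
qed

text \<open>The constants are arranged so that, at a contact point, all maximisers of both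
  sup-convolutions lie in \<Omega>. The convolutions then inherit the inequalities of v and w near
  the contact set, where the blow-up takes place.\<close>

lemma visc_sum_max_principle:
  fixes v w :: "real^'n \<Rightarrow> real"
  assumes \<Omega>: "open \<Omega>" "bounded \<Omega>"
    and v: "usc_on (closure \<Omega>) v" "visc_sub S1 \<Omega> v" and w: "usc_on (closure \<Omega>) w" "visc_sub S2 \<Omega> w"
    and x0: "x0 \<in> \<Omega>" and lt: "\<And>y. y \<in> frontier \<Omega> \<Longrightarrow> v y + w y < v x0 + w x0"
  obtains A where "A \<in> Sym" "\<And>\<eta>. \<eta> > 0 \<Longrightarrow> A + \<eta> *\<^sub>R mat 1 \<in> S1" "\<And>\<eta>. \<eta> > 0
      \<Longrightarrow> - A + \<eta> *\<^sub>R mat 1 \<in> S2"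
proof -
  define K where "K = closure \<Omega>"
  define m where "m = v x0 + w x0"
  have K: "compact K" "\<Omega> \<subseteq> K" "K - \<Omega> = frontier \<Omega>" "K \<noteq> {}" and x0K: "x0 \<in> K"
    using \<Omega> x0 closure_subset[of \<Omega>] by (auto simp: K_def compact_closure frontier_def interior_open)
  note vK = v(1)[folded K_def] and wK = w(1)[folded K_def]
  obtain \<epsilon> where \<epsilon>: "\<epsilon> > 0" "\<epsilon> \<le> 1" and gap:
    "\<And>y z. y \<in> K \<Longrightarrow> z \<in> K \<Longrightarrow> dist y z < \<epsilon>
        \<Longrightarrow> y \<notin> \<Omega> \<or> z \<notin> \<Omega> \<Longrightarrow> v y + w z < m - \<epsilon>"
    using usc_pair_gap[OF K(1) \<Omega>(1) vK wK, of m] lt unfolding K(3) m_def by metis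
  obtain V where V: "\<And>y. y \<in> K \<Longrightarrow> v y \<le> V" using usc_on_compact_attains_sup[OF K(1,4) vK] by metis
  obtain W where W: "\<And>y. y \<in> K \<Longrightarrow> w y \<le> W" using usc_on_compact_attains_sup[OF K(1,4) wK] by metis
  obtain R where R: "\<And>y. y \<in> K \<Longrightarrow> norm y \<le> R" using compact_imp_bounded[OF K(1)] unfolding bounded_iff by blast
  have R0: "R \<ge> 0" using R[OF x0K] norm_ge_zero order_trans by blast
  \<comment> \<open>A tilt of slope \<tau> costs at most \<epsilon> over a distance of 2 R +
    1.\<close>
  define \<tau> where "\<tau> = \<epsilon> / (2 * R + 1)"
  have \<tau>: "\<tau> > 0" "\<tau> \<le> 1" using \<epsilon> R0 by (auto simp: \<tau>_def divide_le_eq)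
  define D where "D = V + W - m + 2 * R + 1"
  have "m \<le> V + W" unfolding m_def using V[OF x0K] W[OF x0K] by linarith
  then have D: "D \<ge> 1" using R0 by (simp add: D_def)
  \<comment> \<open>The bound (c - 1) (t^2 + s^2) \<le> D obtained below then keeps the
    displacements t and s of the maximisers under \<epsilon> / 2. One unit of c is reserved for
    absorbing the term t^2 that comes from the tilt.\<close>
  define c where "c = 1 + 4 * (D + 1) / \<epsilon>\<^sup>2"
  have c: "c \<ge> 1" using D \<epsilon> by (simp add: c_def)
  obtain f where f: "is_supconv c K v f" using is_supconv_exists[OF K(1,4) vK] .
  obtain g where g: "is_supconv c K w g" using is_supconv_exists[OF K(1,4) wK] .
  have scf: "semiconvex c f" and scg: "semiconvex c g" using supconv_semiconvex f g by blast+
  define Uv where "Uv = {x. \<forall>y\<in>K. f x = v y - c * (norm (x - y))\<^sup>2 \<longrightarrow> y \<in> \<Omega>}"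
  define Uw where "Uw = {x. \<forall>y\<in>K. g x = w y - c * (norm (x - y))\<^sup>2 \<longrightarrow> y \<in> \<Omega>}"
  have oU: "open (Uv \<inter> Uw)"
    unfolding Uv_def Uw_def by (intro open_Int supconv_interior_open K(1) \<Omega>(1) vK wK f g)
  have inside: "y \<in> \<Omega> \<and> z \<in> \<Omega>"
    if x: "x \<in> contact_set \<tau> f g" and y: "y \<in> K" "f x = v y - c * (norm (x - y))\<^sup>2"
      and z: "z \<in> K" "g x = w z - c * (norm (x - z))\<^sup>2" for x y z
  proof -
    obtain p where p: "norm p \<le> \<tau>" "\<And>u. f u + g u - p \<bullet> u \<le> f x + g x - p \<bullet> x"
      using x unfolding contact_set_def by blast
    define t s where "t = norm (x - y)" and "s = norm (x - z)"
    have "v x0 - c * (norm (x0 - x0))\<^sup>2 \<le> f x0" "w x0 - c * (norm (x0 - x0))\<^sup>2 \<le> g x0"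
      using f g x0K unfolding is_supconv_def by blast+
    then have "m \<le> f x0 + g x0" by (simp add: m_def)
    then have "m \<le> f x + g x + p \<bullet> (x0 - x)" using p(2)[of x0] by (simp add: inner_diff_right)
    \<comment> \<open>The contact point x may lie outside K, so its distance from x0 is measured
      through the maximiser y in K.\<close>
    moreover have "p \<bullet> (x0 - x) \<le> \<tau> * (2 * R + t)"
    proof -
      have "norm (x0 - x) \<le> norm x0 + norm y + t"
        using norm_triangle_ineq4[of "x0 - y" "x - y"] norm_triangle_ineq4[of x0 y] by (simp add: t_def)
      also have "\<dots> \<le> 2 * R + t" using R[OF x0K] R[OF y(1)] by simp
      finally have "norm p * norm (x0 - x) \<le> \<tau> * (2 * R + t)" using p(1) \<tau>(1) by (intro mult_mono) auto
      then show ?thesis using norm_cauchy_schwarz[of p "x0 - x"] by linarith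
    qed
    ultimately have key: "m + c * (t\<^sup>2 + s\<^sup>2) \<le> v y + w z + \<tau> * (2 * R + t)"
      using y(2) z(2) by (simp add: t_def s_def algebra_simps)
    have "\<tau> * (2 * R + t) \<le> 1 * (2 * R + t)" using \<tau> R0 by (intro mult_right_mono) (auto simp: t_def)
    moreover have "t \<le> 1 + t\<^sup>2"
    proof -
      have "2 * t \<le> 1 + t\<^sup>2" using zero_le_power2[of "t - 1"] by (simp add: power2_eq_square algebra_simps)
      then show ?thesis using zero_le_power2[of t] by linarith
    qed
    ultimately have "c * (t\<^sup>2 + s\<^sup>2) \<le> D + t\<^sup>2" using key V[OF y(1)] W[OF z(1)] by (simp add: D_def)
    then have "(c - 1) * (t\<^sup>2 + s\<^sup>2) \<le> D" using diff_mono[of _ "D + t\<^sup>2" "t\<^sup>2" "t\<^sup>2 + s\<^sup>2"]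
      by (simp add: left_diff_distrib)
    then have "4 * (D + 1) * (t\<^sup>2 + s\<^sup>2) \<le> D * \<epsilon>\<^sup>2" using \<epsilon> by (simp add: c_def divide_le_eq)
    also have "\<dots> < (D + 1) * \<epsilon>\<^sup>2" using \<epsilon> by simp
    finally have "(D + 1) * (4 * (t\<^sup>2 + s\<^sup>2)) < (D + 1) * \<epsilon>\<^sup>2" by (simp only: mult_ac)
    moreover have "D + 1 > 0" using D by simp
    ultimately have ts: "4 * (t\<^sup>2 + s\<^sup>2) < \<epsilon>\<^sup>2" by (simp only: mult_less_cancel_left_pos)
    have "(2 * t)\<^sup>2 = 4 * t\<^sup>2" "(2 * s)\<^sup>2 = 4 * s\<^sup>2" by (simp_all add: power_mult_distrib)
    then have "(2 * t)\<^sup>2 < \<epsilon>\<^sup>2 \<and> (2 * s)\<^sup>2 < \<epsilon>\<^sup>2"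
      using ts zero_le_power2[of t] zero_le_power2[of s] unfolding distrib_left by linarith
    then have "2 * t < \<epsilon>" "2 * s < \<epsilon>" using \<epsilon>(1) power2_less_imp_less[of _ \<epsilon>] by simp_all
    then have ts': "t + s < \<epsilon>" "t \<le> 1" using \<epsilon>(2) by auto
    have yz: "dist y z < \<epsilon>"
      using norm_triangle_ineq4[of "x - z" "x - y"] ts'(1) by (simp add: t_def s_def dist_norm)
    have "\<tau> * (2 * R + t) \<le> \<tau> * (2 * R + 1)" using ts'(2) \<tau>(1) by (intro mult_left_mono) auto
    also have "\<dots> = \<epsilon>" using R0 by (simp add: \<tau>_def)
    finally have \<tau>\<epsilon>: "\<tau> * (2 * R + t) \<le> \<epsilon>" .
    have "m \<le> m + c * (t\<^sup>2 + s\<^sup>2)" using c by simp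
    also note key
    also have "v y + w z + \<tau> * (2 * R + t) \<le> v y + w z + \<epsilon>" using \<tau>\<epsilon> by simp
    finally have "m - \<epsilon> \<le> v y + w z" by simp
    then show ?thesis using gap[OF y(1) z(1) yz] by linarith
  qed
  have sub: "contact_set \<tau> f g \<subseteq> Uv \<inter> Uw"
  proof
    fix x assume x: "x \<in> contact_set \<tau> f g"
    obtain y z where "y \<in> K" "f x = v y - c * (norm (x - y))\<^sup>2" "z \<in> K" "g x = w z - c * (norm (x - z))\<^sup>2"
      using f g unfolding is_supconv_def by metis
    then show "x \<in> Uv \<inter> Uw" using inside[OF x] unfolding Uv_def Uw_def by blast
  qed
  have max: "\<exists>x. \<forall>z. f z + g z - p \<bullet> z \<le> f x + g x - p \<bullet> x" if p: "norm p \<le> \<tau>" for p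
  proof -
    \<comment> \<open>At excess u = |z| - R \<ge> 1 the penalty gives f z \<le> V - u^2 and g z
      \<le> W - u^2, while the tilt contributes at most u + R. Beyond R' the sum does not exceed the
      value at 0, so a maximum over the ball is global.\<close>
    define R' where "R' = R + max 1 (V + W + R - (f 0 + g 0))"
    have "continuous_on (cball 0 R') (\<lambda>x. f x + g x - p \<bullet> x)"
      using semiconvex_continuous[OF scf] semiconvex_continuous[OF scg]
      by (intro continuous_intros) (auto intro: continuous_on_subset)
    moreover have z0: "0 \<in> cball (0::real^'n) R'" using R0 by (simp add: R'_def)
    ultimately obtain x where x: "\<And>z. z \<in> cball 0 R' \<Longrightarrow> f z + g z - p \<bullet> z \<le> f x + g x - p \<bullet> x"
      using continuous_attains_sup[OF compact_cball, of 0 R' "\<lambda>x. f x + g x - p \<bullet> x"] by blast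
    have "f z + g z - p \<bullet> z \<le> f x + g x - p \<bullet> x" for z
    proof (cases "z \<in> cball 0 R'")
      case False
      define u where "u = norm z - R"
      have u: "u \<ge> 1" "u \<ge> V + W + R - (f 0 + g 0)" using False by (auto simp: R'_def u_def)
      have le: "b y - c * (norm (z - y))\<^sup>2 \<le> B - u\<^sup>2" if "y \<in> K" "b y \<le> B" for b :: "real^'n \<Rightarrow> real" and y B
      proof -
        have "u \<le> norm (z - y)" using norm_triangle_ineq2[of z y] R[OF that(1)] by (simp add: u_def)
        then have "u\<^sup>2 \<le> (norm (z - y))\<^sup>2" using u(1) by (intro power_mono) auto
        also have "\<dots> \<le> c * (norm (z - y))\<^sup>2" using c by (simp add: mult_le_cancel_right1)
        finally show ?thesis using that(2) by linarith
      qed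
      have "f z \<le> V - u\<^sup>2" using f le[of _ v V] V unfolding is_supconv_def by metis
      moreover have "g z \<le> W - u\<^sup>2" using g le[of _ w W] W unfolding is_supconv_def by metis
      moreover have "- (p \<bullet> z) \<le> u + R"
      proof -
        have "norm p * norm z \<le> 1 * norm z" using p \<tau>(2) by (intro mult_right_mono) auto
        then show ?thesis using Cauchy_Schwarz_ineq2[of p z] by (simp add: u_def)
      qed
      moreover have "u \<le> u\<^sup>2" using u(1) by (simp add: power2_eq_square)
      ultimately have "f z + g z - p \<bullet> z \<le> f 0 + g 0" using u(2) by linarith
      then show ?thesis using x[OF z0] by simp
    qed (use x in blast)
    then show ?thesis by blast
  qed
  have c0: "c \<ge> 0" using c by simp
  have "visc_sub S1 Uv f" "visc_sub S2 Uw g"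
    unfolding Uv_def Uw_def by (intro supconv_visc_sub f g \<Omega>(1) K(2) v(2) w(2))+
  then have "visc_sub S1 (Uv \<inter> Uw) f" "visc_sub S2 (Uv \<inter> Uw) g" unfolding visc_sub_def by blast+
  from contact_blowup[OF scf scg c0 contact_set_not_negligible[OF scf scg c0 \<tau>(1) max] oU sub this]
  obtain f0 where f0: "pinched c f0" "visc_sub S1 UNIV f0" "visc_sub S2 UNIV (\<lambda>x. - f0 x)" .
  from visc_sub_both_sides[OF c0 f0] show ?thesis using that by blast
qed

section \<open>Hessians of test functions\<close>

lemma has_real_derivative_along_line:
  fixes f :: "'a::real_normed_vector \<Rightarrow> real"
  assumes "f differentiable (at (z + s *\<^sub>R e))"
  shows "((\<lambda>s. f (z + s *\<^sub>R e)) has_real_derivative frechet_derivative f (at (z + s *\<^sub>R e)) e) (at s)"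
proof -
  let ?D = "frechet_derivative f (at (z + s *\<^sub>R e))"
  have D: "(f has_derivative ?D) (at (z + s *\<^sub>R e))" using assms frechet_derivative_works by blast
  have "((\<lambda>s. z + s *\<^sub>R e) has_derivative (\<lambda>t. t *\<^sub>R e)) (at s)"
    by (auto intro!: derivative_eq_intros)
  from has_derivative_compose[OF this D]
  have "((\<lambda>s. f (z + s *\<^sub>R e)) has_derivative (\<lambda>t. ?D (t *\<^sub>R e))) (at s)" .
  moreover have "?D (t *\<^sub>R e) = ?D e * t" for t
    using linear_scale[OF has_derivative_linear[OF D], of t e] by simp
  ultimately show ?thesis unfolding has_field_derivative_def by simp
qed

lemma frechet_derivative_pderiv:
  fixes f :: "real^'n \<Rightarrow> real"
  assumes "f differentiable (at y)"
  shows "frechet_derivative f (at y) e = (\<Sum>j\<in>UNIV. e $ j * pderiv_at j f y)"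
proof -
  have lin: "linear (frechet_derivative f (at y))" using assms linear_frechet_derivative by blast
  have "e = (\<Sum>j\<in>UNIV. e $ j *\<^sub>R axis j 1)"
    using basis_expansion[of e] by (simp add: scalar_mult_eq_scaleR)
  then have "frechet_derivative f (at y) e = frechet_derivative f (at y) (\<Sum>j\<in>UNIV. e $ j *\<^sub>R axis j 1)" by simp
  also have "\<dots> = (\<Sum>j\<in>UNIV. e $ j * pderiv_at j f y)"
    unfolding pderiv_at_def by (simp add: linear_sum[OF lin] linear_scale[OF lin])
  finally show ?thesis .
qed

lemma C2_nearE:
  fixes f :: "real^'n \<Rightarrow> real"
  assumes "C2_near f x0"
  obtains r where "r > 0" "\<And>y. y \<in> ball x0 r \<Longrightarrow> f differentiable (at y)"
    "\<And>j y. y \<in> ball x0 r \<Longrightarrow> pderiv_at j f differentiable (at y)"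
    "\<And>i j. isCont (pderiv_at i (pderiv_at j f)) x0"
proof -
  obtain U where U: "open U" "x0 \<in> U" "f differentiable_on U" "\<And>j. pderiv_at j f differentiable_on U"
    "\<And>i j. continuous_on U (pderiv_at i (pderiv_at j f))" using assms unfolding C2_near_def by blast
  obtain r where r: "r > 0" "ball x0 r \<subseteq> U" using U(1,2) openE by blast
  have "g differentiable (at y)" if "g differentiable_on U" "y \<in> ball x0 r" for g :: "real^'n \<Rightarrow> real" and y
    using that r(2) U(1) unfolding differentiable_on_def by (metis at_within_open subsetD)
  moreover have "isCont (pderiv_at i (pderiv_at j f)) x0" for i j
    using U(1,2,5) continuous_on_eq_continuous_at by blast
  ultimately show ?thesis using that r(1) U(3,4) by metis
qed

lemma pderiv_line:
  fixes f :: "real^'n \<Rightarrow> real"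
  assumes "f differentiable (at (z + s *\<^sub>R axis i 1))"
  shows "((\<lambda>s. f (z + s *\<^sub>R axis i 1)) has_real_derivative pderiv_at i f (z + s *\<^sub>R axis i 1)) (at s)"
  using has_real_derivative_along_line[OF assms] unfolding pderiv_at_def .

text \<open>The mean value theorem is applied to an increment of f in direction i and then to one of
  \<open>pderiv_at i f\<close> in direction j. The double difference is symmetric in i and j, while
  the derivative on the right has a fixed order.\<close>

lemma double_difference_mvt:
  fixes f :: "real^'n \<Rightarrow> real"
  assumes h: "h > 0" "2 * h < r"
    and f: "\<And>y. y \<in> ball x r \<Longrightarrow> f differentiable (at y)"
    and pf: "\<And>y. y \<in> ball x r \<Longrightarrow> pderiv_at i f differentiable (at y)"
  obtains y where "dist y x \<le> 2 * h"
    "f (x + h *\<^sub>R axis i 1 + h *\<^sub>R axis j 1) - f (x + h *\<^sub>R axis i 1) - f (x + h *\<^sub>R axis j 1) + f x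
       = h * h * pderiv_at j (pderiv_at i f) y"
proof -
  let ?i = "axis i 1 :: real^'n" and ?j = "axis j 1 :: real^'n"
  have near: "dist (x + s *\<^sub>R ?i + t *\<^sub>R ?j) x \<le> 2 * h" if "0 \<le> s" "s \<le> h" "0 \<le> t" "t \<le> h" for s t
  proof -
    have "dist (x + s *\<^sub>R ?i + t *\<^sub>R ?j) x = norm (s *\<^sub>R ?i + t *\<^sub>R ?j)" by (simp add: dist_norm)
    also have "\<dots> \<le> norm (s *\<^sub>R ?i) + norm (t *\<^sub>R ?j)" by (rule norm_triangle_ineq)
    also have "\<dots> \<le> 2 * h" using that by (simp add: norm_axis_1)
    finally show ?thesis .
  qed
  have inball: "x + s *\<^sub>R ?i + t *\<^sub>R ?j \<in> ball x r" if "0 \<le> s" "s \<le> h" "0 \<le> t" "t \<le> h" for s t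
    using near[OF that] h by (simp add: dist_commute)
  define g where "g s = f (x + h *\<^sub>R ?j + s *\<^sub>R ?i) - f (x + s *\<^sub>R ?i)" for s
  have "\<exists>z. 0 < z \<and> z < h \<and> g h - g 0 = (h - 0) * (pderiv_at i f (x + h *\<^sub>R ?j + z *\<^sub>R ?i) - pderiv_at i f (x + z *\<^sub>R ?i))"
  proof (rule MVT2[OF h(1)])
    fix s assume s: "0 \<le> s" "s \<le> h"
    have "x + h *\<^sub>R ?j + s *\<^sub>R ?i \<in> ball x r" using inball[OF s, of h] h(1) by (simp add: add_ac)
    moreover have "x + s *\<^sub>R ?i \<in> ball x r" using inball[OF s, of 0] h(1) by simp
    ultimately show "DERIV g s :> pderiv_at i f (x + h *\<^sub>R ?j + s *\<^sub>R ?i) - pderiv_at i f (x + s *\<^sub>R ?i)"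
      unfolding g_def by (intro DERIV_diff pderiv_line f)
  qed
  then obtain z where z: "0 < z" "z < h" "g h - g 0 = h * (pderiv_at i f (x + h *\<^sub>R ?j + z *\<^sub>R ?i) - pderiv_at i f (x + z *\<^sub>R ?i))"
    by auto
  have "\<exists>u. 0 < u \<and> u < h \<and> pderiv_at i f (x + z *\<^sub>R ?i + h *\<^sub>R ?j) - pderiv_at i f (x + z *\<^sub>R ?i + 0 *\<^sub>R ?j)
     = (h - 0) * pderiv_at j (pderiv_at i f) (x + z *\<^sub>R ?i + u *\<^sub>R ?j)"
  proof (rule MVT2[OF h(1)])
    fix s assume s: "0 \<le> s" "s \<le> h"
    show "DERIV (\<lambda>s. pderiv_at i f (x + z *\<^sub>R ?i + s *\<^sub>R ?j)) s :> pderiv_at j (pderiv_at i f) (x + z *\<^sub>R ?i + s *\<^sub>R ?j)"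
      using z s by (intro pderiv_line pf inball) auto
  qed
  then obtain u where u: "0 < u" "u < h" "pderiv_at i f (x + z *\<^sub>R ?i + h *\<^sub>R ?j) - pderiv_at i f (x + z *\<^sub>R ?i)
     = h * pderiv_at j (pderiv_at i f) (x + z *\<^sub>R ?i + u *\<^sub>R ?j)" by auto
  show ?thesis
  proof (rule that)
    show "dist (x + z *\<^sub>R ?i + u *\<^sub>R ?j) x \<le> 2 * h" using near z u by simp
    have "f (x + h *\<^sub>R ?i + h *\<^sub>R ?j) - f (x + h *\<^sub>R ?i) - f (x + h *\<^sub>R ?j) + f x = g h - g 0"
      by (simp add: g_def add_ac)
    also have "\<dots> = h * h * pderiv_at j (pderiv_at i f) (x + z *\<^sub>R ?i + u *\<^sub>R ?j)"
      unfolding z(3) using u(3) by (simp add: add_ac)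
    finally show "f (x + h *\<^sub>R ?i + h *\<^sub>R ?j) - f (x + h *\<^sub>R ?i) - f (x + h *\<^sub>R ?j) + f x
       = h * h * pderiv_at j (pderiv_at i f) (x + z *\<^sub>R ?i + u *\<^sub>R ?j)" .
  qed
qed

text \<open>Ellipticity speaks only of \<open>Sym\<close>, so the symmetry of Hessians has to be
  derived. Since the double difference ignores the order of i and j, the two mixed derivatives take
  equal values at points arbitrarily close to x, and continuity at x finishes.\<close>

lemma hessian_Sym:
  fixes f :: "real^'n \<Rightarrow> real"
  assumes "C2_near f x"
  shows "hessian f x \<in> Sym"
proof -
  obtain r where r: "r > 0" and f: "\<And>y. y \<in> ball x r \<Longrightarrow> f differentiable (at y)"
    and pf: "\<And>j y. y \<in> ball x r \<Longrightarrow> pderiv_at j f differentiable (at y)"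
    and cont: "\<And>i j. isCont (pderiv_at i (pderiv_at j f)) x" using C2_nearE[OF assms] by blast
  have "pderiv_at j (pderiv_at i f) x = pderiv_at i (pderiv_at j f) x" for i j
  proof -
    define h where "h k = r / 3 * (1 / real (Suc k))" for k
    have h: "h k > 0" "2 * h k < r" for k
    proof -
      have "1 / real (Suc k) \<le> 1" by simp
      then have "r / 3 * (1 / real (Suc k)) \<le> r / 3 * 1" using r by (intro mult_left_mono) auto
      then show "h k > 0" "2 * h k < r" using r by (simp_all add: h_def)
    qed
    have "\<exists>y z. dist y x \<le> 2 * h k \<and> dist z x \<le> 2 * h k \<and> pderiv_at j (pderiv_at i f) y = pderiv_at i (pderiv_at j f) z" for k
    proof -
      let ?i = "h k *\<^sub>R axis i 1 :: real^'n" and ?j = "h k *\<^sub>R axis j 1 :: real^'n"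
      obtain y where y: "dist y x \<le> 2 * h k" "f (x + ?i + ?j) - f (x + ?i) - f (x + ?j) + f x = h k * h k * pderiv_at j (pderiv_at i f) y"
        by (rule double_difference_mvt[OF h f pf])
      obtain z where z: "dist z x \<le> 2 * h k" "f (x + ?j + ?i) - f (x + ?j) - f (x + ?i) + f x = h k * h k * pderiv_at i (pderiv_at j f) z"
        by (rule double_difference_mvt[OF h f pf])
      have "f (x + ?i + ?j) - f (x + ?i) - f (x + ?j) + f x = f (x + ?j + ?i) - f (x + ?j) - f (x + ?i) + f x"
        by (simp add: add_ac)
      then show ?thesis using y z h(1)[of k] by (intro exI[of _ y] exI[of _ z]) auto
    qed
    then obtain y z where yz: "\<And>k. dist (y k) x \<le> 2 * h k" "\<And>k. dist (z k) x \<le> 2 * h k"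
      "\<And>k. pderiv_at j (pderiv_at i f) (y k) = pderiv_at i (pderiv_at j f) (z k)" by metis
    have "(\<lambda>k. 2 * (r / 3 * (1 / real (Suc k)))) \<longlonglongrightarrow> 2 * (r / 3 * 0)"
      by (intro tendsto_intros LIMSEQ_Suc[OF lim_1_over_n])
    then have h0: "(\<lambda>k. 2 * h k) \<longlonglongrightarrow> 0" by (simp add: h_def)
    have lim: "u \<longlonglongrightarrow> x" if "\<And>k. dist (u k) x \<le> 2 * h k" for u
      by (rule metric_tendsto_imp_tendsto[OF h0]) (use that h(1) in \<open>auto simp: less_imp_le\<close>)
    have "(\<lambda>k. pderiv_at j (pderiv_at i f) (y k)) \<longlonglongrightarrow> pderiv_at j (pderiv_at i f) x"
      by (rule isCont_tendsto_compose[OF cont lim[OF yz(1)]])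
    moreover have "(\<lambda>k. pderiv_at j (pderiv_at i f) (y k)) \<longlonglongrightarrow> pderiv_at i (pderiv_at j f) x"
      unfolding yz(3) by (rule isCont_tendsto_compose[OF cont lim[OF yz(2)]])
    ultimately show ?thesis by (rule LIMSEQ_unique)
  qed
  then show ?thesis by (simp add: Sym_def transpose_def hessian_def vec_eq_iff)
qed

text \<open>If D < 0, then \<open>m1\<close> is negative just to the right of its zero at 0, and m
  drops below m 0 by the mean value theorem.\<close>

lemma second_derivative_nonneg_at_min:
  fixes m :: "real \<Rightarrow> real"
  assumes r: "r > 0" and m: "\<And>t. \<bar>t\<bar> < r \<Longrightarrow> (m has_real_derivative m1 t) (at t)"
    and m1: "(m1 has_real_derivative D) (at 0)" and min: "\<And>t. \<bar>t\<bar> < r \<Longrightarrow> m 0 \<le> m t"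
  shows "D \<ge> 0"
proof (rule ccontr)
  assume "\<not> D \<ge> 0"
  then obtain d where d: "d > 0" "\<And>h. 0 < h \<Longrightarrow> h < d \<Longrightarrow> m1 (0 + h) < m1 0"
    using DERIV_neg_dec_right[OF m1] by (metis not_le)
  have m10: "m1 0 = 0" by (rule DERIV_local_min[OF m r]) (use min r in auto)
  define h where "h = min d r / 2"
  have h: "h > 0" "h < d" "h < r" using d(1) r by (auto simp: h_def)
  have "\<exists>z. 0 < z \<and> z < h \<and> m h - m 0 = (h - 0) * m1 z"
    by (rule MVT2[OF h(1)]) (use h m in auto)
  then obtain z where z: "0 < z" "z < h" "m h - m 0 = h * m1 z" by auto
  have "m1 z < 0" using d(2)[of z] z h m10 by simp
  then have "m h < m 0" using z(3) h(1) mult_pos_neg[of h "m1 z"] by simp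
  then show False using min[of h] h by simp
qed

section \<open>Derivatives of quadratic polynomials and contact with them\<close>

lemma quad_has_derivative:
  assumes A: "A \<in> Sym"
  shows "(quad c p A x has_derivative (\<lambda>h. (p + A *v (y - x)) \<bullet> h)) (at y)"
proof -
  have lin: "((\<lambda>y. A *v (y - x)) has_derivative (\<lambda>h. A *v h)) (at y)"
  proof -
    have "((*v) A has_derivative (*v) A) (at (y - x))"
      by (rule bounded_linear_imp_has_derivative[OF matrix_vector_mul_bounded_linear])
    moreover have "((\<lambda>y. y - x) has_derivative (\<lambda>h. h)) (at y)" by (auto intro!: derivative_eq_intros)
    ultimately show ?thesis using has_derivative_compose by blast
  qed
  have "((\<lambda>y. c + p \<bullet> (y - x) + (y - x) \<bullet> (A *v (y - x)) / 2) has_derivative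
    (\<lambda>h. p \<bullet> h + ((y - x) \<bullet> (A *v h) + h \<bullet> (A *v (y - x))) / 2)) (at y)"
    by (auto intro!: derivative_eq_intros lin)
  moreover have "p \<bullet> h + ((y - x) \<bullet> (A *v h) + h \<bullet> (A *v (y - x))) / 2 = (p + A *v (y - x)) \<bullet> h" for h
    using Sym_inner[OF A, of "y - x" h] by (simp add: inner_add_left inner_add_right inner_commute)
  ultimately show ?thesis unfolding quad_def[abs_def] by simp
qed

lemma pderiv_quad:
  assumes A: "A \<in> Sym"
  shows "pderiv_at j (quad c p A x) = (\<lambda>y. p $ j + (A *v (y - x)) $ j)"
proof
  fix y
  have "frechet_derivative (quad c p A x) (at y) = (\<lambda>h. (p + A *v (y - x)) \<bullet> h)"
    using frechet_derivative_at[OF quad_has_derivative[OF A]] by metis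
  then show "pderiv_at j (quad c p A x) y = p $ j + (A *v (y - x)) $ j"
    by (simp add: pderiv_at_def inner_axis)
qed

lemma affine_component_has_derivative:
  "((\<lambda>y. a + (A *v (y - x)) $ j) has_derivative (\<lambda>h. (A *v (h::real^'n)) $ j)) (at y)"
proof -
  have "bounded_linear (\<lambda>h. (A *v h) $ j)"
    using bounded_linear_compose[OF bounded_linear_vec_nth matrix_vector_mul_bounded_linear] .
  then have "((\<lambda>h. (A *v h) $ j) has_derivative (\<lambda>h. (A *v h) $ j)) (at (y - x))"
    by (rule bounded_linear_imp_has_derivative)
  moreover have "((\<lambda>y. y - x) has_derivative (\<lambda>h. h)) (at y)" by (auto intro!: derivative_eq_intros)
  ultimately have "((\<lambda>y. (A *v (y - x)) $ j) has_derivative (\<lambda>h. (A *v h) $ j)) (at y)"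
    using has_derivative_compose by blast
  then show ?thesis by (auto intro!: derivative_eq_intros)
qed

lemma pderiv2_quad:
  assumes A: "A \<in> Sym"
  shows "pderiv_at i (pderiv_at j (quad c p A x)) = (\<lambda>y. A $ j $ i)"
proof
  fix y
  have "frechet_derivative (\<lambda>y. p $ j + (A *v (y - x)) $ j) (at y) = (\<lambda>h. (A *v h) $ j)"
    using frechet_derivative_at[OF affine_component_has_derivative] by metis
  then show "pderiv_at i (pderiv_at j (quad c p A x)) y = A $ j $ i"
    unfolding pderiv_quad[OF A] by (simp add: pderiv_at_def matrix_vector_mult_basis column_def)
qed

lemma hessian_quad:
  assumes A: "A \<in> Sym"
  shows "hessian (quad c p A x) y = A"
  using A by (auto simp: hessian_def pderiv2_quad[OF A] vec_eq_iff Sym_def transpose_def)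

lemma C2_near_quad:
  assumes A: "A \<in> Sym"
  shows "C2_near (quad c p A x) y"
  unfolding C2_near_def
proof (intro exI[of _ UNIV] conjI allI)
  show "quad c p A x differentiable_on UNIV"
    using quad_has_derivative[OF A] unfolding differentiable_on_def differentiable_def by blast
  show "pderiv_at j (quad c p A x) differentiable_on UNIV" for j
    unfolding pderiv_quad[OF A] differentiable_on_def differentiable_def using affine_component_has_derivative by blast
qed (auto simp: pderiv2_quad[OF A])

lemma second_derivative_along_line:
  fixes f :: "real^'n \<Rightarrow> real"
  assumes "C2_near f x"
  obtains r m1 where "r > 0" "\<And>t. \<bar>t\<bar> < r \<Longrightarrow> ((\<lambda>t. f (x + t *\<^sub>R e)) has_real_derivative m1 t) (at t)"
    "(m1 has_real_derivative e \<bullet> (hessian f x *v e)) (at 0)"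
proof -
  obtain r0 where r0: "r0 > 0" and f: "\<And>y. y \<in> ball x r0 \<Longrightarrow> f differentiable (at y)"
    and pf: "\<And>j y. y \<in> ball x r0 \<Longrightarrow> pderiv_at j f differentiable (at y)"
    and "\<And>i j. isCont (pderiv_at i (pderiv_at j f)) x" by (rule C2_nearE[OF assms]) blast
  define r where "r = r0 / (norm e + 1)"
  define m1 where "m1 t = (\<Sum>j\<in>UNIV. e $ j * pderiv_at j f (x + t *\<^sub>R e))" for t
  have ne: "norm e + 1 > 0" by (simp add: add_nonneg_pos)
  have r: "r > 0" using r0 ne by (simp add: r_def)
  have inb: "x + t *\<^sub>R e \<in> ball x r0" if "\<bar>t\<bar> < r" for t
  proof -
    have "\<bar>t\<bar> * norm e \<le> \<bar>t\<bar> * (norm e + 1)" by (intro mult_left_mono) auto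
    also have "\<dots> < r0" using that ne by (simp add: r_def pos_less_divide_eq)
    finally show ?thesis by (simp add: dist_norm)
  qed
  have d1: "((\<lambda>t. f (x + t *\<^sub>R e)) has_real_derivative m1 t) (at t)" if "\<bar>t\<bar> < r" for t
    using has_real_derivative_along_line[OF f[OF inb[OF that]]]
    unfolding frechet_derivative_pderiv[OF f[OF inb[OF that]]] m1_def .
  have "(m1 has_real_derivative e \<bullet> (hessian f x *v e)) (at 0)"
  proof -
    have pfx: "pderiv_at j f differentiable (at (x + 0 *\<^sub>R e))" for j using pf[of x j] r0 by simp
    have "((\<lambda>t. e $ j * pderiv_at j f (x + t *\<^sub>R e)) has_real_derivative e $ j * (\<Sum>i\<in>UNIV. e $ i * pderiv_at i (pderiv_at j f) (x + 0 *\<^sub>R e))) (at 0)" for j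
      using has_real_derivative_along_line[OF pfx, of j] unfolding frechet_derivative_pderiv[OF pfx] by (intro DERIV_cmult)
    then have "(m1 has_real_derivative (\<Sum>j\<in>UNIV. e $ j * (\<Sum>i\<in>UNIV. e $ i * pderiv_at i (pderiv_at j f) (x + 0 *\<^sub>R e)))) (at 0)"
      unfolding m1_def[abs_def] by (intro DERIV_sum)
    moreover have "(\<Sum>j\<in>UNIV. e $ j * (\<Sum>i\<in>UNIV. e $ i * pderiv_at i (pderiv_at j f) (x + 0 *\<^sub>R e))) = e \<bullet> (hessian f x *v e)"
    proof -
      have "(\<Sum>j\<in>UNIV. e $ j * (\<Sum>i\<in>UNIV. e $ i * pderiv_at i (pderiv_at j f) (x + 0 *\<^sub>R e)))
        = (\<Sum>j\<in>UNIV. \<Sum>i\<in>UNIV. e $ i * (hessian f x $ i $ j * e $ j))"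
        by (simp add: sum_distrib_left hessian_def mult_ac)
      also have "\<dots> = (\<Sum>i\<in>UNIV. \<Sum>j\<in>UNIV. e $ i * (hessian f x $ i $ j * e $ j))" by (rule sum.swap)
      also have "\<dots> = e \<bullet> (hessian f x *v e)"
        by (simp add: inner_vec_def matrix_vector_mult_def sum_distrib_left)
      finally show ?thesis .
    qed
    ultimately show ?thesis by simp
  qed
  with r d1 show ?thesis by (rule that[of r m1])
qed

lemma quad_line: "quad c p A x (x + t *\<^sub>R e) = c + t * (p \<bullet> e) + t\<^sup>2 / 2 * (e \<bullet> (A *v e))"
  by (simp add: quad_def matrix_vector_mult_scaleR power2_eq_square)

text \<open>The sign \<sigma> treats a quadratic below f (\<sigma> = 1) and one above f (\<sigma> =
  -1) together: on each line through x, \<sigma> times the difference has a local minimum at the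
  contact point.\<close>

lemma hessian_touching_quad:
  fixes f :: "real^'n \<Rightarrow> real"
  assumes f: "C2_near f x" and A: "A \<in> Sym" and \<sigma>: "\<sigma> \<in> {-1, 1}"
    and touch: "\<forall>\<^sub>F y in nhds x. \<sigma> * quad (f x) p A x y \<le> \<sigma> * f y"
  shows "\<sigma> * (e \<bullet> (A *v e)) \<le> \<sigma> * (e \<bullet> (hessian f x *v e))"
proof -
  obtain r m1 where r: "r > 0" and m: "\<And>t. \<bar>t\<bar> < r \<Longrightarrow> ((\<lambda>t. f (x + t *\<^sub>R e)) has_real_derivative m1 t) (at t)"
    and m1: "(m1 has_real_derivative e \<bullet> (hessian f x *v e)) (at 0)"
    using second_derivative_along_line[OF f] by blast
  have "((\<lambda>t. x + t *\<^sub>R e) \<longlongrightarrow> x + 0 *\<^sub>R e) (nhds 0)" by (intro tendsto_intros filterlim_ident)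
  then have "filterlim (\<lambda>t. x + t *\<^sub>R e) (nhds x) (nhds 0)" by simp
  from eventually_compose_filterlim[OF touch this]
  obtain d where d: "d > 0" "\<And>t. \<bar>t\<bar> < d \<Longrightarrow> \<sigma> * quad (f x) p A x (x + t *\<^sub>R e) \<le> \<sigma> * f (x + t *\<^sub>R e)"
    unfolding eventually_nhds_metric by auto
  define M where "M t = \<sigma> * (f (x + t *\<^sub>R e) - (f x + t * (p \<bullet> e) + t\<^sup>2 / 2 * (e \<bullet> (A *v e))))" for t
  have "0 \<le> \<sigma> * (e \<bullet> (hessian f x *v e) - (e \<bullet> (A *v e)))"
  proof (rule second_derivative_nonneg_at_min[of "min r d" M "\<lambda>t. \<sigma> * (m1 t - (p \<bullet> e + t * (e \<bullet> (A *v e))))"])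
    show "min r d > 0" using r d by simp
    show "(M has_real_derivative \<sigma> * (m1 t - (p \<bullet> e + t * (e \<bullet> (A *v e))))) (at t)" if "\<bar>t\<bar> < min r d" for t
      unfolding M_def[abs_def] using that by (auto intro!: derivative_eq_intros m)
    show "((\<lambda>t. \<sigma> * (m1 t - (p \<bullet> e + t * (e \<bullet> (A *v e)))))
        has_real_derivative \<sigma> * (e \<bullet> (hessian f x *v e) - (e \<bullet> (A *v e)))) (at 0)"
      by (auto intro!: derivative_eq_intros m1)
    show "M 0 \<le> M t" if "\<bar>t\<bar> < min r d" for t
      using d(2)[of t] that unfolding quad_line by (simp add: M_def right_diff_distrib)
  qed
  then show ?thesis by (simp add: right_diff_distrib)
qed

section \<open>Ellipticity and the equivalences\<close>

lemma norm_matrix_vector_le: "norm (A *v x) \<le> norm A * norm (x::real^'n)" for A :: "real^'n^'m"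
proof -
  have "norm (A *v x) \<le> L2_set (\<lambda>i. norm (A $ i) * norm x) UNIV"
    unfolding norm_vec_def[of "A *v x"]
    by (rule L2_set_mono) (simp_all add: matrix_vector_mul_component Cauchy_Schwarz_ineq2)
  also have "\<dots> = norm A * norm x" unfolding norm_vec_def[of A] by (simp add: L2_set_left_distrib)
  finally show ?thesis .
qed

text \<open>The norm on matrices is the Frobenius norm, which dominates the operator norm, so |v
  \<bullet> ((Y - X) *v v)| \<le> t |v|^2. Balls of radius t thus lie in order intervals from Y - t
  I to Y + t I, which links topology with order.\<close>

lemma loewner_le_of_dist:
  assumes X: "X \<in> Sym" and Y: "Y \<in> Sym" and d: "dist X Y \<le> t"
  shows "loewner_le X (Y + t *\<^sub>R mat 1)"
  unfolding loewner_le_def psd_def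
proof (intro conjI allI)
  show "Y + t *\<^sub>R mat 1 - X \<in> Sym" by (intro Sym_diff Sym_add Sym_scaleR Sym_mat X Y)
  fix v
  have e: "Y + t *\<^sub>R mat 1 - X = (Y - X) + t *\<^sub>R mat 1" by simp
  have "\<bar>v \<bullet> ((Y - X) *v v)\<bar> \<le> norm v * norm ((Y - X) *v v)" by (rule Cauchy_Schwarz_ineq2)
  also have "\<dots> \<le> norm v * (t * norm v)"
    using norm_matrix_vector_le[of "Y - X" v] mult_right_mono[of "norm (Y - X)" t "norm v"] d
    by (intro mult_left_mono) (auto simp: dist_norm norm_minus_commute)
  finally show "0 \<le> v \<bullet> ((Y + t *\<^sub>R mat 1 - X) *v v)"
    unfolding e inner_add_mat by (simp add: power2_eq_square mult_ac)
qed

lemma elliptic_mono: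
  assumes F: "elliptic_at_0 F" and XY: "X \<in> Sym" "Y \<in> Sym" "loewner_le X Y"
  shows "0 \<le> F X \<Longrightarrow> 0 \<le> F Y" "0 < F X \<Longrightarrow> 0 < F Y" "F Y \<le> 0 \<Longrightarrow> F X \<le> 0" "F Y < 0 \<Longrightarrow> F X < 0"
proof -
  have *: "0 \<le> F X \<longrightarrow> 0 \<le> F Y" "0 < F X \<longrightarrow> 0 < F Y" using F XY unfolding elliptic_at_0_def by blast+
  then show "0 \<le> F X \<Longrightarrow> 0 \<le> F Y" "0 < F X \<Longrightarrow> 0 < F Y" by blast+
  show "F Y \<le> 0 \<Longrightarrow> F X \<le> 0" "F Y < 0 \<Longrightarrow> F X < 0" using * by (meson not_less)+
qed

definition shift :: "real^'n^'n \<Rightarrow> real \<Rightarrow> real^'n^'n" where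
  "shift X t = X + t *\<^sub>R mat 1"

lemma shift_Sym: "X \<in> Sym \<Longrightarrow> shift X t \<in> Sym"
  unfolding shift_def by (intro Sym_add Sym_scaleR Sym_mat)

lemma shift_shift [simp]: "shift (shift X s) t = shift X (s + t)"
  by (simp add: shift_def scaleR_add_left add.assoc)

lemma shift_0 [simp]: "shift X 0 = X"
  by (simp add: shift_def)

lemma dist_shift: "dist (shift X s) (shift X t) = \<bar>s - t\<bar> * norm (mat 1 :: real^'n^'n)" for X :: "real^'n^'n"
  by (simp add: shift_def dist_norm scaleR_diff_left[symmetric])

lemma loewner_le_shift: "X \<in> Sym \<Longrightarrow> s \<le> t \<Longrightarrow> loewner_le (shift X s) (shift X t)"
  using loewner_le_of_dist[of "shift X s" "shift X s" "t - s"] shift_Sym[of X s]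
  by (simp add: shift_def[symmetric])

lemma loewner_le_shift_of_dist:
  assumes "X \<in> Sym" "Y \<in> Sym" "dist X Y \<le> t"
  shows "loewner_le X (shift Y t)" "loewner_le (shift X (- t)) Y"
proof -
  show "loewner_le X (shift Y t)" using loewner_le_of_dist[OF assms] unfolding shift_def .
  have "Y - (X + - t *\<^sub>R mat 1) = Y + t *\<^sub>R mat 1 - X" by simp
  then show "loewner_le (shift X (- t)) Y"
    using loewner_le_of_dist[OF assms] unfolding shift_def loewner_le_def by metis
qed

lemma near_shift:
  fixes X :: "real^'n^'n"
  assumes e: "e > 0"
  obtains t where "t > 0" "dist (shift X t) X < e" "dist (shift X (- t)) X < e"
proof -
  define t where "t = e / (2 * (norm (mat 1 :: real^'n^'n) + 1))"
  have p: "norm (mat 1 :: real^'n^'n) + 1 > 0" by (simp add: add_nonneg_pos)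
  have t: "t > 0" using e p by (simp add: t_def)
  have "t * norm (mat 1 :: real^'n^'n) \<le> t * (norm (mat 1 :: real^'n^'n) + 1)" using t by (intro mult_left_mono) auto
  also have "\<dots> = e / 2" using p by (simp add: t_def field_simps)
  finally have "t * norm (mat 1 :: real^'n^'n) < e" using e by simp
  then show ?thesis using that t dist_shift[of X t 0] dist_shift[of X "- t" 0] by simp
qed

lemma in_uminus_image: "Y \<in> uminus ` C \<longleftrightarrow> - Y \<in> C" for Y :: "'a::group_add"
proof
  show "Y \<in> uminus ` C" if "- Y \<in> C" by (rule image_eqI[OF _ that]) simp
qed auto

text \<open>For \<open>F\<close> elliptic at 0, a violation makes \<open>F\<close> vanish on the
  whole order interval from X to X + t I. The condition serves as a hub: each of the six statements
  is compared with it separately.\<close>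

definition no_gap :: "(real^'n^'n \<Rightarrow> ereal) \<Rightarrow> bool" where
  "no_gap F \<longleftrightarrow> (\<forall>X\<in>Sym. \<forall>t>0. \<not> (0 \<le> F X \<and> F (shift X t) \<le> 0))"

context
  fixes F :: "real^'n^'n \<Rightarrow> ereal"
  assumes F: "elliptic_at_0 F"
begin

lemma shift_mono:
  assumes "X \<in> Sym" "s \<le> t"
  shows "0 \<le> F (shift X s) \<Longrightarrow> 0 \<le> F (shift X t)" "0 < F (shift X s) \<Longrightarrow> 0 < F (shift X t)"
    "F (shift X t) \<le> 0 \<Longrightarrow> F (shift X s) \<le> 0" "F (shift X t) < 0 \<Longrightarrow> F (shift X s) < 0"
  using elliptic_mono[OF F shift_Sym[OF assms(1)] shift_Sym[OF assms(1)] loewner_le_shift[OF assms]] by blast+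

lemma no_gap_iff_strict:
  "no_gap F \<longleftrightarrow> (\<forall>X0\<in>Gamma_0 F. \<forall>t>0. F (X0 - t *\<^sub>R mat 1) < 0 \<and> 0 < F (X0 + t *\<^sub>R mat 1))"
proof
  assume N: "no_gap F"
  show "\<forall>X0\<in>Gamma_0 F. \<forall>t>0. F (X0 - t *\<^sub>R mat 1) < 0 \<and> 0 < F (X0 + t *\<^sub>R mat 1)"
  proof (intro ballI allI impI)
    fix X0 and t :: real assume X0: "X0 \<in> Gamma_0 F" and t: "t > 0"
    then have S: "X0 \<in> Sym" "F X0 = 0" unfolding Gamma_0_def by auto
    have "\<not> F (shift X0 t) \<le> 0" using N S t unfolding no_gap_def by auto
    moreover have "\<not> 0 \<le> F (shift X0 (- t))"
    proof -
      have "\<not> (0 \<le> F (shift X0 (- t)) \<and> F (shift (shift X0 (- t)) t) \<le> 0)"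
        using N shift_Sym[OF S(1)] t unfolding no_gap_def by blast
      then show ?thesis using S(2) by simp
    qed
    ultimately show "F (X0 - t *\<^sub>R mat 1) < 0 \<and> 0 < F (X0 + t *\<^sub>R mat 1)" by (simp add: shift_def not_le)
  qed
next
  assume iv: "\<forall>X0\<in>Gamma_0 F. \<forall>t>0. F (X0 - t *\<^sub>R mat 1) < 0 \<and> 0 < F (X0 + t *\<^sub>R mat 1)"
  show "no_gap F"
    unfolding no_gap_def
  proof (intro ballI allI impI notI)
    fix X and t :: real assume X: "X \<in> Sym" and t: "t > 0" and g: "0 \<le> F X \<and> F (shift X t) \<le> 0"
    then have "F X \<le> 0" using shift_mono(3)[OF X, of 0 t] by simp
    then have "X \<in> Gamma_0 F" using g X by (simp add: Gamma_0_def)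
    then have "0 < F (shift X t)" using iv t unfolding shift_def by blast
    then show False using g by (simp add: not_less[symmetric])
  qed
qed

text \<open>A gap contains a ball, since all symmetric matrices within t / 2 of the midpoint lie
  between X and X + t I. Conversely a ball contains a short segment in direction I.\<close>

lemma no_gap_iff_no_ball:
  "no_gap F \<longleftrightarrow> \<not> (\<exists>X\<in>Sym. \<exists>r>0. ball X r \<inter> Sym \<subseteq> Gamma_0 F)"
proof
  assume N: "no_gap F"
  show "\<not> (\<exists>X\<in>Sym. \<exists>r>0. ball X r \<inter> Sym \<subseteq> Gamma_0 F)"
  proof
    assume "\<exists>X\<in>Sym. \<exists>r>0. ball X r \<inter> Sym \<subseteq> Gamma_0 F"
    then obtain X r where X: "X \<in> Sym" "r > 0" "ball X r \<inter> Sym \<subseteq> Gamma_0 F" by blast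
    obtain t where t: "t > 0" "dist (shift X t) X < r" using near_shift[OF X(2)] by metis
    have "X \<in> Gamma_0 F" "shift X t \<in> Gamma_0 F" using X t shift_Sym[OF X(1)] by (auto simp: dist_commute)
    moreover have "\<not> (0 \<le> F X \<and> F (shift X t) \<le> 0)" using N X(1) t(1) unfolding no_gap_def by blast
    ultimately show False by (simp add: Gamma_0_def)
  qed
next
  assume ii: "\<not> (\<exists>X\<in>Sym. \<exists>r>0. ball X r \<inter> Sym \<subseteq> Gamma_0 F)"
  show "no_gap F"
    unfolding no_gap_def
  proof (intro ballI allI impI notI)
    fix X and t :: real assume X: "X \<in> Sym" and t: "t > 0" and g: "0 \<le> F X \<and> F (shift X t) \<le> 0"
    define Z where "Z = shift X (t / 2)"
    have Z: "Z \<in> Sym" unfolding Z_def by (rule shift_Sym[OF X])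
    have "ball Z (t / 2) \<inter> Sym \<subseteq> Gamma_0 F"
    proof
      fix Y assume Y: "Y \<in> ball Z (t / 2) \<inter> Sym"
      then have YS: "Y \<in> Sym" and d: "dist Z Y \<le> t / 2" "dist Y Z \<le> t / 2" by (auto simp: dist_commute)
      have "loewner_le X Y" using loewner_le_shift_of_dist(2)[OF Z YS d(1)] by (simp add: Z_def)
      moreover have "loewner_le Y (shift X t)" using loewner_le_shift_of_dist(1)[OF YS Z d(2)] by (simp add: Z_def)
      ultimately have "0 \<le> F Y" "F Y \<le> 0"
        using elliptic_mono[OF F X YS] elliptic_mono[OF F YS shift_Sym[OF X]] g by blast+
      then show "Y \<in> Gamma_0 F" using YS by (simp add: Gamma_0_def)
    qed
    then show False using ii Z t by (meson half_gt_zero)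
  qed
qed

text \<open>On a line in direction I, sup \<le> inf says exactly that the line has no gap. The
  reverse inequality always holds because each real number belongs to one of the two sets; in this
  form empty sets and infinite values require no case distinction.\<close>

lemma no_gap_iff_sup_eq_inf:
  "no_gap F \<longleftrightarrow> (\<forall>X\<in>Sym. (SUP t\<in>{t. X + t *\<^sub>R mat 1 \<in> Theta_minus F}. ereal t)
            = (INF t\<in>{t. X + t *\<^sub>R mat 1 \<in> Theta_plus F}. ereal t))"
proof -
  have m: "X + t *\<^sub>R mat 1 \<in> Theta_minus F \<longleftrightarrow> F (shift X t) \<le> 0"
    and p: "X + t *\<^sub>R mat 1 \<in> Theta_plus F \<longleftrightarrow> 0 \<le> F (shift X t)" if "X \<in> Sym" for X :: "real^'n^'n" and t
    using shift_Sym[OF that] by (simp_all add: Theta_minus_def Theta_plus_def shift_def)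
  show ?thesis
  proof
    assume N: "no_gap F"
    show "\<forall>X\<in>Sym. (SUP t\<in>{t. X + t *\<^sub>R mat 1 \<in> Theta_minus F}. ereal t)
            = (INF t\<in>{t. X + t *\<^sub>R mat 1 \<in> Theta_plus F}. ereal t)"
    proof
      fix X :: "real^'n^'n" assume X: "X \<in> Sym"
      let ?L = "SUP t\<in>{t. F (shift X t) \<le> 0}. ereal t" and ?U = "INF t\<in>{t. 0 \<le> F (shift X t)}. ereal t"
      have "?L \<le> ?U"
      proof (intro SUP_least INF_greatest)
        fix t s assume ts: "t \<in> {t. F (shift X t) \<le> 0}" "s \<in> {t. 0 \<le> F (shift X t)}"
        have "\<not> s < t"
        proof
          assume "s < t"
          then have "\<not> (0 \<le> F (shift X s) \<and> F (shift (shift X s) (t - s)) \<le> 0)"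
            using N shift_Sym[OF X] unfolding no_gap_def by (meson diff_gt_0_iff_gt)
          then show False using ts by simp
        qed
        then show "ereal t \<le> ereal s" by simp
      qed
      moreover have "\<not> ?L < ?U"
      proof
        assume "?L < ?U"
        then obtain r where r: "?L < ereal r" "ereal r < ?U" using ereal_dense2 by blast
        have "F (shift X r) \<le> 0 \<or> 0 \<le> F (shift X r)" by (rule linear)
        then show False
        proof
          assume "F (shift X r) \<le> 0"
          then have "ereal r \<le> ?L" by (intro SUP_upper) simp
          then show False using r(1) by simp
        next
          assume "0 \<le> F (shift X r)"
          then have "?U \<le> ereal r" by (intro INF_lower) simp
          then show False using r(2) by simp
        qed
      qed
      ultimately have "?L = ?U" by simp
      then show "(SUP t\<in>{t. X + t *\<^sub>R mat 1 \<in> Theta_minus F}. ereal t)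
            = (INF t\<in>{t. X + t *\<^sub>R mat 1 \<in> Theta_plus F}. ereal t)" unfolding m[OF X] p[OF X] .
    qed
  next
    assume iii: "\<forall>X\<in>Sym. (SUP t\<in>{t. X + t *\<^sub>R mat 1 \<in> Theta_minus F}. ereal t)
            = (INF t\<in>{t. X + t *\<^sub>R mat 1 \<in> Theta_plus F}. ereal t)"
    show "no_gap F"
      unfolding no_gap_def
    proof (intro ballI allI impI notI)
      fix X and t :: real assume X: "X \<in> Sym" and t: "t > 0" and g: "0 \<le> F X \<and> F (shift X t) \<le> 0"
      have "(INF t\<in>{t. X + t *\<^sub>R mat 1 \<in> Theta_plus F}. ereal t) \<le> ereal 0"
        using g p[OF X, of 0] by (intro INF_lower) simp
      moreover have "ereal t \<le> (SUP t\<in>{t. X + t *\<^sub>R mat 1 \<in> Theta_minus F}. ereal t)"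
        using g m[OF X, of t] by (intro SUP_upper) simp
      ultimately have "ereal t \<le> ereal 0" unfolding bspec[OF iii X] by (rule order_trans[rotated])
      then show False using t by simp
    qed
  qed
qed

section \<open>Closures, interiors and frontiers described along lines in direction I\<close>

lemma in_closure_of_Sym:
  "X \<in> top_of_set Sym closure_of A \<longleftrightarrow> X \<in> Sym \<and> (\<forall>e>0. \<exists>Y\<in>A. Y \<in> Sym \<and> dist Y X < e)" for A :: "(real^'n^'n) set"
proof
  assume X: "X \<in> top_of_set Sym closure_of A"
  show "X \<in> Sym \<and> (\<forall>e>0. \<exists>Y\<in>A. Y \<in> Sym \<and> dist Y X < e)"
  proof (intro conjI allI impI)
    show XS: "X \<in> Sym" using X unfolding closure_of_def by simp
    fix e :: real assume e: "e > 0"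
    have "openin (top_of_set Sym) (Sym \<inter> ball X e)" by (simp add: openin_open_Int)
    moreover have "X \<in> Sym \<inter> ball X e" using XS e by simp
    ultimately obtain Y where "Y \<in> A" "Y \<in> Sym \<inter> ball X e" using X unfolding closure_of_def by blast
    then show "\<exists>Y\<in>A. Y \<in> Sym \<and> dist Y X < e" by (auto simp: dist_commute)
  qed
next
  assume X: "X \<in> Sym \<and> (\<forall>e>0. \<exists>Y\<in>A. Y \<in> Sym \<and> dist Y X < e)"
  have "\<exists>Y\<in>A. Y \<in> T" if T: "X \<in> T" "openin (top_of_set Sym) T" for T
  proof -
    obtain e where "e > 0" "\<And>Y. Y \<in> Sym \<Longrightarrow> dist Y X < e \<Longrightarrow> Y \<in> T"
      using T unfolding openin_euclidean_subtopology_iff by blast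
    then show ?thesis using X by blast
  qed
  then show "X \<in> top_of_set Sym closure_of A" using X unfolding closure_of_def by auto
qed

lemma in_interior_of_Sym:
  "X \<in> top_of_set Sym interior_of A \<longleftrightarrow> X \<in> Sym
      \<and> (\<exists>e>0. \<forall>Y\<in>Sym. dist Y X < e \<longrightarrow> Y \<in> A)" for A :: "(real^'n^'n) set"
proof
  assume "X \<in> top_of_set Sym interior_of A"
  then obtain T where T: "openin (top_of_set Sym) T" "X \<in> T" "T \<subseteq> A" unfolding interior_of_def by blast
  then show "X \<in> Sym \<and> (\<exists>e>0. \<forall>Y\<in>Sym. dist Y X < e \<longrightarrow> Y \<in> A)"
    unfolding openin_euclidean_subtopology_iff by blast
next
  assume X: "X \<in> Sym \<and> (\<exists>e>0. \<forall>Y\<in>Sym. dist Y X < e \<longrightarrow> Y \<in> A)"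
  then obtain e where e: "e > 0" "\<And>Y. Y \<in> Sym \<Longrightarrow> dist Y X < e \<Longrightarrow> Y \<in> A" by blast
  have "openin (top_of_set Sym) (Sym \<inter> ball X e)" by (simp add: openin_open_Int)
  moreover have "X \<in> Sym \<inter> ball X e" using X e(1) by simp
  moreover have "Sym \<inter> ball X e \<subseteq> A" using e(2) by (auto simp: dist_commute)
  ultimately show "X \<in> top_of_set Sym interior_of A" unfolding interior_of_def by blast
qed

text \<open>A member of the set within distance t of X lies below X + t I, and ellipticity carries
  its sign there; conversely the shifts of X approach X. The topology of the sign sets is thereby
  reduced to the real line, and the three descriptions that follow have the same pattern.\<close>

lemma closure_Theta_plus:
  "X \<in> top_of_set Sym closure_of Theta_plus F \<longleftrightarrow> X \<in> Sym \<and> (\<forall>t>0. 0 \<le> F (shift X t))"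
  unfolding in_closure_of_Sym
proof (rule conj_cong[OF refl], intro iffI allI impI)
  fix t :: real assume X: "X \<in> Sym" and h: "\<forall>e>0. \<exists>Y\<in>Theta_plus F. Y \<in> Sym \<and> dist Y X < e" and t: "t > 0"
  then obtain Y where Y: "Y \<in> Sym" "0 \<le> F Y" "dist Y X \<le> t" unfolding Theta_plus_def by (metis (mono_tags, lifting) less_imp_le mem_Collect_eq)
  show "0 \<le> F (shift X t)"
    using elliptic_mono(1)[OF F Y(1) shift_Sym[OF X] loewner_le_shift_of_dist(1)[OF Y(1) X Y(3)] Y(2)] .
next
  fix e :: real assume X: "X \<in> Sym" and h: "\<forall>t>0. 0 \<le> F (shift X t)" and e: "e > 0"
  obtain t where "t > 0" "dist (shift X t) X < e" using near_shift[OF e] by metis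
  then show "\<exists>Y\<in>Theta_plus F. Y \<in> Sym \<and> dist Y X < e"
    using h shift_Sym[OF X] by (intro bexI[of _ "shift X t"]) (auto simp: Theta_plus_def)
qed

lemma closure_Theta_minus:
  "X \<in> top_of_set Sym closure_of Theta_minus F \<longleftrightarrow> X \<in> Sym \<and> (\<forall>t>0. F (shift X (- t)) \<le> 0)"
  unfolding in_closure_of_Sym
proof (rule conj_cong[OF refl], intro iffI allI impI)
  fix t :: real assume X: "X \<in> Sym" and h: "\<forall>e>0. \<exists>Y\<in>Theta_minus F. Y \<in> Sym \<and> dist Y X < e" and t: "t > 0"
  then obtain Y where Y: "Y \<in> Sym" "F Y \<le> 0" "dist X Y \<le> t" unfolding Theta_minus_def by (metis (mono_tags, lifting) dist_commute less_imp_le mem_Collect_eq)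
  show "F (shift X (- t)) \<le> 0"
    using elliptic_mono(3)[OF F shift_Sym[OF X] Y(1) loewner_le_shift_of_dist(2)[OF X Y(1) Y(3)] Y(2)] .
next
  fix e :: real assume X: "X \<in> Sym" and h: "\<forall>t>0. F (shift X (- t)) \<le> 0" and e: "e > 0"
  obtain t where "t > 0" "dist (shift X (- t)) X < e" using near_shift[OF e] by metis
  then show "\<exists>Y\<in>Theta_minus F. Y \<in> Sym \<and> dist Y X < e"
    using h shift_Sym[OF X] by (intro bexI[of _ "shift X (- t)"]) (auto simp: Theta_minus_def)
qed

lemma interior_Theta_plus:
  "X \<in> top_of_set Sym interior_of Theta_plus F \<longleftrightarrow> X \<in> Sym \<and> (\<exists>t>0. 0 \<le> F (shift X (- t)))"
  unfolding in_interior_of_Sym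
proof (rule conj_cong[OF refl], rule iffI)
  assume X: "X \<in> Sym" and "\<exists>e>0. \<forall>Y\<in>Sym. dist Y X < e \<longrightarrow> Y \<in> Theta_plus F"
  then obtain e where e: "e > 0" "\<And>Y. Y \<in> Sym \<Longrightarrow> dist Y X < e \<Longrightarrow> Y \<in> Theta_plus F" by blast
  obtain t where "t > 0" "dist (shift X (- t)) X < e" using near_shift[OF e(1)] by metis
  then show "\<exists>t>0. 0 \<le> F (shift X (- t))" using e(2)[OF shift_Sym[OF X]] by (auto simp: Theta_plus_def)
next
  assume X: "X \<in> Sym" and "\<exists>t>0. 0 \<le> F (shift X (- t))"
  then obtain t where t: "t > 0" "0 \<le> F (shift X (- t))" by blast
  have "Y \<in> Theta_plus F" if Y: "Y \<in> Sym" "dist Y X < t" for Y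
  proof -
    have d: "dist X Y \<le> t" using Y(2) by (simp add: dist_commute)
    show ?thesis using elliptic_mono(1)[OF F shift_Sym[OF X] Y(1) loewner_le_shift_of_dist(2)[OF X Y(1) d] t(2)] Y(1)
      by (simp add: Theta_plus_def)
  qed
  then show "\<exists>e>0. \<forall>Y\<in>Sym. dist Y X < e \<longrightarrow> Y \<in> Theta_plus F" using t(1) by blast
qed

lemma interior_Theta_minus:
  "X \<in> top_of_set Sym interior_of Theta_minus F \<longleftrightarrow> X \<in> Sym \<and> (\<exists>t>0. F (shift X t) \<le> 0)"
  unfolding in_interior_of_Sym
proof (rule conj_cong[OF refl], rule iffI)
  assume X: "X \<in> Sym" and "\<exists>e>0. \<forall>Y\<in>Sym. dist Y X < e \<longrightarrow> Y \<in> Theta_minus F"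
  then obtain e where e: "e > 0" "\<And>Y. Y \<in> Sym \<Longrightarrow> dist Y X < e \<Longrightarrow> Y \<in> Theta_minus F" by blast
  obtain t where "t > 0" "dist (shift X t) X < e" using near_shift[OF e(1)] by metis
  then show "\<exists>t>0. F (shift X t) \<le> 0" using e(2)[OF shift_Sym[OF X]] by (auto simp: Theta_minus_def)
next
  assume X: "X \<in> Sym" and "\<exists>t>0. F (shift X t) \<le> 0"
  then obtain t where t: "t > 0" "F (shift X t) \<le> 0" by blast
  have "Y \<in> Theta_minus F" if Y: "Y \<in> Sym" "dist Y X < t" for Y
  proof -
    have d: "dist Y X \<le> t" using Y(2) by simp
    show ?thesis using elliptic_mono(3)[OF F Y(1) shift_Sym[OF X] loewner_le_shift_of_dist(1)[OF Y(1) X d] t(2)] Y(1)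
      by (simp add: Theta_minus_def)
  qed
  then show "\<exists>e>0. \<forall>Y\<in>Sym. dist Y X < e \<longrightarrow> Y \<in> Theta_minus F" using t(1) by blast
qed

text \<open>The two reflections cancel and leave the complement of the interior of the closure of
  \<open>Theta_minus F\<close>. That interior equals the interior of \<open>Theta_minus F\<close>
  itself, since half of a shift into the closure already lands in the set.\<close>

lemma in_dual_closure_Theta_minus:
  "X \<in> dual_set (uminus ` (top_of_set Sym closure_of Theta_minus F)) \<longleftrightarrow> X \<in> Sym \<and> (\<forall>t>0. 0 < F (shift X t))"
proof -
  let ?C = "top_of_set Sym closure_of Theta_minus F"
  have int: "(\<exists>e>0. \<forall>Y\<in>Sym. dist Y (- X) < e \<longrightarrow> Y \<in> uminus ` ?C) \<longleftrightarrow> (\<exists>t>0. F (shift X t) \<le> 0)" if X: "X \<in> Sym"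
  proof
    assume "\<exists>e>0. \<forall>Y\<in>Sym. dist Y (- X) < e \<longrightarrow> Y \<in> uminus ` ?C"
    then obtain e where e: "e > 0" "\<And>Y. Y \<in> Sym \<Longrightarrow> dist Y (- X) < e \<Longrightarrow> Y \<in> uminus ` ?C" by blast
    obtain t where t: "t > 0" "dist (shift X t) X < e" using near_shift[OF e(1)] by metis
    have "dist (- shift X t) (- X) < e" using t(2) by (simp add: dist_norm norm_minus_commute)
    then have "- shift X t \<in> uminus ` ?C" using e(2) Sym_minus[OF shift_Sym[OF X]] by blast
    then have "shift X t \<in> ?C" unfolding in_uminus_image by simp
    then have "F (shift (shift X t) (- (t / 2))) \<le> 0" using t(1) unfolding closure_Theta_minus by (meson half_gt_zero)
    then show "\<exists>t>0. F (shift X t) \<le> 0" using t(1) by (intro exI[of _ "t / 2"]) simp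
  next
    assume "\<exists>t>0. F (shift X t) \<le> 0"
    then have "X \<in> top_of_set Sym interior_of Theta_minus F" using X interior_Theta_minus by blast
    then obtain e where e: "e > 0" "\<And>Y. Y \<in> Sym \<Longrightarrow> dist Y X < e \<Longrightarrow> Y \<in> Theta_minus F"
      unfolding in_interior_of_Sym by blast
    have "Y \<in> uminus ` ?C" if Y: "Y \<in> Sym" "dist Y (- X) < e" for Y
    proof -
      have "dist (- Y) X = dist Y (- X)" using norm_minus_cancel[of "Y + X"] by (simp add: dist_norm)
      then have "dist (- Y) X < e" using Y(2) by simp
      then have "- Y \<in> Theta_minus F" using e(2) Sym_minus[OF Y(1)] by blast
      moreover have "Theta_minus F \<subseteq> ?C" by (rule closure_of_subset) (auto simp: Theta_minus_def)
      ultimately have "- Y \<in> ?C" by blast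
      then show ?thesis unfolding in_uminus_image .
    qed
    then show "\<exists>e>0. \<forall>Y\<in>Sym. dist Y (- X) < e \<longrightarrow> Y \<in> uminus ` ?C" using e(1) by blast
  qed
  have "X \<in> dual_set (uminus ` ?C) \<longleftrightarrow> - X \<in> Sym - top_of_set Sym interior_of (uminus ` ?C)"
    unfolding dual_set_def in_uminus_image ..
  also have "\<dots> \<longleftrightarrow> X \<in> Sym \<and> \<not> (\<exists>e>0. \<forall>Y\<in>Sym. dist Y (- X) < e \<longrightarrow> Y \<in> uminus ` ?C)"
    using Sym_minus[of X] Sym_minus[of "- X"] unfolding Diff_iff in_interior_of_Sym by auto
  also have "\<dots> \<longleftrightarrow> X \<in> Sym \<and> (\<forall>t>0. 0 < F (shift X t))"
  proof (rule conj_cong[OF refl])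
    assume X: "X \<in> Sym"
    show "\<not> (\<exists>e>0. \<forall>Y\<in>Sym. dist Y (- X) < e \<longrightarrow> Y \<in> uminus ` ?C) \<longleftrightarrow> (\<forall>t>0. 0 < F (shift X t))"
      unfolding int[OF X] by (auto simp: not_le)
  qed
  finally show ?thesis .
qed

text \<open>Closure and dual differ only in \<open>F (shift X t)\<close> being \<ge> 0 or > 0 for
  all t > 0. Without a gap, the step from t / 2 to t makes the sign strict.\<close>

lemma no_gap_iff_dual:
  "no_gap F \<longleftrightarrow> top_of_set Sym closure_of Theta_plus F
       = dual_set (uminus ` (top_of_set Sym closure_of Theta_minus F))"
proof
  assume N: "no_gap F"
  have "0 < F (shift X t)" if X: "X \<in> Sym" "\<forall>t>0. 0 \<le> F (shift X t)" "t > 0" for X t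
  proof -
    have "\<not> (0 \<le> F (shift X (t / 2)) \<and> F (shift (shift X (t / 2)) (t / 2)) \<le> 0)"
      using N shift_Sym[OF X(1)] X(3) unfolding no_gap_def by (meson half_gt_zero)
    then show ?thesis using X(2,3) by (simp add: not_le)
  qed
  then show "top_of_set Sym closure_of Theta_plus F = dual_set (uminus ` (top_of_set Sym closure_of Theta_minus F))"
    unfolding set_eq_iff closure_Theta_plus in_dual_closure_Theta_minus by (meson less_imp_le)
next
  assume v: "top_of_set Sym closure_of Theta_plus F = dual_set (uminus ` (top_of_set Sym closure_of Theta_minus F))"
  show "no_gap F"
    unfolding no_gap_def
  proof (intro ballI allI impI notI)
    fix X and t :: real assume X: "X \<in> Sym" and t: "t > 0" and g: "0 \<le> F X \<and> F (shift X t) \<le> 0"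
    have "0 \<le> F (shift X s)" if "s > 0" for s using shift_mono(1)[OF X, of 0 s] g that by simp
    then have "X \<in> top_of_set Sym closure_of Theta_plus F" unfolding closure_Theta_plus using X by blast
    then have "0 < F (shift X t)" using t unfolding v in_dual_closure_Theta_minus by blast
    then show False using g by (simp add: not_less[symmetric])
  qed
qed

lemma frontier_Theta_minus:
  "X \<in> top_of_set Sym frontier_of Theta_minus F \<longleftrightarrow>
     X \<in> Sym \<and> (\<forall>t>0. F (shift X (- t)) \<le> 0) \<and> (\<forall>t>0. 0 < F (shift X t))"
  unfolding frontier_of_def Diff_iff closure_Theta_minus interior_Theta_minus by (auto simp: not_le)

lemma frontier_Theta_plus:
  "X \<in> top_of_set Sym frontier_of Theta_plus F \<longleftrightarrow>
     X \<in> Sym \<and> (\<forall>t>0. F (shift X (- t)) < 0) \<and> (\<forall>t>0. 0 \<le> F (shift X t))"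
  unfolding frontier_of_def Diff_iff closure_Theta_plus interior_Theta_plus by (auto simp: not_le)

text \<open>For \<open>F\<close> identically 0 both frontiers are empty although there are gaps, so
  a matrix Y with F Y \<noteq> 0 has to enter. Its sign forces the line through a gap to leave one
  of the sign sets, and the exit point is a frontier point at which the other frontier imposes
  strict signs on the gap.\<close>

lemma no_gap_iff_frontier:
  assumes nz: "\<exists>X\<in>Sym. F X \<noteq> 0"
  shows "no_gap F \<longleftrightarrow> top_of_set Sym frontier_of Theta_minus F = top_of_set Sym frontier_of Theta_plus F"
proof
  assume N: "no_gap F"
  have "F (shift X (- t)) < 0" if X: "X \<in> Sym" "\<forall>t>0. F (shift X (- t)) \<le> 0" "t > 0" for X t
  proof -
    have "\<not> (0 \<le> F (shift X (- t)) \<and> F (shift (shift X (- t)) (t / 2)) \<le> 0)"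
      using N shift_Sym[OF X(1)] X(3) unfolding no_gap_def by (meson half_gt_zero)
    moreover have "F (shift X (- (t / 2))) \<le> 0" using X(2,3) by (meson half_gt_zero)
    ultimately show ?thesis by (simp add: not_le)
  qed
  moreover have "0 < F (shift X t)" if X: "X \<in> Sym" "\<forall>t>0. 0 \<le> F (shift X t)" "t > 0" for X t
  proof -
    have "\<not> (0 \<le> F (shift X (t / 2)) \<and> F (shift (shift X (t / 2)) (t / 2)) \<le> 0)"
      using N shift_Sym[OF X(1)] X(3) unfolding no_gap_def by (meson half_gt_zero)
    then show ?thesis using X(2,3) by (simp add: not_le)
  qed
  ultimately show "top_of_set Sym frontier_of Theta_minus F = top_of_set Sym frontier_of Theta_plus F"
    unfolding set_eq_iff frontier_Theta_minus frontier_Theta_plus by (meson less_imp_le)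
next
  assume vi: "top_of_set Sym frontier_of Theta_minus F = top_of_set Sym frontier_of Theta_plus F"
  obtain Y where Y: "Y \<in> Sym" "F Y \<noteq> 0" using nz by blast
  show "no_gap F"
    unfolding no_gap_def
  proof (intro ballI allI impI notI)
    fix X and t :: real assume X: "X \<in> Sym" and t: "t > 0" and g: "0 \<le> F X \<and> F (shift X t) \<le> 0"
    consider "0 < F Y" | "F Y < 0" using Y(2) by (meson linorder_neqE)
    then show False
    proof cases
      case 1
      \<comment> \<open>Large shifts of X dominate Y, where \<open>F\<close> is positive, so the
        line leaves \<open>Theta_minus F\<close> at s = Sup T. As a point of the frontier of
        \<open>Theta_plus F\<close>, the exit has \<open>F\<close> strictly negative at all lower
        shifts, among them X.\<close>
      define T where "T = {s. F (shift X s) \<le> 0}"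
      have up: "s \<le> dist Y X" if "s \<in> T" for s
      proof (rule ccontr)
        assume "\<not> s \<le> dist Y X"
        then have "loewner_le Y (shift X s)" by (intro loewner_le_shift_of_dist(1) Y X) simp
        then have "0 < F (shift X s)" using elliptic_mono(2)[OF F Y(1) shift_Sym[OF X]] 1 by blast
        then show False using that by (simp add: T_def not_less[symmetric])
      qed
      have bdd: "bdd_above T" by (rule bdd_aboveI) (rule up)
      have ne: "T \<noteq> {}" using g unfolding T_def by blast
      define s where "s = Sup T"
      have s: "s \<ge> t" unfolding s_def using g bdd by (intro cSup_upper) (auto simp: T_def)
      have "F (shift (shift X s) (- u)) \<le> 0" if u: "u > 0" for u
      proof -
        have "s - u < Sup T" using u by (simp add: s_def)
        then obtain s' where s': "s' \<in> T" "s - u < s'" using less_cSup_iff[OF ne bdd] by blast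
        then show ?thesis using shift_mono(3)[OF X, of "s - u" s'] by (simp add: T_def)
      qed
      moreover have "0 < F (shift (shift X s) u)" if "u > 0" for u
      proof -
        have "s + u \<notin> T" using cSup_upper[OF _ bdd, of "s + u"] that by (auto simp: s_def)
        then show ?thesis by (simp add: T_def not_le)
      qed
      ultimately have "shift X s \<in> top_of_set Sym frontier_of Theta_minus F"
        unfolding frontier_Theta_minus using shift_Sym[OF X] by blast
      then have "F (shift (shift X s) (- s)) < 0"
        using s t unfolding vi frontier_Theta_plus by (meson less_le_trans)
      then show False using g by (simp add: not_less[symmetric])
    next
      case 2
      \<comment> \<open>The mirror image: the line is followed downwards from X + t I, with s as the
        distance descended, so that a supremum again gives the exit point.\<close>
      define T where "T = {s. 0 \<le> F (shift X (t - s))}"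
      have up: "s \<le> t + dist X Y" if "s \<in> T" for s
      proof (rule ccontr)
        assume "\<not> s \<le> t + dist X Y"
        then have "loewner_le (shift X (- (s - t))) Y" by (intro loewner_le_shift_of_dist(2) Y X) simp
        then have "F (shift X (t - s)) < 0" using elliptic_mono(4)[OF F shift_Sym[OF X] Y(1)] 2 by simp
        then show False using that by (simp add: T_def not_less[symmetric])
      qed
      have bdd: "bdd_above T" by (rule bdd_aboveI) (rule up)
      have "t \<in> T" using g by (simp add: T_def)
      then have ne: "T \<noteq> {}" by blast
      define s where "s = Sup T"
      have s: "s \<ge> t" unfolding s_def using g bdd by (intro cSup_upper) (auto simp: T_def)
      have "0 \<le> F (shift (shift X (t - s)) u)" if u: "u > 0" for u
      proof -
        have "s - u < Sup T" using u by (simp add: s_def)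
        then obtain s' where s': "s' \<in> T" "s - u < s'" using less_cSup_iff[OF ne bdd] by blast
        then show ?thesis using shift_mono(1)[OF X, of "t - s'" "t - s + u"] by (simp add: T_def)
      qed
      moreover have "F (shift (shift X (t - s)) (- u)) < 0" if "u > 0" for u
      proof -
        have "s + u \<notin> T" using cSup_upper[OF _ bdd, of "s + u"] that by (auto simp: s_def)
        then show ?thesis by (simp add: T_def not_le algebra_simps)
      qed
      ultimately have "shift X (t - s) \<in> top_of_set Sym frontier_of Theta_plus F"
        unfolding frontier_Theta_plus using shift_Sym[OF X] by blast
      then have "0 < F (shift (shift X (t - s)) s)"
        using s t unfolding vi[symmetric] frontier_Theta_minus by (meson less_le_trans)
      then show False using g by (simp add: not_less[symmetric])
    qed
  qed
qed

section \<open>Quadratic polynomials as viscosity solutions, and comparison\<close>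

lemma continuous_imp_usc_on: "continuous_on S f \<Longrightarrow> usc_on S f" for f :: "'a::topological_space \<Rightarrow> real"
  unfolding usc_on_def continuous_on_def using order_tendstoD(2) by blast

lemma continuous_imp_lsc_on: "continuous_on S f \<Longrightarrow> lsc_on S f" for f :: "'a::topological_space \<Rightarrow> real"
  unfolding lsc_on_def continuous_on_def using order_tendstoD(1) by blast

lemma continuous_on_quad: "A \<in> Sym \<Longrightarrow> continuous_on S (quad c p A x)"
  by (intro continuous_at_imp_continuous_on ballI has_derivative_continuous[OF quad_has_derivative])

text \<open>A test function that touches the quadratic from above has a Hessian of at least A, and
  ellipticity carries the sign of F A over to it.\<close>

lemma viscosity_subsolution_quad:
  assumes A: "A \<in> Sym" and FA: "0 \<le> F A"
  shows "viscosity_subsolution F \<Omega> (quad c p A x)"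
  unfolding viscosity_subsolution_def
proof (intro conjI ballI allI impI)
  show "usc_on (closure \<Omega>) (quad c p A x)" by (intro continuous_imp_usc_on continuous_on_quad A)
  fix z \<phi> assume \<phi>: "C2_near \<phi> z \<and> \<phi> z = quad c p A x z \<and> (\<forall>\<^sub>F y in nhds z. quad c p A x y \<le> \<phi> y)"
  have e: "quad (\<phi> z) (p + A *v (z - x)) A z y = quad c p A x y" for y
    using quad_recenter[OF A, of c p x y z] \<phi> by presburger
  have ev: "\<forall>\<^sub>F y in nhds z. 1 * quad (\<phi> z) (p + A *v (z - x)) A z y \<le> 1 * \<phi> y"
    using \<phi> unfolding e by simp
  have H: "hessian \<phi> z \<in> Sym" using hessian_Sym \<phi> by blast
  have "loewner_le A (hessian \<phi> z)"
    unfolding loewner_le_def psd_def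
  proof (intro conjI allI)
    show "hessian \<phi> z - A \<in> Sym" by (intro Sym_diff H A)
    show "0 \<le> e \<bullet> ((hessian \<phi> z - A) *v e)" for e
      using hessian_touching_quad[OF _ A _ ev, of e] \<phi> by (simp add: matrix_vector_mult_diff_rdistrib inner_diff_right)
  qed
  then show "0 \<le> F (hessian \<phi> z)" using elliptic_mono(1)[OF F A H] FA by blast
qed

lemma viscosity_supersolution_quad:
  assumes A: "A \<in> Sym" and FA: "F A \<le> 0"
  shows "viscosity_supersolution F \<Omega> (quad c p A x)"
  unfolding viscosity_supersolution_def
proof (intro conjI ballI allI impI)
  show "lsc_on (closure \<Omega>) (quad c p A x)" by (intro continuous_imp_lsc_on continuous_on_quad A)
  fix z \<phi> assume \<phi>: "C2_near \<phi> z \<and> \<phi> z = quad c p A x z \<and> (\<forall>\<^sub>F y in nhds z. \<phi> y \<le> quad c p A x y)"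
  have e: "quad (\<phi> z) (p + A *v (z - x)) A z y = quad c p A x y" for y
    using quad_recenter[OF A, of c p x y z] \<phi> by presburger
  have ev: "\<forall>\<^sub>F y in nhds z. -1 * quad (\<phi> z) (p + A *v (z - x)) A z y \<le> -1 * \<phi> y"
    using \<phi> unfolding e by simp
  have H: "hessian \<phi> z \<in> Sym" using hessian_Sym \<phi> by blast
  have "loewner_le (hessian \<phi> z) A"
    unfolding loewner_le_def psd_def
  proof (intro conjI allI)
    show "A - hessian \<phi> z \<in> Sym" by (intro Sym_diff H A)
    show "0 \<le> e \<bullet> ((A - hessian \<phi> z) *v e)" for e
      using hessian_touching_quad[OF _ A _ ev, of e] \<phi> by (simp add: matrix_vector_mult_diff_rdistrib inner_diff_right)
  qed
  then show "F (hessian \<phi> z) \<le> 0" using elliptic_mono(3)[OF F H A] FA by blast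
qed

text \<open>Here v - u = t (1 - |x|^2) / 2, which vanishes on the unit sphere and is positive at
  0.\<close>

lemma no_gap_of_comparison:
  assumes cp: "comparison_principle F (ball 0 1)"
  shows "no_gap F"
  unfolding no_gap_def
proof (intro ballI allI impI notI)
  fix X and t :: real assume X: "X \<in> Sym" and t: "t > 0" and g: "0 \<le> F X \<and> F (shift X t) \<le> 0"
  let ?v = "quad (t / 2) 0 X 0" and ?u = "quad 0 0 (shift X t) 0"
  have "viscosity_subsolution F (ball 0 1) ?v" using viscosity_subsolution_quad X g by blast
  moreover have "viscosity_supersolution F (ball 0 1) ?u" using viscosity_supersolution_quad shift_Sym[OF X] g by blast
  moreover have "?v x \<le> ?u x" if "x \<in> frontier (ball 0 1)" for x
    using that by (simp add: frontier_ball quad_def shift_def inner_add_mat add_divide_distrib)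
  ultimately have "?v 0 \<le> ?u 0" using cp unfolding comparison_principle_def by auto
  then show False using t by (simp add: quad_def)
qed

text \<open>Moving \<delta> |x|^2 / 2 to the other side turns a test for the sum with matrix A into
  a test for v with matrix A - \<delta> I. This shift by \<delta> is the reserve on which the
  comparison argument draws.\<close>

lemma visc_sub_of_subsolution:
  assumes v: "viscosity_subsolution F \<Omega> v"
  shows "visc_sub {A. 0 \<le> F (shift A (- \<delta>))} \<Omega> (\<lambda>x. v x + \<delta> / 2 * (norm x)\<^sup>2)"
  unfolding visc_sub_def
proof (intro ballI allI impI)
  fix x p :: "real^'n" and A :: "real^'n^'n" and \<eta> :: real
  assume x: "x \<in> \<Omega>" and A: "A \<in> Sym" and \<eta>: "\<eta> > 0"
    and ev: "\<forall>\<^sub>F y in nhds x. v y + \<delta> / 2 * (norm y)\<^sup>2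
        \<le> v x + \<delta> / 2 * (norm x)\<^sup>2 + p \<bullet> (y - x) + (y - x) \<bullet> (A *v (y - x)) / 2"
  let ?B = "shift A (- \<delta>)"
  let ?\<phi> = "quad (v x) (p - \<delta> *\<^sub>R x) ?B x"
  have B: "?B \<in> Sym" by (rule shift_Sym[OF A])
  have "\<forall>\<^sub>F y in nhds x. v y \<le> ?\<phi> y"
    using ev
  proof eventually_elim
    case (elim y)
    have "(norm y)\<^sup>2 = (norm x)\<^sup>2 + 2 * (x \<bullet> (y - x)) + (norm (y - x))\<^sup>2"
      by (simp add: power2_norm_eq_inner inner_diff_left inner_diff_right inner_commute)
    then have "\<delta> / 2 * (norm y)\<^sup>2 = \<delta> / 2 * (norm x)\<^sup>2 + \<delta> * (x \<bullet> (y - x)) + \<delta> / 2 * (norm (y - x))\<^sup>2"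
      by (simp add: field_simps)
    moreover have "?\<phi> y = v x + p \<bullet> (y - x) - \<delta> * (x \<bullet> (y - x)) + (y - x) \<bullet> (A *v (y - x)) / 2 - \<delta> / 2 * (norm (y - x))\<^sup>2"
      unfolding quad_def shift_def inner_add_mat by (simp add: inner_diff_left field_simps)
    ultimately show ?case using elim by linarith
  qed
  moreover have "?\<phi> x = v x" by (simp add: quad_def)
  ultimately have "0 \<le> F (hessian ?\<phi> x)"
    using v x C2_near_quad[OF B] unfolding viscosity_subsolution_def by blast
  then have "0 \<le> F (shift A (- \<delta>))" unfolding hessian_quad[OF B] .
  then have "0 \<le> F (shift A (\<eta> - \<delta>))" using shift_mono(1)[OF A, of "- \<delta>" "\<eta> - \<delta>"] \<eta> by simp
  then show "A + \<eta> *\<^sub>R mat 1 \<in> {A. 0 \<le> F (shift A (- \<delta>))}"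
    unfolding mem_Collect_eq shift_def[of A \<eta>, symmetric] by simp
qed

lemma visc_sub_of_supersolution:
  assumes u: "viscosity_supersolution F \<Omega> u"
  shows "visc_sub {A. F (- A) \<le> 0} \<Omega> (\<lambda>x. - u x)"
  unfolding visc_sub_def
proof (intro ballI allI impI)
  fix x p :: "real^'n" and A :: "real^'n^'n" and \<eta> :: real
  assume x: "x \<in> \<Omega>" and A: "A \<in> Sym" and \<eta>: "\<eta> > 0"
    and ev: "\<forall>\<^sub>F y in nhds x. - u y \<le> - u x + p \<bullet> (y - x) + (y - x) \<bullet> (A *v (y - x)) / 2"
  let ?\<phi> = "quad (u x) (- p) (- A) x"
  have B: "- A \<in> Sym" by (rule Sym_minus[OF A])
  have "\<forall>\<^sub>F y in nhds x. ?\<phi> y \<le> u y"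
    using ev by eventually_elim (simp add: quad_def uminus_matrix_vector_mult)
  moreover have "?\<phi> x = u x" by (simp add: quad_def)
  ultimately have "F (hessian ?\<phi> x) \<le> 0"
    using u x C2_near_quad[OF B] unfolding viscosity_supersolution_def by blast
  then have "F (- A) \<le> 0" unfolding hessian_quad[OF B] .
  then have "F (shift (- A) (- \<eta>)) \<le> 0" using shift_mono(3)[OF B, of "- \<eta>" 0] \<eta> by simp
  moreover have "- (A + \<eta> *\<^sub>R mat 1) = shift (- A) (- \<eta>)" by (simp add: shift_def)
  ultimately show "A + \<eta> *\<^sub>R mat 1 \<in> {A. F (- A) \<le> 0}" by simp
qed

lemma comparison_of_no_gap:
  assumes N: "no_gap F" and \<Omega>: "open \<Omega>" "bounded \<Omega>"
  shows "comparison_principle F \<Omega>"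
  unfolding comparison_principle_def
proof (intro allI impI ballI, elim conjE)
  fix v u x0
  assume v: "viscosity_subsolution F \<Omega> v" and u: "viscosity_supersolution F \<Omega> u"
    and bd: "\<forall>x\<in>frontier \<Omega>. v x \<le> u x" and x0: "x0 \<in> \<Omega>"
  show "v x0 \<le> u x0"
  proof (rule ccontr)
    assume "\<not> v x0 \<le> u x0"
    then have m: "v x0 - u x0 > 0" by simp
    obtain R where R: "\<And>x. x \<in> closure \<Omega> \<Longrightarrow> norm x \<le> R"
      using bounded_closure[OF \<Omega>(2)] unfolding bounded_iff by blast
    \<comment> \<open>The added term is at most \<delta> R^2 / 2 on the frontier, hence smaller than
      the excess v x0 - u x0, and the strict advantage of x0 over the frontier is kept.\<close>
    define \<delta> where "\<delta> = (v x0 - u x0) / (R\<^sup>2 + 1)"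
    have R1: "R\<^sup>2 + 1 > 0" by (simp add: add_nonneg_pos)
    have \<delta>: "\<delta> > 0" using m R1 by (simp add: \<delta>_def)
    let ?v = "\<lambda>x. v x + \<delta> / 2 * (norm x)\<^sup>2" and ?w = "\<lambda>x. - u x"
    have "usc_on (closure \<Omega>) (\<lambda>x. v x - (- (\<delta> / 2 * (norm x)\<^sup>2)))"
      by (rule usc_on_diff_continuous) (use v in \<open>auto simp: viscosity_subsolution_def intro!: continuous_intros\<close>)
    then have 1: "usc_on (closure \<Omega>) ?v" by simp
    have 2: "usc_on (closure \<Omega>) ?w"
      unfolding usc_on_def
    proof (intro ballI allI impI)
      fix x a assume "x \<in> closure \<Omega>" "- u x < a"
      then have "\<forall>\<^sub>F y in at x within closure \<Omega>. - a < u y"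
        using u unfolding viscosity_supersolution_def lsc_on_def by (meson minus_less_iff)
      then show "\<forall>\<^sub>F y in at x within closure \<Omega>. - u y < a" by eventually_elim simp
    qed
    have 3: "?v y + ?w y < ?v x0 + ?w x0" if y: "y \<in> frontier \<Omega>" for y
    proof -
      have "norm y \<le> R" using R y by (simp add: frontier_def)
      then have "(norm y)\<^sup>2 \<le> R\<^sup>2" by (intro power_mono) auto
      then have "\<delta> / 2 * (norm y)\<^sup>2 \<le> \<delta> / 2 * R\<^sup>2" using \<delta> by (intro mult_left_mono) auto
      also have "\<dots> < \<delta> * (R\<^sup>2 + 1)" using \<delta> by (simp add: distrib_left add_nonneg_pos)
      also have "\<dots> = v x0 - u x0" using R1 by (simp add: \<delta>_def)
      finally have "\<delta> / 2 * (norm y)\<^sup>2 < v x0 - u x0" .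
      moreover have "v y - u y \<le> 0" using bd y by simp
      moreover have "0 \<le> \<delta> / 2 * (norm x0)\<^sup>2" using \<delta> by simp
      ultimately show ?thesis by linarith
    qed
    obtain A where A: "A \<in> Sym" "\<And>\<eta>. \<eta> > 0 \<Longrightarrow> A + \<eta> *\<^sub>R mat 1 \<in> {A. 0 \<le> F (shift A (- \<delta>))}"
      "\<And>\<eta>. \<eta> > 0 \<Longrightarrow> - A + \<eta> *\<^sub>R mat 1 \<in> {A. F (- A) \<le> 0}"
      using visc_sum_max_principle[OF \<Omega> 1 visc_sub_of_subsolution[OF v] 2 visc_sub_of_supersolution[OF u] x0 3] by blast
    \<comment> \<open>With \<eta> = \<delta> / 4 on both sides, \<open>F\<close> is \<ge> 0 at A -
      (3 \<delta> / 4) I and \<le> 0 at A - (\<delta> / 4) I, a gap of length \<delta> / 2.\<close>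
    have "0 \<le> F (shift A (\<delta> / 4 - \<delta>))"
      using A(2)[of "\<delta> / 4"] \<delta> unfolding mem_Collect_eq shift_def[of A "\<delta> / 4", symmetric] by simp
    moreover have "F (shift A (- (\<delta> / 4))) \<le> 0"
    proof -
      have "- (- A + (\<delta> / 4) *\<^sub>R mat 1) = shift A (- (\<delta> / 4))" by (simp add: shift_def)
      then show ?thesis using A(3)[of "\<delta> / 4"] \<delta> by simp
    qed
    then have "F (shift (shift A (\<delta> / 4 - \<delta>)) (\<delta> / 2)) \<le> 0" by (simp add: field_simps)
    ultimately show False using N shift_Sym[OF A(1)] \<delta> unfolding no_gap_def by (meson half_gt_zero)
  qed
qed

lemma no_gap_iff_comparison:
  "no_gap F \<longleftrightarrow> (\<forall>\<Omega>. open \<Omega> \<and> bounded \<Omega> \<longrightarrow> comparison_principle F \<Omega>)"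
  using comparison_of_no_gap no_gap_of_comparison by (meson bounded_ball open_ball)

end

theorem proposition2p6:
  fixes F :: "real^'n^'n \<Rightarrow> ereal"
  assumes "elliptic_at_0 F"
    and "\<exists>X\<in>Sym. F X \<noteq> 0"
  shows "all_equivalent
    [\<forall>\<Omega>. open \<Omega> \<and> bounded \<Omega> \<longrightarrow> comparison_principle F \<Omega>,
     \<not> (\<exists>X\<in>Sym. \<exists>r>0. ball X r \<inter> Sym \<subseteq> Gamma_0 F),
     \<forall>X\<in>Sym. (SUP t\<in>{t. X + t *\<^sub>R mat 1 \<in> Theta_minus F}. ereal t)
            = (INF t\<in>{t. X + t *\<^sub>R mat 1 \<in> Theta_plus F}. ereal t),
     \<forall>X0\<in>Gamma_0 F. \<forall>t>0. F (X0 - t *\<^sub>R mat 1) < 0 \<and> 0 < F (X0 + t *\<^sub>R mat 1),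
     top_of_set Sym closure_of Theta_plus F
       = dual_set (uminus ` (top_of_set Sym closure_of Theta_minus F)),
     top_of_set Sym frontier_of Theta_minus F = top_of_set Sym frontier_of Theta_plus F]"
  unfolding all_equivalent_def no_gap_iff_comparison[OF assms(1), symmetric]
    no_gap_iff_no_ball[OF assms(1), symmetric] no_gap_iff_sup_eq_inf[OF assms(1), symmetric]
    no_gap_iff_strict[OF assms(1), symmetric] no_gap_iff_dual[OF assms(1), symmetric]
    no_gap_iff_frontier[OF assms, symmetric]
  by simp

end
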